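(* Let $F_C$ be the inhomogeneous self-similar set with non-empty compact condensation set $C$ generated by an iterated function system $\mathbb{I}$ of similarities on a compact metric space, let $F_\emptyset$ be the homogeneous attractor of $\mathbb{I}$, and let $s$ be the similarity dimension of $F_\emptyset$. Regardless of separation conditions, the lower box dimension of $F_C$ is not in general given by a function of the numbers $$\underline{\dim}_{\mathrm B}C,\ \overline{\dim}_{\mathrm B}C,\ \dim_{\mathrm H}C,\ \dim_{\mathrm P}C,\ \dim_{\mathrm B}F_\emptyset\ \text{ and }\ s.$$ This is in stark contrast to the situation for the countably stable dimensions and the upper box dimension.
   Context: Let $(X,d)$ be a compact metric space. An iterated function system (IFS) of similarities on $X$ is a finite collection $\mathbb{I}=\{S_1,\dots,S_N\}$ of maps $S_i:X\to X$ such that for each $i$ there is a constant $\mathrm{Lip}(S_i)\in(0,1)$ with $d(S_i(x),S_i(y))=\mathrm{Lip}(S_i)\,d(x,y)$ for all $x,y\in X$. The homogeneous attractor $F_\emptyset$ is the unique non-empty compact set with $F_\emptyset=\bigcup_{i=1}^N S_i(F_\emptyset)$. For a non-empty compact set $C\subseteq X$ (the condensation set), the inhomogeneous attractor $F_C$ is the unique non-empty compact set with $F_C=\bigcup_{i=1}^N S_i(F_C)\cup C$. The similarity dimension $s$ is the unique solution of $\sum_{i=1}^N \mathrm{Lip}(S_i)^s=1$. For a non-empty set $E\subseteq X$ and $\delta>0$, $N_\delta(E)$ is the minimum number of sets of diameter $\delta$ required to cover $E$; the lower and upper box dimensions $\underline{\dim}_{\mathrm B}E$ and $\overline{\dim}_{\mathrm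 B}E$ are the $\liminf$ and $\limsup$, respectively, of $\frac{\log N_\delta(E)}{-\log\delta}$ as $\delta\to0$; the box dimension $\dim_{\mathrm B}E$ is their common value when they coincide (which is always the case for $E=F_\emptyset$). $\dim_{\mathrm H}$ and $\dim_{\mathrm P}$ denote Hausdorff and packing dimension. A dimension is countably stable if the dimension of a countable union of sets equals the supremum of the individual dimensions; Hausdorff and packing dimension are examples. The situation referred to in the last sentence of the claim is the following. For every countably stable dimension $\dim$ one has $\dim F_C=\max\{\dim F_\emptyset,\dim C\}$. For the upper box dimension one always has $\max\{\overline{\dim}_{\mathrm B}F_\emptyset,\overline{\dim}_{\mathrm B}C\}\le\overline{\dim}_{\mathrm B}F_C\le\max\{s,\overline{\dim}_{\mathrm B}C\}$, and $\overline{\dim}_{\mathrm B}F_C=\max\{\overline{\dim}_{\mathrm B}F_\emptyset,\overline{\dim}_{\mathrm B}C\}$ whenever $\mathbb{I}$ satisfies the strong open set condition, i.e. there is a non-empty open set $U$ with $F_\emptyset\cap U\neq\emptyset$ and $\bigcup_{i=1}^N S_i(U)\subseteq U$ with the union disjoint. *)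

theory Defs
  imports "HOL-Analysis.Analysis"
begin

section \<open>Dimensions of subsets of a metric space\<close>

definition set_diam :: "'a metric \<Rightarrow> 'a set \<Rightarrow> real" where
  "set_diam X U = (if U = {} then 0 else SUP (x, y) \<in> U \<times> U. mdist X x y)"

text \<open>As usual, the covering sets have diameter at most \<open>\<delta>\<close>: in a general metric space there
  need not be any set of diameter exactly \<open>\<delta>\<close>.\<close>

definition covering_number :: "'a metric \<Rightarrow> real \<Rightarrow> 'a set \<Rightarrow> nat" where
  "covering_number X \<delta> E = (LEAST n. \<exists>\<U>. finite \<U> \<and> card \<U> = n \<and>
     (\<forall>U\<in>\<U>. U \<subseteq> mspace X \<and> set_diam X U \<le> \<delta>) \<and> E \<subseteq> \<Union>\<U>)"

definition lower_box_dim :: "'a metric \<Rightarrow> 'a set \<Rightarrow> ereal" where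
  "lower_box_dim X E =
     Liminf (at_right 0) (\<lambda>\<delta>. ereal (ln (real (covering_number X \<delta> E)) / - ln \<delta>))"

definition upper_box_dim :: "'a metric \<Rightarrow> 'a set \<Rightarrow> ereal" where
  "upper_box_dim X E =
     Limsup (at_right 0) (\<lambda>\<delta>. ereal (ln (real (covering_number X \<delta> E)) / - ln \<delta>))"

definition has_box_dim :: "'a metric \<Rightarrow> 'a set \<Rightarrow> ereal \<Rightarrow> bool" where
  "has_box_dim X E t \<longleftrightarrow> lower_box_dim X E = t \<and> upper_box_dim X E = t"

definition hausdorff_premeasure :: "'a metric \<Rightarrow> real \<Rightarrow> real \<Rightarrow> 'a set \<Rightarrow> ennreal" where
  "hausdorff_premeasure X s \<delta> E =
     (INF U \<in> {U :: nat \<Rightarrow> 'a set. (\<forall>n. U n \<subseteq> mspace X \<and> set_diam X (U n) \<le> \<delta>) \<and> E \<subseteq> (\<Union>n. U n)}.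
        \<Sum>n. ennreal (set_diam X (U n) powr s))"

definition hausdorff_measure :: "'a metric \<Rightarrow> real \<Rightarrow> 'a set \<Rightarrow> ennreal" where
  "hausdorff_measure X s E = (SUP \<delta> \<in> {0<..}. hausdorff_premeasure X s \<delta> E)"

text \<open>The infimum runs over \<open>s > 0\<close>, which does not change its value and avoids
  the convention \<open>0 powr 0 = 0\<close>.\<close>

definition hausdorff_dim :: "'a metric \<Rightarrow> 'a set \<Rightarrow> ereal" where
  "hausdorff_dim X E = Inf {ereal s | s. 0 < s \<and> hausdorff_measure X s E = 0}"

text \<open>A \<open>\<delta>\<close>-packing of \<open>E\<close> is a family of pairwise disjoint closed balls with centres in \<open>E\<close>
  and radii at most \<open>\<delta>\<close>, given as pairs (centre, radius).  The supremum over countable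
  packings equals the one over finite packings.\<close>

definition is_packing :: "'a metric \<Rightarrow> real \<Rightarrow> 'a set \<Rightarrow> ('a \<times> real) set \<Rightarrow> bool" where
  "is_packing X \<delta> E K \<longleftrightarrow> finite K \<and> (\<forall>(x, \<rho>) \<in> K. x \<in> E \<and> 0 < \<rho> \<and> \<rho> \<le> \<delta>) \<and>
     pairwise (\<lambda>(x, \<rho>) (y, \<sigma>). disjnt (mcball_of X x \<rho>) (mcball_of X y \<sigma>)) K"

definition packing_premeasure :: "'a metric \<Rightarrow> real \<Rightarrow> 'a set \<Rightarrow> ennreal" where
  "packing_premeasure X s E =
     (INF \<delta> \<in> {0<..}. SUP K \<in> {K. is_packing X \<delta> E K}. ennreal (\<Sum>(x, \<rho>) \<in> K. (2 * \<rho>) powr s))"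

text \<open>The packing premeasure is not countably subadditive, hence the second step.\<close>

definition packing_measure :: "'a metric \<Rightarrow> real \<Rightarrow> 'a set \<Rightarrow> ennreal" where
  "packing_measure X s E =
     (INF A \<in> {A :: nat \<Rightarrow> 'a set. (\<forall>n. A n \<subseteq> mspace X) \<and> E \<subseteq> (\<Union>n. A n)}.
        \<Sum>n. packing_premeasure X s (A n))"

definition packing_dim :: "'a metric \<Rightarrow> 'a set \<Rightarrow> ereal" where
  "packing_dim X E = Inf {ereal s | s. 0 < s \<and> packing_measure X s E = 0}"

text \<open>Besides countable stability, the only property of a ``dimension'' that is required here is
  its invariance under similarities; every bi-Lipschitz invariant dimension has it.
  Finite unions are covered by repeating sets, and monotonicity follows.\<close>

definition countably_stable_dim :: "'a metric \<Rightarrow> ('a set \<Rightarrow> ereal) \<Rightarrow> bool" where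
  "countably_stable_dim X dm \<longleftrightarrow>
     (\<forall>E :: nat \<Rightarrow> 'a set. (\<forall>n. E n \<noteq> {} \<and> E n \<subseteq> mspace X) \<longrightarrow>
        dm (\<Union>n. E n) = (SUP n. dm (E n))) \<and>
     (\<forall>E f c. E \<noteq> {} \<and> E \<subseteq> mspace X \<and> f \<in> E \<rightarrow> mspace X \<and> 0 < c \<and>
        (\<forall>x\<in>E. \<forall>y\<in>E. mdist X (f x) (f y) = c * mdist X x y) \<longrightarrow> dm (f ` E) = dm E)"


section \<open>Inhomogeneous self-similar sets\<close>

text \<open>The maps \<open>S 0, \<dots>, S (N - 1)\<close> come with their ratios \<open>r i\<close>, i.e. \<open>Lip (S i)\<close>; the ratios
  are determined by the maps as soon as the space has two points.\<close>

definition similarity_ifs ::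
    "'a metric \<Rightarrow> nat \<Rightarrow> (nat \<Rightarrow> 'a \<Rightarrow> 'a) \<Rightarrow> (nat \<Rightarrow> real) \<Rightarrow> bool" where
  "similarity_ifs X N S r \<longleftrightarrow> 1 \<le> N \<and>
     (\<forall>i<N. S i \<in> mspace X \<rightarrow> mspace X \<and> 0 < r i \<and> r i < 1 \<and>
        (\<forall>x\<in>mspace X. \<forall>y\<in>mspace X. mdist X (S i x) (S i y) = r i * mdist X x y))"

text \<open>The case \<open>C = {}\<close> is the homogeneous attractor.  On a compact space there is exactly one
  such \<open>F\<close> for every compact \<open>C\<close>.\<close>

definition is_attractor ::
    "'a metric \<Rightarrow> nat \<Rightarrow> (nat \<Rightarrow> 'a \<Rightarrow> 'a) \<Rightarrow> 'a set \<Rightarrow> 'a set \<Rightarrow> bool" where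
  "is_attractor X N S C F \<longleftrightarrow>
     F \<noteq> {} \<and> compactin (mtopology_of X) F \<and> F = (\<Union>i<N. S i ` F) \<union> C"

definition is_similarity_dim :: "nat \<Rightarrow> (nat \<Rightarrow> real) \<Rightarrow> real \<Rightarrow> bool" where
  "is_similarity_dim N r s \<longleftrightarrow> (\<Sum>i<N. r i powr s) = 1"

definition inhomogeneous_system ::
    "'a metric \<Rightarrow> nat \<Rightarrow> (nat \<Rightarrow> 'a \<Rightarrow> 'a) \<Rightarrow> (nat \<Rightarrow> real) \<Rightarrow> 'a set \<Rightarrow> 'a set \<Rightarrow> 'a set \<Rightarrow> real \<Rightarrow> bool"
    where
  "inhomogeneous_system X N S r C F0 FC s \<longleftrightarrow>
     compact_space (mtopology_of X) \<and> similarity_ifs X N S r \<and>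
     C \<noteq> {} \<and> compactin (mtopology_of X) C \<and>
     is_attractor X N S {} F0 \<and> is_attractor X N S C FC \<and> is_similarity_dim N r s"


section \<open>Separation conditions\<close>

type_synonym 'a separation_condition =
  "'a metric \<Rightarrow> nat \<Rightarrow> (nat \<Rightarrow> 'a \<Rightarrow> 'a) \<Rightarrow> 'a set \<Rightarrow> 'a set \<Rightarrow> 'a set \<Rightarrow> bool"

definition no_separation :: "'a separation_condition" where
  "no_separation X N S C F0 FC \<longleftrightarrow> True"

definition strong_open_set_condition :: "'a separation_condition" where
  "strong_open_set_condition X N S C F0 FC \<longleftrightarrow>
     (\<exists>U. openin (mtopology_of X) U \<and> F0 \<inter> U \<noteq> {} \<and>
        (\<Union>i<N. S i ` U) \<subseteq> U \<and> disjoint_family_on (\<lambda>i. S i ` U) {..<N})"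

text \<open>All pieces in \<open>FC = (\<Union>i<N. S i ` FC) \<union> C\<close> are disjoint.  Since \<open>F0 \<subseteq> FC\<close>, this
  includes the usual strong separation condition for \<open>F0\<close>.\<close>

definition strong_separation_condition :: "'a separation_condition" where
  "strong_separation_condition X N S C F0 FC \<longleftrightarrow>
     disjoint_family_on (\<lambda>i. S i ` FC) {..<N} \<and> (\<forall>i<N. S i ` FC \<inter> C = {})"


section \<open>Dependence of the lower box dimension on other numbers\<close>

text \<open>A compact metric space has at most continuum many points, so every compact metric space is
  isometric to one whose carrier is a set of reals, with an arbitrary metric (not necessarily
  the Euclidean one).  Quantifying over \<open>X :: real metric\<close> thus covers all of them.\<close>

definition lower_box_dim_given_by ::
    "real separation_condition \<Rightarrow>
     (ereal \<Rightarrow> ereal \<Rightarrow> ereal \<Rightarrow> ereal \<Rightarrow> ereal \<Rightarrow> real \<Rightarrow> ereal) \<Rightarrow> bool" where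
  "lower_box_dim_given_by Q \<phi> \<longleftrightarrow>
     (\<forall>(X :: real metric) N S r C F0 FC s t.
        inhomogeneous_system X N S r C F0 FC s \<and> Q X N S C F0 FC \<and> has_box_dim X F0 t \<longrightarrow>
        lower_box_dim X FC =
          \<phi> (lower_box_dim X C) (upper_box_dim X C) (hausdorff_dim X C) (packing_dim X C) t s)"

end

theory Submission
  imports Defs
begin

text \<open>
  The proof of the negative part produces two systems with equal data and different lower box
  dimensions of \<open>FC\<close>.  Both consist of two maps of ratio \<open>1/2\<close> whose copies of \<open>FC\<close> are well
  separated, so that the covering numbers \<open>N \<delta>\<close> of \<open>FC\<close> satisfy, for small \<open>\<delta>\<close>,
  \<open>2 * N (2\<delta>) \<le> N \<delta> \<le> 2 * N (2\<delta>) + (covering number of C at scale \<delta>)\<close>.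
  If \<open>C\<close> has covering number \<open>2 ^ h n\<close> at scale \<open>(1/2) ^ n\<close>, it follows that \<open>log 2 (N ((1/2) ^ n))\<close> is,
  up to a term of order \<open>log n\<close>, the maximum of \<open>n\<close> and of \<open>n - m + h m\<close> over \<open>m \<le> n\<close>.  Thus \<open>FC\<close> remembers
  the coarse scales \<open>m\<close> at which \<open>C\<close> is large, and its lower box dimension depends on how
  regularly they occur, whereas \<open>liminf h n / n\<close> and \<open>limsup h n / n\<close> do not see this.

  In the two systems \<open>h\<close> jumps at the places \<open>a j = 2 ^ (j^2)\<close> to a height \<open>b j \<ge> 2 ^ j * a j\<close>, stays
  there until the diagonal \<open>n\<close> has caught up, and follows the diagonal until the next jump.  In
  both cases the lower and upper box dimensions of \<open>C\<close> are \<open>1\<close> and \<open>\<infinity>\<close>; as \<open>C\<close> is countable, its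
  Hausdorff and packing dimensions vanish; and \<open>F0\<close> is a Cantor set of dimension \<open>s = 1\<close>.  If
  \<open>b j = a (j + 1)\<close>, every \<open>n\<close> is preceded by a jump of height at least \<open>n\<close>, and \<open>FC\<close> has lower
  box dimension at least \<open>3/2\<close> (\<open>lower_box_dim_FC_ge_adjacent_jumps\<close>).  If \<open>b j = 2 ^ j * a j\<close>, the jump
  is negligible compared with \<open>n\<close> shortly before the next one, and the lower box dimension is at
  most \<open>5/4\<close> (\<open>lower_box_dim_FC_le_sparse_jumps\<close>).

  The underlying space consists of sequences of natural numbers, two of which have distance
  \<open>(1/2) ^ m\<close> if \<open>m\<close> is the first place where they differ, coded injectively by real numbers.  In
  it a countable compact \<open>C\<close> can have any nondecreasing sequence of positive integers as its covering
  numbers at the scales \<open>(1/2) ^ n\<close> with \<open>n \<ge> 1\<close>.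

  The positive part rests on \<open>FC = F0 \<union> (\<Union>w. S w ` C)\<close>, where \<open>w\<close> ranges over the finite words and
  \<open>S w\<close> is the corresponding composition (\<open>attractor_eq_orbital_union\<close>); a countably stable dimension
  cannot distinguish \<open>C\<close> from its similar images.  The bound on the upper box dimension comes from
  \<open>N \<delta> \<le> (\<Sum>i. N (\<delta> / r i)) + (covering number of C)\<close>, which propagates a bound \<open>A * \<delta> powr - t\<close> from
  coarse to fine scales whenever \<open>(\<Sum>i. r i powr t) < 1\<close>.  Under the strong open set condition some
  piece \<open>S u ` F0\<close> lies in the open set \<open>U\<close>, so that the sets \<open>S w ` S u ` F0\<close> with \<open>w\<close> of a fixed length are
  disjoint and compact, hence separated, and the recursion can be reversed to give \<open>s\<close> as a lower
  bound for the box dimension of \<open>F0\<close>.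
\<close>

section \<open>Diameters and covering numbers\<close>

lemma mdist_self: "x \<in> mspace X \<Longrightarrow> mdist X x x = 0"
  by simp

lemma compact_metric_bounded:
  assumes "compact_space (mtopology_of X)"
  obtains D where "0 < D" "\<And>x y. x \<in> mspace X \<Longrightarrow> y \<in> mspace X \<Longrightarrow> mdist X x y \<le> D"
proof -
  interpret Metric_space "mspace X" "mdist X" by blast
  have "mbounded (mspace X)"
    using assms by (metis compactin_imp_mbounded compact_space_def mtopology_of_def topspace_mtopology)
  then obtain D where "D > 0" "\<forall>x\<in>mspace X. \<forall>y\<in>mspace X. mdist X x y \<le> D"
    unfolding mbounded_alt_pos by auto
  then show ?thesis using that by simp
qed

lemma set_diam_le:
  assumes "0 \<le> d" "\<And>x y. x \<in> U \<Longrightarrow> y \<in> U \<Longrightarrow> mdist X x y \<le> d"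
  shows "set_diam X U \<le> d"
proof (cases "U = {}")
  case False
  then have "(SUP (x, y) \<in> U \<times> U. mdist X x y) \<le> d"
    using assms(2) by (intro cSUP_least) auto
  then show ?thesis unfolding set_diam_def if_not_P[OF False] .
qed (use assms(1) in \<open>simp add: set_diam_def\<close>)

lemma mdist_le_set_diam:
  assumes "compact_space (mtopology_of X)" "U \<subseteq> mspace X" "x \<in> U" "y \<in> U"
  shows "mdist X x y \<le> set_diam X U"
proof -
  obtain D where "0 < D"
    and D: "\<And>x y. x \<in> mspace X \<Longrightarrow> y \<in> mspace X \<Longrightarrow> mdist X x y \<le> D"
    using compact_metric_bounded[OF assms(1)] by metis
  have "bdd_above ((\<lambda>(x, y). mdist X x y) ` (U \<times> U))"
    using D assms(2) by (intro bdd_aboveI[of _ D]) auto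
  then have "(case (x, y) of (x, y) \<Rightarrow> mdist X x y) \<le> (SUP (x, y) \<in> U \<times> U. mdist X x y)"
    using assms(3,4) by (rule_tac cSUP_upper) (simp_all only: mem_Sigma_iff)
  moreover have "U \<noteq> {}" using assms(3) by blast
  ultimately show ?thesis unfolding set_diam_def by (simp only: if_False prod.case)
qed

lemma set_diam_nonneg:
  assumes "compact_space (mtopology_of X)" "U \<subseteq> mspace X"
  shows "0 \<le> set_diam X U"
proof (cases "U = {}")
  case False
  then obtain x where "x \<in> U" by blast
  then show ?thesis by (rule_tac order_trans[OF mdist_nonneg mdist_le_set_diam[OF assms, of x x]])
qed (simp add: set_diam_def)

text \<open>Covers are handled through colourings: a cover of \<open>E\<close> by \<open>n\<close> sets of diameter at most \<open>\<delta>\<close> amounts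
  to a map on \<open>E\<close> with \<open>n\<close> values whose level sets have diameter at most \<open>\<delta>\<close>.  Colourings can be
  restricted, pulled back along maps and combined without any bookkeeping of covering sets.\<close>

definition colouring :: "'a metric \<Rightarrow> real \<Rightarrow> 'a set \<Rightarrow> ('a \<Rightarrow> 'b) \<Rightarrow> bool" where
  "colouring X \<delta> E f \<longleftrightarrow> (\<forall>x\<in>E. \<forall>y\<in>E. f x = f y \<longrightarrow> mdist X x y \<le> \<delta>)"

lemma covering_number_le_colouring:
  assumes "colouring X \<delta> E f" "E \<subseteq> mspace X" "0 \<le> \<delta>" "finite (f ` E)"
  shows "covering_number X \<delta> E \<le> card (f ` E)"
proof -
  let ?U = "(\<lambda>c. {x \<in> E. f x = c}) ` f ` E"
  have "inj_on (\<lambda>c. {x \<in> E. f x = c}) (f ` E)" by (auto simp: inj_on_def)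
  then have card: "card ?U = card (f ` E)" by (rule card_image)
  have "\<exists>\<U>. finite \<U> \<and> card \<U> = card (f ` E) \<and>
     (\<forall>U\<in>\<U>. U \<subseteq> mspace X \<and> set_diam X U \<le> \<delta>) \<and> E \<subseteq> \<Union>\<U>"
  proof (intro exI[of _ ?U] conjI ballI)
    fix U assume "U \<in> ?U"
    then show "U \<subseteq> mspace X" using assms(2) by auto
    show "set_diam X U \<le> \<delta>"
      using \<open>U \<in> ?U\<close> assms by (intro set_diam_le) (auto simp: colouring_def)
  qed (use assms card in auto)
  then show ?thesis unfolding covering_number_def by (rule Least_le)
qed

lemma finite_cover_exists:
  assumes "compact_space (mtopology_of X)" "E \<subseteq> mspace X" "0 < \<delta>"
  shows "\<exists>\<U>. finite \<U> \<and> (\<forall>U\<in>\<U>. U \<subseteq> mspace X \<and> set_diam X U \<le> \<delta>) \<and> E \<subseteq> \<Union>\<U>"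
proof -
  interpret Metric_space "mspace X" "mdist X" by blast
  have "mtotally_bounded (mspace X)"
    using assms(1) by (metis compact_space_eq_mcomplete_mtotally_bounded mtopology_of_def)
  then obtain K where K: "finite K" "K \<subseteq> mspace X" "mspace X \<subseteq> (\<Union>x\<in>K. mball x (\<delta>/2))"
    using assms(3) unfolding mtotally_bounded_def by (meson half_gt_zero)
  have "set_diam X (mball x (\<delta>/2)) \<le> \<delta>" for x
  proof (rule set_diam_le)
    fix y z assume "y \<in> mball x (\<delta>/2)" "z \<in> mball x (\<delta>/2)"
    then have "mdist X y z \<le> mdist X y x + mdist X x z" "mdist X x y < \<delta>/2" "mdist X x z < \<delta>/2"
      using triangle by auto
    then show "mdist X y z \<le> \<delta>" by (simp add: mdist_commute[of X y])
  qed (use assms in simp)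
  then show ?thesis
    using K assms(2) by (intro exI[of _ "(\<lambda>x. mball x (\<delta>/2)) ` K"]) fastforce
qed

lemma covering_number_colouring:
  assumes "compact_space (mtopology_of X)" "E \<subseteq> mspace X" "0 < \<delta>"
  obtains f :: "'a \<Rightarrow> 'a set" where "colouring X \<delta> E f" "finite (f ` E)"
    "card (f ` E) = covering_number X \<delta> E"
proof -
  let ?P = "\<lambda>n. \<exists>\<U>. finite \<U> \<and> card \<U> = n \<and>
     (\<forall>U\<in>\<U>. U \<subseteq> mspace X \<and> set_diam X U \<le> \<delta>) \<and> E \<subseteq> \<Union>\<U>"
  have "\<exists>n. ?P n" using finite_cover_exists[OF assms] by blast
  then have "?P (covering_number X \<delta> E)" unfolding covering_number_def by (rule LeastI_ex)
  then obtain \<U> where U: "finite \<U>" "card \<U> = covering_number X \<delta> E"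
     "\<And>U. U\<in>\<U> \<Longrightarrow> U \<subseteq> mspace X \<and> set_diam X U \<le> \<delta>" "E \<subseteq> \<Union>\<U>" by blast
  then have "\<forall>x\<in>E. \<exists>U\<in>\<U>. x \<in> U" by blast
  then obtain f where f: "\<And>x. x \<in> E \<Longrightarrow> f x \<in> \<U> \<and> x \<in> f x" by metis
  have col: "colouring X \<delta> E f" unfolding colouring_def
  proof (intro ballI impI)
    fix x y assume xy: "x \<in> E" "y \<in> E" "f x = f y"
    then have "mdist X x y \<le> set_diam X (f x)"
      using f U(3) by (intro mdist_le_set_diam assms) auto
    then show "mdist X x y \<le> \<delta>" using U(3) f xy by (meson order_trans)
  qed
  have sub: "f ` E \<subseteq> \<U>" using f by auto
  then have fin: "finite (f ` E)" using U(1) finite_subset by blast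
  have "card (f ` E) \<le> covering_number X \<delta> E" using sub U card_mono by metis
  moreover have "covering_number X \<delta> E \<le> card (f ` E)"
    using covering_number_le_colouring[OF col assms(2) _ fin] assms(3) by simp
  ultimately show ?thesis using that col fin by simp
qed

lemma covering_number_antimono:
  assumes "compact_space (mtopology_of X)" "E \<subseteq> E'" "E' \<subseteq> mspace X" "0 < \<delta>'" "\<delta>' \<le> \<delta>"
  shows "covering_number X \<delta> E \<le> covering_number X \<delta>' E'"
proof -
  obtain f :: "'a \<Rightarrow> 'a set" where f: "colouring X \<delta>' E' f" "finite (f ` E')"
    "card (f ` E') = covering_number X \<delta>' E'"
    using covering_number_colouring[OF assms(1,3,4)] .
  have fin: "finite (f ` E)" using assms(2) f(2) by (meson finite_subset image_mono)
  have "colouring X \<delta> E f" using f(1) assms unfolding colouring_def by (meson order_trans subsetD)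
  then have "covering_number X \<delta> E \<le> card (f ` E)"
    using fin assms by (intro covering_number_le_colouring) auto
  also have "\<dots> \<le> card (f ` E')" using assms(2) f(2) by (intro card_mono) auto
  finally show ?thesis using f(3) by simp
qed

lemma covering_number_pos:
  assumes "compact_space (mtopology_of X)" "E \<subseteq> mspace X" "0 < \<delta>" "E \<noteq> {}"
  shows "1 \<le> covering_number X \<delta> E"
proof -
  obtain f :: "'a \<Rightarrow> 'a set" where f: "finite (f ` E)" "card (f ` E) = covering_number X \<delta> E"
    using covering_number_colouring[OF assms(1-3)] .
  then show ?thesis using assms(4) by (metis One_nat_def Suc_leI card_gt_0_iff image_is_empty)
qed

lemma covering_number_empty: "covering_number X \<delta> {} = 0"
  unfolding covering_number_def by (rule Least_eq_0) auto

lemma covering_number_small_set: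
  assumes "E \<subseteq> mspace X" "0 \<le> \<delta>" "\<And>x y. x \<in> E \<Longrightarrow> y \<in> E \<Longrightarrow> mdist X x y \<le> \<delta>"
  shows "covering_number X \<delta> E \<le> 1"
proof -
  have "covering_number X \<delta> E \<le> card ((\<lambda>_. ()) ` E)"
    using assms by (intro covering_number_le_colouring) (auto simp: colouring_def)
  also have "\<dots> \<le> 1" by (metis UNIV_unit card.empty card_mono finite subset_UNIV card_UNIV_unit)
  finally show ?thesis .
qed

lemma covering_number_Un:
  assumes "compact_space (mtopology_of X)" "A \<subseteq> mspace X" "B \<subseteq> mspace X" "0 < \<delta>"
  shows "covering_number X \<delta> (A \<union> B) \<le> covering_number X \<delta> A + covering_number X \<delta> B"
proof -
  obtain f :: "'a \<Rightarrow> 'a set" where f: "colouring X \<delta> A f" "finite (f ` A)"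
    "card (f ` A) = covering_number X \<delta> A"
    using covering_number_colouring[OF assms(1,2,4)] .
  obtain g :: "'a \<Rightarrow> 'a set" where g: "colouring X \<delta> B g" "finite (g ` B)"
    "card (g ` B) = covering_number X \<delta> B"
    using covering_number_colouring[OF assms(1,3,4)] .
  define h where "h x = (if x \<in> A then Inl (f x) else Inr (g x))" for x
  have sub: "h ` (A \<union> B) \<subseteq> Inl ` f ` A \<union> Inr ` g ` B" by (auto simp: h_def)
  have fin: "finite (Inl ` f ` A \<union> Inr ` g ` B :: ('a set + 'a set) set)" using f g by auto
  have "covering_number X \<delta> (A \<union> B) \<le> card (h ` (A \<union> B))"
    using assms f(1) g(1) finite_subset[OF sub fin]
    by (intro covering_number_le_colouring) (auto simp: colouring_def h_def split: if_splits)
  also have "\<dots> \<le> card (Inl ` f ` A \<union> Inr ` g ` B :: ('a set + 'a set) set)"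
    by (rule card_mono[OF fin sub])
  also have "\<dots> \<le> card (Inl ` f ` A :: ('a set + 'a set) set) + card (Inr ` g ` B :: ('a set + 'a set) set)"
    by (rule card_Un_le)
  also have "\<dots> = covering_number X \<delta> A + covering_number X \<delta> B"
    using f(3) g(3) by (simp add: card_image)
  finally show ?thesis .
qed

lemma covering_number_UN:
  assumes "compact_space (mtopology_of X)" "finite I" "\<And>i. i \<in> I \<Longrightarrow> A i \<subseteq> mspace X" "0 < \<delta>"
  shows "covering_number X \<delta> (\<Union>i\<in>I. A i) \<le> (\<Sum>i\<in>I. covering_number X \<delta> (A i))"
  using assms(2,3)
proof (induction I rule: finite_induct)
  case empty
  then show ?case by (simp add: covering_number_empty)
next
  case (insert i I)
  have "covering_number X \<delta> (A i \<union> (\<Union>i\<in>I. A i))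
        \<le> covering_number X \<delta> (A i) + covering_number X \<delta> (\<Union>i\<in>I. A i)"
    using insert.prems by (intro covering_number_Un assms(1,4)) auto
  then show ?case using insert by simp
qed

text \<open>Points of different \<open>A i\<close> are more than \<open>\<delta>\<close> apart and cannot share a colour, so a colouring of \<open>E\<close>
  uses disjoint sets of colours on the \<open>A i\<close>.\<close>

lemma covering_number_separated:
  assumes "compact_space (mtopology_of X)" "finite I" "\<And>i. i \<in> I \<Longrightarrow> A i \<subseteq> E" "E \<subseteq> mspace X" "0 < \<delta>"
    and sep: "\<And>i j x y. i \<in> I \<Longrightarrow> j \<in> I \<Longrightarrow> i \<noteq> j \<Longrightarrow> x \<in> A i \<Longrightarrow> y \<in> A j \<Longrightarrow> \<delta> < mdist X x y"
  shows "(\<Sum>i\<in>I. covering_number X \<delta> (A i)) \<le> covering_number X \<delta> E"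
proof -
  obtain f :: "'a \<Rightarrow> 'a set" where f: "colouring X \<delta> E f" "finite (f ` E)"
    "card (f ` E) = covering_number X \<delta> E"
    using covering_number_colouring[OF assms(1,4,5)] .
  have fin: "finite (f ` A i)" if "i \<in> I" for i
    using f(2) assms(3)[OF that] by (meson finite_subset image_mono)
  have "(\<Sum>i\<in>I. covering_number X \<delta> (A i)) \<le> (\<Sum>i\<in>I. card (f ` A i))"
  proof (intro sum_mono covering_number_le_colouring)
    fix i assume i: "i \<in> I"
    show "colouring X \<delta> (A i) f" using f(1) assms(3)[OF i] unfolding colouring_def by blast
    show "A i \<subseteq> mspace X" using assms(3)[OF i] assms(4) by blast
  qed (use fin assms(5) in auto)
  also have "\<dots> = card (\<Union>i\<in>I. f ` A i)"
  proof (rule card_UN_disjoint[symmetric])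
    show "\<forall>i\<in>I. \<forall>j\<in>I. i \<noteq> j \<longrightarrow> f ` A i \<inter> f ` A j = {}"
    proof (intro ballI impI equals0I)
      fix i j c assume ij: "i \<in> I" "j \<in> I" "i \<noteq> j" and "c \<in> f ` A i \<inter> f ` A j"
      then obtain x y where xy: "x \<in> A i" "y \<in> A j" "f x = f y" by auto
      then have "mdist X x y \<le> \<delta>" using f(1) assms(3) ij unfolding colouring_def by (meson subsetD)
      then show False using sep[OF ij xy(1,2)] by simp
    qed
  qed (use assms(2) fin in auto)
  also have "\<dots> \<le> card (f ` E)" using assms(3) f(2) by (intro card_mono) auto
  finally show ?thesis using f(3) by simp
qed

text \<open>Subsets of \<open>\<phi> ` E\<close> and of \<open>E\<close> correspond to each other with diameters scaled by \<open>c\<close>.  That the covering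
  sets need not be balls is essential for equality here.\<close>

lemma covering_number_similar:
  assumes "compact_space (mtopology_of X)" "E \<subseteq> mspace X" "\<phi> \<in> E \<rightarrow> mspace X" "0 < c" "0 < \<delta>"
    and sim: "\<And>x y. x \<in> E \<Longrightarrow> y \<in> E \<Longrightarrow> mdist X (\<phi> x) (\<phi> y) = c * mdist X x y"
  shows "covering_number X \<delta> (\<phi> ` E) = covering_number X (\<delta> / c) E"
proof (rule antisym)
  have dc: "0 < \<delta> / c" using assms by simp
  have sub: "\<phi> ` E \<subseteq> mspace X" using assms(3) by auto
  obtain f :: "'a \<Rightarrow> 'a set" where f: "colouring X (\<delta>/c) E f" "finite (f ` E)"
    "card (f ` E) = covering_number X (\<delta>/c) E"
    using covering_number_colouring[OF assms(1,2) dc] .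
  obtain g :: "'a \<Rightarrow> 'a set" where g: "colouring X \<delta> (\<phi> ` E) g" "finite (g ` \<phi> ` E)"
    "card (g ` \<phi> ` E) = covering_number X \<delta> (\<phi> ` E)"
    using covering_number_colouring[OF assms(1) sub assms(5)] .
  let ?f = "f \<circ> inv_into E \<phi>"
  have im: "?f ` \<phi> ` E \<subseteq> f ` E" by (auto intro: inv_into_into)
  have "colouring X \<delta> (\<phi> ` E) ?f" unfolding colouring_def
  proof (intro ballI impI)
    fix u v assume uv: "u \<in> \<phi> ` E" "v \<in> \<phi> ` E" "?f u = ?f v"
    let ?x = "inv_into E \<phi> u" and ?y = "inv_into E \<phi> v"
    have xy: "?x \<in> E" "?y \<in> E" "\<phi> ?x = u" "\<phi> ?y = v"
      using uv by (auto intro: inv_into_into f_inv_into_f)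
    then have "mdist X ?x ?y \<le> \<delta> / c" using f(1) uv(3) unfolding colouring_def by simp
    then have "c * mdist X ?x ?y \<le> \<delta>" using assms(4) by (simp add: field_simps)
    then show "mdist X u v \<le> \<delta>" using sim[OF xy(1,2)] xy by simp
  qed
  then have "covering_number X \<delta> (\<phi> ` E) \<le> card (?f ` \<phi> ` E)"
    using finite_subset[OF im f(2)] sub assms(5) by (intro covering_number_le_colouring) auto
  also have "\<dots> \<le> card (f ` E)" by (rule card_mono[OF f(2) im])
  finally show "covering_number X \<delta> (\<phi> ` E) \<le> covering_number X (\<delta> / c) E" using f(3) by simp
  have "colouring X (\<delta>/c) E (g \<circ> \<phi>)"
    using g(1) sim assms(4) unfolding colouring_def by (simp add: field_simps)
  then have "covering_number X (\<delta>/c) E \<le> card ((g \<circ> \<phi>) ` E)"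
    using g(2) dc assms(2) by (intro covering_number_le_colouring) (auto simp: image_comp)
  then show "covering_number X (\<delta>/c) E \<le> covering_number X \<delta> (\<phi> ` E)"
    using g(3) by (simp add: image_comp)
qed

section \<open>Box dimensions and power bounds on covering numbers\<close>

lemma upper_box_dim_mono:
  assumes "compact_space (mtopology_of X)" "E \<noteq> {}" "E \<subseteq> E'" "E' \<subseteq> mspace X"
  shows "upper_box_dim X E \<le> upper_box_dim X E'"
  unfolding upper_box_dim_def
proof (rule Limsup_mono)
  show "\<forall>\<^sub>F \<delta> in at_right 0. ereal (ln (real (covering_number X \<delta> E)) / - ln \<delta>)
      \<le> ereal (ln (real (covering_number X \<delta> E')) / - ln \<delta>)"
    unfolding eventually_at_right_field
  proof (intro exI[of _ 1] conjI allI impI)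
    fix \<delta> :: real assume d: "0 < \<delta>" "\<delta> < 1"
    have "1 \<le> covering_number X \<delta> E"
      using assms d by (intro covering_number_pos) auto
    moreover have "covering_number X \<delta> E \<le> covering_number X \<delta> E'"
      using assms d by (intro covering_number_antimono) auto
    ultimately show "ereal (ln (real (covering_number X \<delta> E)) / - ln \<delta>)
      \<le> ereal (ln (real (covering_number X \<delta> E')) / - ln \<delta>)"
      unfolding ereal_less_eq using d by (intro divide_right_mono) auto
  qed simp
qed

lemma lower_le_upper_box_dim: "lower_box_dim X E \<le> upper_box_dim X E"
  unfolding lower_box_dim_def upper_box_dim_def by (rule Liminf_le_Limsup) simp

lemma tendsto_const_over_log: "((\<lambda>\<delta>. c / - ln \<delta>) \<longlongrightarrow> 0) (at_right (0::real))"
proof -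
  have "filterlim (\<lambda>\<delta>::real. - ln \<delta>) at_top (at_right 0)"
    using ln_at_0 by (simp add: filterlim_uminus_at_top)
  then show ?thesis by (rule real_tendsto_divide_at_top[OF tendsto_const])
qed

lemma lower_box_dim_ge:
  assumes "0 < a" "\<And>\<delta>. 0 < \<delta> \<Longrightarrow> \<delta> < 1 \<Longrightarrow> a * \<delta> powr (- t) \<le> real (covering_number X \<delta> E)"
  shows "ereal t \<le> lower_box_dim X E"
proof -
  have "((\<lambda>\<delta>. t + ln a / - ln \<delta>) \<longlongrightarrow> t + 0) (at_right (0::real))"
    by (intro tendsto_add tendsto_const tendsto_const_over_log)
  then have "((\<lambda>\<delta>. ereal (t + ln a / - ln \<delta>)) \<longlongrightarrow> ereal t) (at_right (0::real))"
    by (simp add: )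
  then have "Liminf (at_right 0) (\<lambda>\<delta>. ereal (t + ln a / - ln \<delta>)) = ereal t"
    by (intro lim_imp_Liminf) auto
  moreover have "Liminf (at_right 0) (\<lambda>\<delta>. ereal (t + ln a / - ln \<delta>)) \<le> lower_box_dim X E"
    unfolding lower_box_dim_def
  proof (rule Liminf_mono)
    show "\<forall>\<^sub>F \<delta> in at_right 0. ereal (t + ln a / - ln \<delta>)
        \<le> ereal (ln (real (covering_number X \<delta> E)) / - ln \<delta>)"
      unfolding eventually_at_right_field
    proof (intro exI[of _ 1] conjI allI impI)
      fix \<delta> :: real assume d: "0 < \<delta>" "\<delta> < 1"
      have "ln (a * \<delta> powr (- t)) \<le> ln (real (covering_number X \<delta> E))"
        using assms(2)[OF d] assms(1) d by (intro ln_mono) auto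
      then have "ln a + t * (- ln \<delta>) \<le> ln (real (covering_number X \<delta> E))"
        using assms(1) d by (simp add: ln_mult ln_powr)
      then have "(ln a + t * (- ln \<delta>)) / (- ln \<delta>) \<le> ln (real (covering_number X \<delta> E)) / - ln \<delta>"
        using d by (intro divide_right_mono) auto
      moreover have "(ln a + t * (- ln \<delta>)) / (- ln \<delta>) = t + ln a / - ln \<delta>"
        using d by (simp add: field_simps)
      ultimately show "ereal (t + ln a / - ln \<delta>) \<le> ereal (ln (real (covering_number X \<delta> E)) / - ln \<delta>)"
        by simp
    qed simp
  qed
  ultimately show ?thesis by simp
qed

lemma upper_box_dim_le:
  assumes "compact_space (mtopology_of X)" "E \<subseteq> mspace X" "E \<noteq> {}"
    and A: "\<And>\<delta>. 0 < \<delta> \<Longrightarrow> \<delta> < 1 \<Longrightarrow> real (covering_number X \<delta> E) \<le> A * \<delta> powr (- t)"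
  shows "upper_box_dim X E \<le> ereal t"
proof -
  have pos: "1 \<le> real (covering_number X \<delta> E)" if "0 < \<delta>" for \<delta>
    using covering_number_pos[OF assms(1,2) that assms(3)] by simp
  have "1 \<le> A * (1/2) powr (- t)" using A[of "1/2"] pos[of "1/2"] by simp
  then have A0: "0 < A" by (smt (verit) powr_ge_zero mult_nonneg_nonneg mult_nonpos_nonneg)
  have "((\<lambda>\<delta>. t + ln A / - ln \<delta>) \<longlongrightarrow> t + 0) (at_right (0::real))"
    by (intro tendsto_add tendsto_const tendsto_const_over_log)
  then have "((\<lambda>\<delta>. ereal (t + ln A / - ln \<delta>)) \<longlongrightarrow> ereal t) (at_right (0::real))"
    by (simp add: )
  then have "Limsup (at_right 0) (\<lambda>\<delta>. ereal (t + ln A / - ln \<delta>)) = ereal t"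
    by (intro lim_imp_Limsup) auto
  moreover have "upper_box_dim X E \<le> Limsup (at_right 0) (\<lambda>\<delta>. ereal (t + ln A / - ln \<delta>))"
    unfolding upper_box_dim_def
  proof (rule Limsup_mono)
    show "\<forall>\<^sub>F \<delta> in at_right 0. ereal (ln (real (covering_number X \<delta> E)) / - ln \<delta>)
        \<le> ereal (t + ln A / - ln \<delta>)"
      unfolding eventually_at_right_field
    proof (intro exI[of _ 1] conjI allI impI)
      fix \<delta> :: real assume d: "0 < \<delta>" "\<delta> < 1"
      have "ln (real (covering_number X \<delta> E)) \<le> ln (A * \<delta> powr (- t))"
        using A[OF d] A0 pos[OF d(1)] by (intro ln_mono) auto
      then have "ln (real (covering_number X \<delta> E)) \<le> ln A + t * (- ln \<delta>)"
        using A0 d by (simp add: ln_mult ln_powr)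
      then have "ln (real (covering_number X \<delta> E)) / - ln \<delta> \<le> (ln A + t * (- ln \<delta>)) / (- ln \<delta>)"
        using d by (intro divide_right_mono) auto
      moreover have "(ln A + t * (- ln \<delta>)) / (- ln \<delta>) = t + ln A / - ln \<delta>"
        using d by (simp add: field_simps)
      ultimately show "ereal (ln (real (covering_number X \<delta> E)) / - ln \<delta>) \<le> ereal (t + ln A / - ln \<delta>)"
        by simp
    qed simp
  qed
  ultimately show ?thesis by simp
qed

text \<open>The definition gives the bound at small scales only; at the remaining scales the covering
  numbers are bounded, and this bound is absorbed by the constant.\<close>

lemma covering_number_bound_if_upper_box_dim_less:
  assumes "compact_space (mtopology_of X)" "E \<subseteq> mspace X" "E \<noteq> {}" "upper_box_dim X E < ereal t" "0 \<le> t"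
  obtains K where "0 < K" "\<And>\<delta>. 0 < \<delta> \<Longrightarrow> \<delta> \<le> 1 \<Longrightarrow> real (covering_number X \<delta> E) \<le> K * \<delta> powr (- t)"
proof -
  have "\<forall>\<^sub>F \<delta> in at_right 0. ereal (ln (real (covering_number X \<delta> E)) / - ln \<delta>) < ereal t"
    using assms(4) unfolding upper_box_dim_def by (rule Limsup_lessD)
  then obtain b :: real where b: "0 < b"
      "\<And>\<delta>. 0 < \<delta> \<Longrightarrow> \<delta> < b \<Longrightarrow> ln (real (covering_number X \<delta> E)) / - ln \<delta> < t"
    unfolding eventually_at_right_field by auto
  \<comment> \<open>Below \<open>c\<close> the defining inequality applies, above \<open>c\<close> the covering number at \<open>c\<close> is a bound.\<close>
  define c where "c = min b 1 / 2"
  have c: "0 < c" "c < b" "c < 1" using b(1) by (auto simp: c_def)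
  define K where "K = real (covering_number X c E)"
  have K1: "1 \<le> K" using covering_number_pos[OF assms(1,2) c(1) assms(3)] unfolding K_def by simp
  show ?thesis
  proof (rule that[of K])
    fix \<delta> :: real assume d: "0 < \<delta>" "\<delta> \<le> 1"
    have p1: "1 \<le> \<delta> powr (- t)" using d assms(5) by (simp add: powr_minus powr_le1 one_le_inverse)
    show "real (covering_number X \<delta> E) \<le> K * \<delta> powr (- t)"
    proof (cases "\<delta> < c")
      case True
      have "ln (real (covering_number X \<delta> E)) / - ln \<delta> < t" using b True c d by auto
      then have "ln (real (covering_number X \<delta> E)) \<le> ln (\<delta> powr (- t))"
        using True c d by (simp add: ln_powr field_simps)
      moreover have "1 \<le> real (covering_number X \<delta> E)"
        using covering_number_pos[OF assms(1,2) d(1) assms(3)] by simp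
      ultimately have "real (covering_number X \<delta> E) \<le> \<delta> powr (- t)"
        using d by (subst (asm) ln_le_cancel_iff) auto
      also have "\<dots> \<le> K * \<delta> powr (- t)" using mult_right_mono[OF K1, of "\<delta> powr (- t)"] by simp
      finally show ?thesis .
    next
      case False
      then have "real (covering_number X \<delta> E) \<le> K"
        unfolding K_def using assms c by (intro of_nat_mono covering_number_antimono) auto
      also have "\<dots> \<le> K * \<delta> powr (- t)" using mult_left_mono[OF p1, of K] K1 by simp
      finally show ?thesis .
    qed
  qed (use K1 in simp)
qed

lemma frequently_dyadic_scales:
  assumes "\<And>m. \<exists>n\<ge>m. P ((1/2) ^ n)"
  shows "\<exists>\<^sub>F \<delta> in at_right (0::real). P \<delta>"
  unfolding frequently_def eventually_at_right_field
proof clarify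
  fix b :: real assume b: "0 < b" "\<forall>y>0. y < b \<longrightarrow> \<not> P y"
  obtain m where m: "(1/2::real) ^ m < b" using b(1) real_arch_pow_inv[of b "1/2"] by auto
  obtain n where n: "n \<ge> m" "P ((1/2) ^ n)" using assms by blast
  have "(1/2::real) ^ n \<le> (1/2) ^ m" using n(1) by (intro power_decreasing) auto
  then show False using b(2) n(2) m by (metis order_le_less_trans half_gt_zero zero_less_one zero_less_power)
qed

lemma log_ratio_dyadic:
  assumes "1 \<le> n"
  shows "ln (x::real) / - ln ((1/2) ^ n) = log 2 x / real n"
  using assms by (simp add: ln_realpow ln_div log_def field_simps)

lemma lower_box_dim_le_dyadic:
  fixes t :: real
  assumes "\<And>m. \<exists>n\<ge>m. 1 \<le> n \<and> log 2 (real (covering_number X ((1/2) ^ n) E)) \<le> t * real n"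
  shows "lower_box_dim X E \<le> ereal t"
proof (rule ccontr)
  assume "\<not> lower_box_dim X E \<le> ereal t"
  then have "ereal t < Liminf (at_right 0) (\<lambda>\<delta>. ereal (ln (real (covering_number X \<delta> E)) / - ln \<delta>))"
    by (simp add: lower_box_dim_def)
  then have "\<forall>\<^sub>F \<delta> in at_right 0. t < ln (real (covering_number X \<delta> E)) / - ln \<delta>"
    by (rule less_LiminfD[THEN eventually_mono]) simp
  moreover have "\<exists>\<^sub>F \<delta> in at_right 0. \<not> t < ln (real (covering_number X \<delta> E)) / - ln \<delta>"
  proof (rule frequently_dyadic_scales)
    fix m
    obtain n where n: "n \<ge> m" "1 \<le> n" "log 2 (real (covering_number X ((1/2) ^ n) E)) \<le> t * real n"
      using assms by blast
    then show "\<exists>n\<ge>m. \<not> t < ln (real (covering_number X ((1/2) ^ n) E)) / - ln ((1/2) ^ n)"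
      unfolding not_less by (intro exI[of _ n]) (subst log_ratio_dyadic, use n in \<open>auto simp: field_simps\<close>)
  qed
  ultimately show False by (simp add: frequently_def)
qed

lemma upper_box_dim_ge_dyadic:
  fixes t :: real
  assumes "\<And>m. \<exists>n\<ge>m. 1 \<le> n \<and> t * real n \<le> log 2 (real (covering_number X ((1/2) ^ n) E))"
  shows "ereal t \<le> upper_box_dim X E"
proof (rule ccontr)
  assume "\<not> ereal t \<le> upper_box_dim X E"
  then have "Limsup (at_right 0) (\<lambda>\<delta>. ereal (ln (real (covering_number X \<delta> E)) / - ln \<delta>)) < ereal t"
    by (simp add: upper_box_dim_def)
  then have "\<forall>\<^sub>F \<delta> in at_right 0. ln (real (covering_number X \<delta> E)) / - ln \<delta> < t"
    by (rule Limsup_lessD[THEN eventually_mono]) simp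
  moreover have "\<exists>\<^sub>F \<delta> in at_right 0. \<not> ln (real (covering_number X \<delta> E)) / - ln \<delta> < t"
  proof (rule frequently_dyadic_scales)
    fix m
    obtain n where n: "n \<ge> m" "1 \<le> n" "t * real n \<le> log 2 (real (covering_number X ((1/2) ^ n) E))"
      using assms by blast
    then show "\<exists>n\<ge>m. \<not> ln (real (covering_number X ((1/2) ^ n) E)) / - ln ((1/2) ^ n) < t"
      unfolding not_less by (intro exI[of _ n]) (subst log_ratio_dyadic, use n in \<open>auto simp: field_simps\<close>)
  qed
  ultimately show False by (simp add: frequently_def)
qed

section \<open>Null sets of the Hausdorff and packing measures\<close>

lemma ennreal_le_suminf: "f n \<le> (\<Sum>n. f n)" for f :: "nat \<Rightarrow> ennreal"
  using sum_le_suminf[of f "{n}"] by simp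

text \<open>Both notions of dimension are determined by null sets of an outer measure of this form: \<open>g\<close> is
  the power of the diameter for the Hausdorff dimension and the packing premeasure for the packing
  dimension.\<close>

definition cover_content :: "'a metric \<Rightarrow> ('a set \<Rightarrow> ennreal) \<Rightarrow> 'a set \<Rightarrow> ennreal" where
  "cover_content X g E =
     (INF U \<in> {U :: nat \<Rightarrow> 'a set. (\<forall>n. U n \<subseteq> mspace X) \<and> E \<subseteq> (\<Union>n. U n)}. \<Sum>n. g (U n))"

lemma cover_content_eq_0D:
  assumes "cover_content X g E = 0" "0 < \<epsilon>"
  shows "\<exists>U :: nat \<Rightarrow> 'a set. (\<forall>n. U n \<subseteq> mspace X) \<and> E \<subseteq> (\<Union>n. U n) \<and> (\<Sum>n. g (U n)) < ennreal \<epsilon>"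
proof -
  have "cover_content X g E < ennreal \<epsilon>" using assms by simp
  then show ?thesis unfolding cover_content_def INF_less_iff by (simp add: conj_assoc Bex_def)
qed

lemma cover_content_eq_0I:
  assumes "\<And>\<epsilon>. 0 < \<epsilon> \<Longrightarrow> \<exists>U :: nat \<Rightarrow> 'a set. (\<forall>n. U n \<subseteq> mspace X) \<and> E \<subseteq> (\<Union>n. U n) \<and>
    (\<Sum>n. g (U n)) \<le> ennreal \<epsilon>"
  shows "cover_content X g E = 0"
proof -
  have "cover_content X g E \<le> 0"
  proof (rule ennreal_le_epsilon)
    fix e :: real assume "0 < e"
    from assms[OF this] obtain U :: "nat \<Rightarrow> 'a set"
      where U: "(\<forall>n. U n \<subseteq> mspace X) \<and> E \<subseteq> (\<Union>n. U n)" "(\<Sum>n. g (U n)) \<le> ennreal e"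
      by auto
    have "cover_content X g E \<le> (\<Sum>n. g (U n))"
      unfolding cover_content_def using U(1) by (intro INF_lower) simp
    then show "cover_content X g E \<le> 0 + ennreal e" using U(2) by simp
  qed
  then show ?thesis by simp
qed

lemma cover_content_mono:
  assumes "E \<subseteq> E'"
  shows "cover_content X g E \<le> cover_content X g E'"
  unfolding cover_content_def using assms by (intro INF_superset_mono) auto

lemma cover_content_null_UN:
  assumes "\<And>m::nat. cover_content X g (E m) = 0"
  shows "cover_content X g (\<Union>m. E m) = 0"
proof (rule cover_content_eq_0I)
  fix \<epsilon> :: real assume e: "0 < \<epsilon>"
  have "\<forall>m. \<exists>U. (\<forall>n. U n \<subseteq> mspace X) \<and> E m \<subseteq> (\<Union>n. U n) \<and>
      (\<Sum>n. g (U n)) < ennreal (\<epsilon> * (1/2) ^ Suc m)"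
    by (rule allI, rule cover_content_eq_0D[OF assms]) (use e in simp)
  from choice[OF this] obtain U where UU: "\<forall>m. (\<forall>n. U m n \<subseteq> mspace X) \<and> E m \<subseteq> (\<Union>n. U m n) \<and>
      (\<Sum>n. g (U m n)) < ennreal (\<epsilon> * (1/2) ^ Suc m)" ..
  note U = UU[THEN spec, THEN conjunct1, THEN spec] UU[THEN spec, THEN conjunct2, THEN conjunct1]
    UU[THEN spec, THEN conjunct2, THEN conjunct2]
  let ?V = "\<lambda>i. case prod_decode i of (m, n) \<Rightarrow> U m n"
  have sub: "(\<Union>m. E m) \<subseteq> (\<Union>i. ?V i)"
  proof
    fix x assume "x \<in> (\<Union>m. E m)"
    then obtain m n where "x \<in> U m n" using U(2) by blast
    then have "x \<in> ?V (prod_encode (m, n))" by simp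
    then show "x \<in> (\<Union>i. ?V i)" by (rule UN_I[OF UNIV_I])
  qed
  have "(\<Sum>i. g (?V i)) = (\<Sum>i. (\<lambda>(m, n). g (U m n)) (prod_decode i))"
    by (intro suminf_cong) (auto split: prod.split)
  also have "\<dots> = (\<Sum>m. \<Sum>n. g (U m n))" by (rule suminf_ennreal_2dimen) simp
  also have "\<dots> \<le> (\<Sum>m. ennreal (\<epsilon> * (1/2) ^ Suc m))"
    using U(3) by (intro suminf_le) (auto intro: less_imp_le)
  also have "\<dots> = ennreal (\<epsilon> * 1)"
    using e by (intro suminf_ennreal_eq sums_mult power_half_series) auto
  finally show "\<exists>U. (\<forall>n. U n \<subseteq> mspace X) \<and> (\<Union>m. E m) \<subseteq> (\<Union>n. U n) \<and> (\<Sum>n. g (U n)) \<le> ennreal \<epsilon>"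
    using sub U(1) by (intro exI[of _ ?V]) (auto split: prod.split)
qed

text \<open>If \<open>\<Phi>\<close> replaces covering sets of \<open>E\<close> by covering sets of \<open>f ` E\<close> at the cost of a constant factor,
  then null sets are preserved.  The estimate is only required for \<open>g U \<le> 1\<close>, as the sets in an
  efficient cover satisfy; this lets the lemma also compare different exponents.\<close>

lemma cover_content_null_transfer:
  assumes "cover_content X g E = 0" "0 < k"
    and \<Phi>: "\<And>U. U \<subseteq> mspace X \<Longrightarrow> g U \<le> 1 \<Longrightarrow> \<Phi> U \<subseteq> mspace X \<and> g' (\<Phi> U) \<le> ennreal k * g U"
    and f: "\<And>U x. x \<in> E \<Longrightarrow> x \<in> U \<Longrightarrow> f x \<in> \<Phi> U"
  shows "cover_content X g' (f ` E) = 0"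
proof (rule cover_content_eq_0I)
  fix \<epsilon> :: real assume e: "0 < \<epsilon>"
  then have "0 < min 1 (\<epsilon> / k)" using assms(2) by simp
  from cover_content_eq_0D[OF assms(1) this] obtain U where UU: "(\<forall>n. U n \<subseteq> mspace X) \<and> E \<subseteq> (\<Union>n. U n) \<and>
      (\<Sum>n. g (U n)) < ennreal (min 1 (\<epsilon> / k))" ..
  note U = UU[THEN conjunct1, THEN spec] UU[THEN conjunct2, THEN conjunct1] UU[THEN conjunct2, THEN conjunct2]
  have le1: "g (U n) \<le> 1" for n
  proof -
    have "g (U n) \<le> (\<Sum>n. g (U n))" by (rule ennreal_le_suminf)
    also have "\<dots> \<le> ennreal 1" using U(3) by (meson ennreal_leI less_imp_le min.cobounded1 order_trans)
    finally show ?thesis by simp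
  qed
  then have "(\<Sum>n. g' (\<Phi> (U n))) \<le> (\<Sum>n. ennreal k * g (U n))"
    using \<Phi> U(1) by (intro suminf_le) auto
  also have "\<dots> \<le> ennreal k * ennreal (\<epsilon> / k)"
  proof -
    have "(\<Sum>n. g (U n)) \<le> ennreal (\<epsilon> / k)"
      using U(3) by (meson ennreal_leI less_imp_le min.cobounded2 order_trans)
    then show ?thesis by (simp add: mult_left_mono)
  qed
  also have "\<dots> = ennreal \<epsilon>" using assms(2) e by (simp flip: ennreal_mult)
  finally have "(\<Sum>n. g' (\<Phi> (U n))) \<le> ennreal \<epsilon>" .
  moreover have "f ` E \<subseteq> (\<Union>n. \<Phi> (U n))"
  proof
    fix y assume "y \<in> f ` E"
    then obtain x n where "x \<in> E" "x \<in> U n" "y = f x" using U(2) by auto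
    then show "y \<in> (\<Union>n. \<Phi> (U n))" using f by (intro UN_I[of n]) auto
  qed
  moreover have "\<Phi> (U n) \<subseteq> mspace X" for n using \<Phi>[OF U(1) le1] ..
  ultimately show "\<exists>V. (\<forall>n. V n \<subseteq> mspace X) \<and> f ` E \<subseteq> (\<Union>n. V n) \<and> (\<Sum>n. g' (V n)) \<le> ennreal \<epsilon>"
    by (intro exI[of _ "\<lambda>n. \<Phi> (U n)"]) auto
qed

text \<open>The reverse inequality for a similarity is the forward one for its inverse on the image.\<close>

lemma countably_stable_dim_if_null_sets:
  assumes dm: "\<And>E. dm E = Inf {ereal s | s. 0 < s \<and> null s E}"
    and mono: "\<And>s E E'. 0 < s \<Longrightarrow> E \<subseteq> E' \<Longrightarrow> null s E' \<Longrightarrow> null s E"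
    and up: "\<And>s t E. 0 < s \<Longrightarrow> s \<le> t \<Longrightarrow> null s E \<Longrightarrow> null t E"
    and UN: "\<And>s E. 0 < s \<Longrightarrow> (\<And>n::nat. null s (E n)) \<Longrightarrow> null s (\<Union>n. E n)"
    and sim: "\<And>s E f c. 0 < s \<Longrightarrow> 0 < c \<Longrightarrow> E \<subseteq> mspace X \<Longrightarrow> f \<in> E \<rightarrow> mspace X \<Longrightarrow>
       (\<And>x y. x \<in> E \<Longrightarrow> y \<in> E \<Longrightarrow> mdist X (f x) (f y) = c * mdist X x y) \<Longrightarrow>
       null s E \<Longrightarrow> null s (f ` E)"
  shows "countably_stable_dim X dm"
proof -
  have nullD: "null t E" if lt: "dm E < ereal t" for E t
  proof -
    obtain s where "0 < s" "null s E" "ereal s < ereal t"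
      using lt unfolding dm Inf_less_iff by auto
    then show ?thesis using up[of s t E] by simp
  qed
  have nonneg: "0 \<le> dm E" for E unfolding dm by (rule Inf_greatest) auto
  have dm_mono: "dm E \<le> dm E'" if "E \<subseteq> E'" for E E'
    unfolding dm using mono that by (intro Inf_superset_mono) auto
  have dm_le: "dm E \<le> d" if "0 \<le> d" "\<And>t. 0 < t \<Longrightarrow> d < ereal t \<Longrightarrow> null t E" for E d
  proof (rule ccontr)
    assume "\<not> dm E \<le> d"
    then obtain t where t: "d < ereal t" "ereal t < dm E" using ereal_dense2 by (meson not_le)
    then have "0 < t" using that(1) by (metis ereal_less(2) order_le_less_trans)
    then have "dm E \<le> ereal t" unfolding dm using that(2)[OF _ t(1)] by (intro Inf_lower) auto
    then show False using t(2) by simp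
  qed
  show ?thesis
    unfolding countably_stable_dim_def
  proof (intro conjI allI impI)
    fix E :: "nat \<Rightarrow> 'a set"
    show "dm (\<Union>n. E n) = (SUP n. dm (E n))"
    proof (rule antisym)
      show "dm (\<Union>n. E n) \<le> (SUP n. dm (E n))"
      proof (rule dm_le)
        show "0 \<le> (SUP n. dm (E n))" using nonneg by (meson SUP_upper2 UNIV_I)
        fix t assume t: "0 < t" "(SUP n. dm (E n)) < ereal t"
        have "dm (E n) < ereal t" for n using t(2) by (meson SUP_lessD UNIV_I)
        then show "null t (\<Union>n. E n)" using UN[OF t(1)] nullD by blast
      qed
      show "(SUP n. dm (E n)) \<le> dm (\<Union>n. E n)" by (intro SUP_least dm_mono) auto
    qed
  next
    fix E :: "'a set" and f :: "'a \<Rightarrow> 'a" and c :: real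
    assume "E \<noteq> {} \<and> E \<subseteq> mspace X \<and> f \<in> E \<rightarrow> mspace X \<and> 0 < c \<and>
        (\<forall>x\<in>E. \<forall>y\<in>E. mdist X (f x) (f y) = c * mdist X x y)"
    then have E: "E \<subseteq> mspace X" "f \<in> E \<rightarrow> mspace X" "0 < c"
      and f: "\<And>x y. x \<in> E \<Longrightarrow> y \<in> E \<Longrightarrow> mdist X (f x) (f y) = c * mdist X x y" by auto
    have inj: "inj_on f E"
    proof (rule inj_onI)
      fix x y assume xy: "x \<in> E" "y \<in> E" "f x = f y"
      then have "c * mdist X x y = 0" using f[OF xy(1,2)] E by (metis PiE mdist_zero)
      then show "x = y" using E xy by (metis mdist_zero mult_eq_0_iff order_less_irrefl subsetD)
    qed
    let ?g = "inv_into E f"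
    have gE: "?g ` f ` E = E" using inj by (simp add: image_comp)
    have "null t (f ` E) \<longleftrightarrow> null t E" if "0 < t" for t
    proof
      show "null t (f ` E)" if "null t E" using sim[OF \<open>0 < t\<close> E(3,1,2) f that] .
      assume fE: "null t (f ` E)"
      have "null t (?g ` f ` E)"
      proof (rule sim[OF \<open>0 < t\<close> _ _ _ _ fE])
        show "0 < 1 / c" using E by simp
        show "?g \<in> f ` E \<rightarrow> mspace X" using gE E by blast
        fix u v assume "u \<in> f ` E" "v \<in> f ` E"
        then obtain x y where "x \<in> E" "y \<in> E" "u = f x" "v = f y" by auto
        then show "mdist X (?g u) (?g v) = 1 / c * mdist X u v"
          using f[of x y] E(3) inj by simp
      qed (use E in auto)
      then show "null t E" using gE by simp
    qed
    then show "dm (f ` E) = dm E" unfolding dm by (metis (no_types, lifting))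
  qed
qed

text \<open>For null sets the restriction on the diameters is automatic: if the sum of the \<open>s\<close>-th powers is at
  most \<open>\<delta> powr s\<close>, every diameter is at most \<open>\<delta>\<close>.\<close>

lemma hausdorff_null_iff_cover_content_null:
  assumes "compact_space (mtopology_of X)" "0 < s"
  shows "hausdorff_measure X s E = 0 \<longleftrightarrow> cover_content X (\<lambda>U. ennreal (set_diam X U powr s)) E = 0"
proof
  let ?c = "cover_content X (\<lambda>U. ennreal (set_diam X U powr s)) E"
  assume "hausdorff_measure X s E = 0"
  then have "hausdorff_premeasure X s 1 E \<le> 0"
    unfolding hausdorff_measure_def by (metis SUP_upper greaterThan_iff zero_less_one)
  moreover have "?c \<le> hausdorff_premeasure X s 1 E"
    unfolding cover_content_def hausdorff_premeasure_def by (rule INF_superset_mono) auto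
  ultimately show "?c = 0" by (metis le_zero_eq order_trans)
next
  let ?c = "cover_content X (\<lambda>U. ennreal (set_diam X U powr s)) E"
  assume null: "?c = 0"
  have "hausdorff_premeasure X s \<delta> E \<le> 0" if d: "0 < \<delta>" for \<delta>
  proof (rule ennreal_le_epsilon)
    fix e :: real assume e: "0 < e"
    then have "0 < min e (\<delta> powr s)" using d by simp
    from cover_content_eq_0D[OF null this] obtain U where UU: "(\<forall>n. U n \<subseteq> mspace X) \<and> E \<subseteq> (\<Union>n. U n) \<and>
      (\<Sum>n. ennreal (set_diam X (U n) powr s)) < ennreal (min e (\<delta> powr s))" ..
    note U = UU[THEN conjunct1, THEN spec] UU[THEN conjunct2, THEN conjunct1] UU[THEN conjunct2, THEN conjunct2]
    have "set_diam X (U n) \<le> \<delta>" for n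
    proof -
      have "ennreal (set_diam X (U n) powr s) \<le> (\<Sum>n. ennreal (set_diam X (U n) powr s))"
        by (rule ennreal_le_suminf)
      also have "\<dots> \<le> ennreal (\<delta> powr s)"
        using U(3) by (meson ennreal_leI less_imp_le min.cobounded2 order_trans)
      finally have "set_diam X (U n) powr s \<le> \<delta> powr s" by (simp add: ennreal_le_iff)
      then show ?thesis using assms(2) d set_diam_nonneg[OF assms(1) U(1)]
        by (smt (verit) powr_less_mono2)
    qed
    then have "hausdorff_premeasure X s \<delta> E \<le> (\<Sum>n. ennreal (set_diam X (U n) powr s))"
      unfolding hausdorff_premeasure_def using U by (intro INF_lower) auto
    also have "\<dots> \<le> ennreal e" using U(3) by (meson ennreal_leI less_imp_le min.cobounded1 order_trans)
    finally show "hausdorff_premeasure X s \<delta> E \<le> 0 + ennreal e" by simp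
  qed
  then have "hausdorff_measure X s E \<le> 0"
    unfolding hausdorff_measure_def by (intro SUP_least) auto
  then show "hausdorff_measure X s E = 0" by simp
qed

lemma countably_stable_hausdorff_dim:
  assumes "compact_space (mtopology_of X)"
  shows "countably_stable_dim X (hausdorff_dim X)"
proof (rule countably_stable_dim_if_null_sets[OF hausdorff_dim_def])
  note iff = hausdorff_null_iff_cover_content_null[OF assms]
  show "hausdorff_measure X s E = 0" if "0 < s" "E \<subseteq> E'" "hausdorff_measure X s E' = 0" for s E E'
    using that cover_content_mono[OF that(2)] by (simp add: iff) (metis le_zero_eq)
  show "hausdorff_measure X t E = 0" if st: "0 < s" "s \<le> t" "hausdorff_measure X s E = 0" for s t E
  proof -
    have "cover_content X (\<lambda>U. ennreal (set_diam X U powr t)) (id ` E) = 0"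
    proof (rule cover_content_null_transfer[where k = 1 and \<Phi> = id])
      show "cover_content X (\<lambda>U. ennreal (set_diam X U powr s)) E = 0" using st iff by simp
      fix U assume U: "U \<subseteq> mspace X" "ennreal (set_diam X U powr s) \<le> 1"
      then have "set_diam X U powr s \<le> 1 powr s" by simp
      then have "set_diam X U \<le> 1"
        using set_diam_nonneg[OF assms U(1)] st(1) by (smt (verit) powr_less_mono2)
      then have "set_diam X U powr t \<le> set_diam X U powr s"
        using set_diam_nonneg[OF assms U(1)] st(2) by (intro powr_mono') auto
      then show "id U \<subseteq> mspace X \<and> ennreal (set_diam X (id U) powr t) \<le> ennreal 1 * ennreal (set_diam X U powr s)"
        using U by (simp add: ennreal_leI)
    qed auto
    then show ?thesis using st iff by simp
  qed
  show "hausdorff_measure X s (\<Union>n. E n) = 0" if "0 < s" "\<And>n::nat. hausdorff_measure X s (E n) = 0" for s E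
    using that by (simp add: iff cover_content_null_UN)
  show "hausdorff_measure X s (f ` E) = 0"
    if s: "0 < s" "0 < c" "E \<subseteq> mspace X" "f \<in> E \<rightarrow> mspace X"
      and f: "\<And>x y. x \<in> E \<Longrightarrow> y \<in> E \<Longrightarrow> mdist X (f x) (f y) = c * mdist X x y"
      and null: "hausdorff_measure X s E = 0" for s E f c
  proof -
    have "cover_content X (\<lambda>U. ennreal (set_diam X U powr s)) (f ` E) = 0"
    proof (rule cover_content_null_transfer[where k = "c powr s" and \<Phi> = "\<lambda>U. f ` (U \<inter> E)"])
      show "cover_content X (\<lambda>U. ennreal (set_diam X U powr s)) E = 0" using null s iff by simp
      fix U assume U: "U \<subseteq> mspace X"
      have "set_diam X (f ` (U \<inter> E)) \<le> c * set_diam X U"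
      proof (rule set_diam_le)
        show "0 \<le> c * set_diam X U" using set_diam_nonneg[OF assms U] s by simp
        fix u v assume "u \<in> f ` (U \<inter> E)" "v \<in> f ` (U \<inter> E)"
        then obtain x y where xy: "x \<in> U" "y \<in> U" "x \<in> E" "y \<in> E" "u = f x" "v = f y" by auto
        then show "mdist X u v \<le> c * set_diam X U"
          using f mdist_le_set_diam[OF assms U xy(1,2)] s(2) by simp
      qed
      then have "set_diam X (f ` (U \<inter> E)) powr s \<le> c powr s * set_diam X U powr s"
        using s set_diam_nonneg[OF assms U] set_diam_nonneg[OF assms, of "f ` (U \<inter> E)"]
        by (subst powr_mult[symmetric]) (auto intro!: powr_mono2)
      then show "f ` (U \<inter> E) \<subseteq> mspace X \<and> ennreal (set_diam X (f ` (U \<inter> E)) powr s)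
          \<le> ennreal (c powr s) * ennreal (set_diam X U powr s)"
        using s(4) by (auto simp: ennreal_leI simp flip: ennreal_mult)
    qed (use s in auto)
    then show ?thesis using s iff by simp
  qed
qed

lemma packing_measure_eq_cover_content:
  "packing_measure X s E = cover_content X (packing_premeasure X s) E"
  by (simp add: packing_measure_def cover_content_def)

abbreviation packing_sup :: "'a metric \<Rightarrow> real \<Rightarrow> real \<Rightarrow> 'a set \<Rightarrow> ennreal" where
  "packing_sup X s \<delta> E \<equiv> (SUP K \<in> {K. is_packing X \<delta> E K}. ennreal (\<Sum>(x, \<rho>) \<in> K. (2 * \<rho>) powr s))"

lemma packing_premeasure_antimono:
  assumes "s \<le> t"
  shows "packing_premeasure X t E \<le> packing_premeasure X s E"
  unfolding packing_premeasure_def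
proof (rule INF_mono)
  fix \<delta> :: real assume "\<delta> \<in> {0<..}"
  then have d: "0 < min \<delta> (1/2)" by simp
  have "packing_sup X t (min \<delta> (1/2)) E \<le> packing_sup X s \<delta> E"
  proof (rule SUP_mono)
    fix K assume "K \<in> {K. is_packing X (min \<delta> (1/2)) E K}"
    then have K: "is_packing X (min \<delta> (1/2)) E K" by simp
    then have "is_packing X \<delta> E K" unfolding is_packing_def by auto
    moreover have "(\<Sum>(x, \<rho>) \<in> K. (2 * \<rho>) powr t) \<le> (\<Sum>(x, \<rho>) \<in> K. (2 * \<rho>) powr s)"
      using K assms unfolding is_packing_def by (intro sum_mono) (auto intro!: powr_mono')
    ultimately show "\<exists>L\<in>{K. is_packing X \<delta> E K}. ennreal (\<Sum>(x, \<rho>) \<in> K. (2 * \<rho>) powr t)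
        \<le> ennreal (\<Sum>(x, \<rho>) \<in> L. (2 * \<rho>) powr s)"
      by (auto intro!: ennreal_leI)
  qed
  then show "\<exists>\<eta>\<in>{0<..}. packing_sup X t \<eta> E \<le> packing_sup X s \<delta> E"
    using d by (metis greaterThan_iff)
qed

text \<open>Disjointness of balls in \<open>X\<close> is not a condition on the distances of their centres alone, so a
  similarity on \<open>E\<close> does not preserve packings.  However, if two balls are disjoint, their centres
  are further apart than either radius, hence than the mean of the radii, and the balls with halved
  radii around the (scaled) images are disjoint by the triangle inequality.  Halving the radii
  accounts for the factor \<open>2\<close> in \<open>(2 * c) powr s\<close>.\<close>

lemma packing_sup_similar:
  assumes c: "0 < c" and E: "E \<subseteq> mspace X" "f \<in> E \<rightarrow> mspace X"
    and f: "\<And>x y. x \<in> E \<Longrightarrow> y \<in> E \<Longrightarrow> mdist X (f x) (f y) = c * mdist X x y"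
  shows "packing_sup X s (2 * c * \<delta>) (f ` E) \<le> ennreal ((2 * c) powr s) * packing_sup X s \<delta> E"
proof (rule SUP_least)
  fix K assume "K \<in> {K. is_packing X (2 * c * \<delta>) (f ` E) K}"
  then have fin: "finite K"
    and K: "\<And>x \<rho>. (x, \<rho>) \<in> K \<Longrightarrow> x \<in> f ` E \<and> 0 < \<rho> \<and> \<rho> \<le> 2 * c * \<delta>"
    and disj: "\<And>x \<rho> y \<sigma>. (x, \<rho>) \<in> K \<Longrightarrow> (y, \<sigma>) \<in> K \<Longrightarrow> (x, \<rho>) \<noteq> (y, \<sigma>) \<Longrightarrow>
       disjnt (mcball_of X x \<rho>) (mcball_of X y \<sigma>)"
    unfolding is_packing_def pairwise_def by fastforce+
  let ?g = "inv_into E f"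
  let ?G = "\<lambda>(x, \<rho>). (?g x, \<rho> / (2 * c))"
  have g: "?g x \<in> E" "f (?g x) = x" if "x \<in> f ` E" for x
    using that by (auto intro: inv_into_into f_inv_into_f)
  have inj: "inj_on ?G K"
    using c K g(2) by (auto simp: inj_on_def) metis
  \<comment> \<open>The centre of one ball lies outside the other ball.\<close>
  have far: "\<rho> < mdist X x y" if "(x, \<rho>) \<in> K" "(y, \<sigma>) \<in> K" "(x, \<rho>) \<noteq> (y, \<sigma>)" for x y \<rho> \<sigma>
  proof -
    have "x \<in> mspace X" "y \<in> mspace X" "0 \<le> \<sigma>" using K[OF that(1)] K[OF that(2)] E by auto
    then have "y \<in> mcball_of X y \<sigma>" by (simp add: mdist_self)
    then have "y \<notin> mcball_of X x \<rho>" using disj[OF that] unfolding disjnt_def by blast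
    then show ?thesis using \<open>x \<in> mspace X\<close> \<open>y \<in> mspace X\<close> by simp
  qed
  have "is_packing X \<delta> E (?G ` K)"
    unfolding is_packing_def
  proof (intro conjI)
    show "finite (?G ` K)" using fin by simp
    show "\<forall>(x, \<rho>)\<in>?G ` K. x \<in> E \<and> 0 < \<rho> \<and> \<rho> \<le> \<delta>"
      using K g(1) c by (auto simp: field_simps)
    show "pairwise (\<lambda>(x, \<rho>) (y, \<sigma>). disjnt (mcball_of X x \<rho>) (mcball_of X y \<sigma>)) (?G ` K)"
    proof (rule pairwiseI)
      fix p q assume "p \<in> ?G ` K" "q \<in> ?G ` K" "p \<noteq> q"
      then obtain x \<rho> y \<sigma> where xy: "(x, \<rho>) \<in> K" "(y, \<sigma>) \<in> K"
        and pq: "p = (?g x, \<rho> / (2 * c))" "q = (?g y, \<sigma> / (2 * c))" by auto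
      then have ne: "(x, \<rho>) \<noteq> (y, \<sigma>)" using \<open>p \<noteq> q\<close> by auto
      have d: "\<rho> < mdist X x y" "\<sigma> < mdist X x y"
        using far[OF xy(1,2) ne] far[OF xy(2,1)] ne by (auto simp: mdist_commute)
      have gg: "?g x \<in> E" "?g y \<in> E" "mdist X x y = c * mdist X (?g x) (?g y)"
        using g f K xy by metis+
      have "disjnt (mcball_of X (?g x) (\<rho> / (2 * c))) (mcball_of X (?g y) (\<sigma> / (2 * c)))"
        unfolding disjnt_iff
      proof (intro allI notI)
        fix z assume "z \<in> mcball_of X (?g x) (\<rho> / (2 * c)) \<and> z \<in> mcball_of X (?g y) (\<sigma> / (2 * c))"
        then have z: "z \<in> mspace X" "mdist X (?g x) z \<le> \<rho> / (2 * c)" "mdist X (?g y) z \<le> \<sigma> / (2 * c)"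
          by auto
        have "mdist X (?g x) (?g y) \<le> mdist X (?g x) z + mdist X z (?g y)"
          using gg E z by (intro mdist_triangle) auto
        also have "\<dots> \<le> \<rho> / (2 * c) + \<sigma> / (2 * c)" using z by (simp add: mdist_commute)
        finally have "2 * (c * mdist X (?g x) (?g y)) \<le> \<rho> + \<sigma>" using c by (simp add: field_simps)
        then show False using d gg(3) by simp
      qed
      then show "(case p of (x, \<rho>) \<Rightarrow> \<lambda>(y, \<sigma>). disjnt (mcball_of X x \<rho>) (mcball_of X y \<sigma>)) q"
        by (simp add: pq)
    qed
  qed
  then have "ennreal (\<Sum>(x, \<rho>) \<in> ?G ` K. (2 * \<rho>) powr s) \<le> packing_sup X s \<delta> E"
    by (intro SUP_upper) simp
  then have "ennreal ((2 * c) powr s) * ennreal (\<Sum>(x, \<rho>) \<in> ?G ` K. (2 * \<rho>) powr s)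
      \<le> ennreal ((2 * c) powr s) * packing_sup X s \<delta> E" by (rule mult_left_mono) simp
  moreover have "(2 * c) powr s * (\<Sum>(x, \<rho>) \<in> ?G ` K. (2 * \<rho>) powr s) = (\<Sum>(x, \<rho>) \<in> K. (2 * \<rho>) powr s)"
  proof -
    have "(2 * c) powr s * (\<Sum>(x, \<rho>) \<in> ?G ` K. (2 * \<rho>) powr s)
        = (\<Sum>(x, \<rho>) \<in> K. (2 * c) powr s * (2 * (\<rho> / (2 * c))) powr s)"
      unfolding sum.reindex[OF inj] sum_distrib_left by (rule sum.cong) auto
    also have "\<dots> = (\<Sum>(x, \<rho>) \<in> K. (2 * \<rho>) powr s)"
    proof (intro sum.cong refl, clarify)
      fix x \<rho> assume "(x, \<rho>) \<in> K"
      then have "0 < \<rho>" using K by blast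
      then have "(2 * c) powr s * (2 * (\<rho> / (2 * c))) powr s = ((2 * c) * (2 * (\<rho> / (2 * c)))) powr s"
        using c by (intro powr_mult[symmetric])
      then show "(2 * c) powr s * (2 * (\<rho> / (2 * c))) powr s = (2 * \<rho>) powr s" using c by simp
    qed
    finally show ?thesis .
  qed
  moreover have "0 \<le> (\<Sum>(x, \<rho>) \<in> ?G ` K. (2 * \<rho>) powr s)" by (intro sum_nonneg) auto
  ultimately show "ennreal (\<Sum>(x, \<rho>) \<in> K. (2 * \<rho>) powr s) \<le> ennreal ((2 * c) powr s) * packing_sup X s \<delta> E"
    by (metis ennreal_mult powr_ge_zero)
qed

lemma packing_premeasure_similar:
  assumes "0 < c" "E \<subseteq> mspace X" "f \<in> E \<rightarrow> mspace X"
    and f: "\<And>x y. x \<in> E \<Longrightarrow> y \<in> E \<Longrightarrow> mdist X (f x) (f y) = c * mdist X x y"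
  shows "packing_premeasure X s (f ` E) \<le> ennreal ((2 * c) powr s) * packing_premeasure X s E"
proof -
  let ?k = "(2 * c) powr s"
  have k: "0 < ?k" using assms(1) by simp
  have inv: "ennreal ?k * (ennreal (1 / ?k) * a) = a" "ennreal (1 / ?k) * (ennreal ?k * a) = a" for a
    using k by (simp_all add: mult.assoc[symmetric] flip: ennreal_mult)
  have "ennreal (1 / ?k) * packing_premeasure X s (f ` E) \<le> packing_premeasure X s E"
    unfolding packing_premeasure_def[of X s E]
  proof (rule INF_greatest)
    fix \<delta> :: real assume "\<delta> \<in> {0<..}"
    then have "packing_premeasure X s (f ` E) \<le> packing_sup X s (2 * c * \<delta>) (f ` E)"
      unfolding packing_premeasure_def using assms(1) by (intro INF_lower) simp
    also have "\<dots> \<le> ennreal ?k * packing_sup X s \<delta> E"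
      by (rule packing_sup_similar[OF assms])
    finally have "ennreal (1 / ?k) * packing_premeasure X s (f ` E)
        \<le> ennreal (1 / ?k) * (ennreal ?k * packing_sup X s \<delta> E)" by (rule mult_left_mono) simp
    then show "ennreal (1 / ?k) * packing_premeasure X s (f ` E) \<le> packing_sup X s \<delta> E"
      by (simp only: inv)
  qed
  then have "ennreal ?k * (ennreal (1 / ?k) * packing_premeasure X s (f ` E))
      \<le> ennreal ?k * packing_premeasure X s E" by (rule mult_left_mono) simp
  then show ?thesis by (simp only: inv)
qed

lemma packing_premeasure_mono:
  assumes "E \<subseteq> E'"
  shows "packing_premeasure X s E \<le> packing_premeasure X s E'"
proof -
  have "{K. is_packing X \<delta> E K} \<subseteq> {K. is_packing X \<delta> E' K}" for \<delta>
    using assms unfolding is_packing_def case_prod_unfold by blast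
  then show ?thesis
    unfolding packing_premeasure_def by (intro INF_superset_mono SUP_subset_mono) auto
qed

lemma countably_stable_packing_dim: "countably_stable_dim X (packing_dim X)"
proof (rule countably_stable_dim_if_null_sets[OF packing_dim_def])
  note eq = packing_measure_eq_cover_content
  show "packing_measure X s E = 0" if "0 < s" "E \<subseteq> E'" "packing_measure X s E' = 0" for s E E'
    using that cover_content_mono[OF that(2)] unfolding eq by (metis le_zero_eq)
  show "packing_measure X t E = 0" if st: "0 < s" "s \<le> t" "packing_measure X s E = 0" for s t E
  proof -
    have "cover_content X (packing_premeasure X t) (id ` E) = 0"
      using st packing_premeasure_antimono[OF st(2)]
      by (intro cover_content_null_transfer[where k = 1 and \<Phi> = id and g = "packing_premeasure X s"])
        (auto simp: eq)
    then show ?thesis by (simp add: eq)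
  qed
  show "packing_measure X s (\<Union>n. E n) = 0" if "\<And>n::nat. packing_measure X s (E n) = 0" for s E
    using that unfolding eq by (rule cover_content_null_UN)
  show "packing_measure X s (f ` E) = 0"
    if s: "0 < s" "0 < c" "E \<subseteq> mspace X" "f \<in> E \<rightarrow> mspace X"
      and f: "\<And>x y. x \<in> E \<Longrightarrow> y \<in> E \<Longrightarrow> mdist X (f x) (f y) = c * mdist X x y"
      and null: "packing_measure X s E = 0" for s E f c
    unfolding eq
  proof (rule cover_content_null_transfer[where k = "(2 * c) powr s" and \<Phi> = "\<lambda>U. f ` (U \<inter> E)"])
    show "cover_content X (packing_premeasure X s) E = 0" using null by (simp add: eq)
    fix U assume U: "U \<subseteq> mspace X"
    have "packing_premeasure X s (f ` (U \<inter> E)) \<le> ennreal ((2 * c) powr s) * packing_premeasure X s (U \<inter> E)"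
      using s f by (intro packing_premeasure_similar) auto
    also have "\<dots> \<le> ennreal ((2 * c) powr s) * packing_premeasure X s U"
      by (intro mult_left_mono packing_premeasure_mono) auto
    finally show "f ` (U \<inter> E) \<subseteq> mspace X \<and>
        packing_premeasure X s (f ` (U \<inter> E)) \<le> ennreal ((2 * c) powr s) * packing_premeasure X s U"
      using s by auto
  qed (use s in auto)
qed

lemma Inf_pos_ereals: "Inf {ereal s | s. 0 < s} = 0"
proof (rule antisym)
  show "Inf {ereal s | s. 0 < s} \<le> 0"
  proof (rule ereal_le_epsilon2)
    fix e :: real assume "0 < e"
    then show "Inf {ereal s | s. 0 < s} \<le> 0 + ereal e" by (auto intro: Inf_lower)
  qed
qed (auto intro!: Inf_greatest)

lemma hausdorff_dim_singleton:
  assumes "compact_space (mtopology_of X)" "x \<in> mspace X"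
  shows "hausdorff_dim X {x} = 0"
proof -
  have "hausdorff_measure X s {x} = 0" if s: "0 < s" for s
  proof -
    have diam: "set_diam X {x} = 0"
      using set_diam_nonneg[OF assms(1), of "{x}"] set_diam_le[of 0 "{x}" X] assms(2)
      by (simp add: mdist_self)
    have "cover_content X (\<lambda>U. ennreal (set_diam X U powr s)) {x} = 0"
      by (rule cover_content_eq_0I) (use assms(2) diam in \<open>auto intro!: exI[of _ "\<lambda>_. {x}"]\<close>)
    then show ?thesis using hausdorff_null_iff_cover_content_null[OF assms(1) s] by simp
  qed
  then have "hausdorff_dim X {x} = Inf {ereal s | s. 0 < s}"
    unfolding hausdorff_dim_def by (metis (no_types, lifting))
  then show ?thesis by (simp only: Inf_pos_ereals)
qed

lemma packing_dim_singleton: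
  assumes "x \<in> mspace X"
  shows "packing_dim X {x} = 0"
proof -
  have "packing_measure X s {x} = 0" if s: "0 < s" for s
  proof -
    have single: "packing_sup X s \<delta> {x} \<le> ennreal ((2 * \<delta>) powr s)" if d: "0 < \<delta>" for \<delta>
    proof (rule SUP_least)
      fix K assume "K \<in> {K. is_packing X \<delta> {x} K}"
      then have K: "finite K" "\<And>y \<rho>. (y, \<rho>) \<in> K \<Longrightarrow> y = x \<and> 0 < \<rho> \<and> \<rho> \<le> \<delta>"
        and disj: "\<And>y \<rho> z \<sigma>. (y, \<rho>) \<in> K \<Longrightarrow> (z, \<sigma>) \<in> K \<Longrightarrow> (y, \<rho>) \<noteq> (z, \<sigma>) \<Longrightarrow>
          disjnt (mcball_of X y \<rho>) (mcball_of X z \<sigma>)"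
        unfolding is_packing_def pairwise_def by fastforce+
      have eq: "\<rho> = \<sigma>" if "(x, \<rho>) \<in> K" "(x, \<sigma>) \<in> K" for \<rho> \<sigma>
      proof (rule ccontr)
        assume "\<rho> \<noteq> \<sigma>"
        then have "disjnt (mcball_of X x \<rho>) (mcball_of X x \<sigma>)" using disj that by blast
        moreover have "x \<in> mcball_of X x \<rho>" "x \<in> mcball_of X x \<sigma>"
          using K(2)[OF that(1)] K(2)[OF that(2)] assms by (simp_all add: mdist_self)
        ultimately show False unfolding disjnt_def by blast
      qed
      show "ennreal (\<Sum>(y, \<rho>) \<in> K. (2 * \<rho>) powr s) \<le> ennreal ((2 * \<delta>) powr s)"
      proof (cases "K = {}")
        case False
        then obtain y \<rho> where y\<rho>: "(y, \<rho>) \<in> K" by auto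
        have "p = (x, \<rho>)" if "p \<in> K" for p
          using K(2) eq y\<rho> that by (cases p) metis
        then have "K = {(x, \<rho>)}" using False by blast
        moreover have "0 < \<rho>" "\<rho> \<le> \<delta>" using K(2)[OF y\<rho>] by auto
        ultimately show ?thesis using s by (auto intro!: ennreal_leI powr_mono2)
      qed simp
    qed
    have "packing_premeasure X s {x} \<le> 0"
    proof (rule ennreal_le_epsilon)
      fix e :: real assume e: "0 < e"
      define \<delta> where "\<delta> = e powr (1 / s) / 2"
      have "0 < \<delta>" "(2 * \<delta>) powr s = e" using e s by (simp_all add: \<delta>_def powr_powr)
      then have "packing_premeasure X s {x} \<le> packing_sup X s \<delta> {x}"
        unfolding packing_premeasure_def by (intro INF_lower) simp
      then show "packing_premeasure X s {x} \<le> 0 + ennreal e"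
        using single[OF \<open>0 < \<delta>\<close>] \<open>(2 * \<delta>) powr s = e\<close> by (simp add: order_trans)
    qed
    then have "cover_content X (packing_premeasure X s) {x} = 0"
      using assms by (intro cover_content_eq_0I exI[of _ "\<lambda>_. {x}"]) auto
    then show ?thesis by (simp add: packing_measure_eq_cover_content)
  qed
  then have "packing_dim X {x} = Inf {ereal s | s. 0 < s}"
    unfolding packing_dim_def by (metis (no_types, lifting))
  then show ?thesis by (simp only: Inf_pos_ereals)
qed

lemma countably_stable_dim_countable_set:
  assumes "countably_stable_dim X dm" "countable E" "E \<noteq> {}" "E \<subseteq> mspace X"
    and "\<And>x. x \<in> mspace X \<Longrightarrow> dm {x} = d"
  shows "dm E = d"
proof -
  let ?e = "from_nat_into E"
  have "dm (\<Union>n. {?e n}) = (SUP n. dm {?e n})"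
    using assms(1,4) from_nat_into[OF assms(3)] unfolding countably_stable_dim_def
    by (elim conjE allE[of _ "\<lambda>n. {?e n}"]) auto
  moreover have "(\<Union>n. {?e n}) = E" using range_from_nat_into[OF assms(3,2)] by auto
  moreover have "dm {?e n} = d" for n using assms(4,5) from_nat_into[OF assms(3)] by blast
  ultimately show ?thesis by simp
qed

section \<open>Words and the orbital decomposition of an attractor\<close>

lemma compact_limit_point:
  assumes "compactin (mtopology_of X) F" "x \<in> mspace X"
    and "\<And>\<epsilon>. 0 < \<epsilon> \<Longrightarrow> \<exists>y\<in>F. mdist X x y < \<epsilon>"
  shows "x \<in> F"
proof -
  interpret Metric_space "mspace X" "mdist X" by blast
  have F: "compactin mtopology F" using assms(1) by (simp add: mtopology_of_def)
  then have "closedin mtopology F" using compactin_imp_closedin Hausdorff_space_mtopology by blast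
  moreover have "F \<subseteq> mspace X" using compactin_subset_topspace[OF F] by simp
  then have "x \<in> mtopology closure_of F"
    unfolding metric_closure_of using assms(2,3) by fastforce
  ultimately show ?thesis by (simp add: closure_of_closedin)
qed

text \<open>The gap is a Lebesgue number of the covering of \<open>A\<close> by the complement of \<open>B\<close>.\<close>

lemma disjoint_compact_gap:
  assumes "compactin (mtopology_of X) A" "compactin (mtopology_of X) B" "A \<inter> B = {}"
  shows "\<exists>\<eta>>0. \<forall>x\<in>A. \<forall>y\<in>B. \<eta> \<le> mdist X x y"
proof -
  interpret Metric_space "mspace X" "mdist X" by blast
  have AB: "compactin mtopology A" "compactin mtopology B" using assms by (simp_all add: mtopology_of_def)
  then have sub: "A \<subseteq> mspace X" "B \<subseteq> mspace X" using compactin_subset_topspace by fastforce+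
  have "closedin mtopology B" using AB(2) compactin_imp_closedin Hausdorff_space_mtopology by blast
  then have op: "openin mtopology (mspace X - B)" by (simp add: openin_diff)
  have "\<exists>\<epsilon>>0. \<forall>x\<in>A. \<exists>U\<in>{mspace X - B}. mball x \<epsilon> \<subseteq> U"
  proof (rule Bolzano_Weierstrass_D[OF sub(1)])
    show "A \<subseteq> \<Union>{mspace X - B}" using sub assms(3) by auto
    show "\<forall>\<sigma>::nat \<Rightarrow> 'a. range \<sigma> \<subseteq> A \<longrightarrow> (\<exists>l (r::nat \<Rightarrow> nat). l \<in> A \<and> strict_mono r \<and> limitin mtopology (\<sigma> \<circ> r) l sequentially)"
      using iffD1[OF compactin_sequentially AB(1)] by (rule conjunct2)
  qed (use op in simp)
  then obtain \<epsilon> where e: "\<epsilon> > 0" "\<forall>x\<in>A. mball x \<epsilon> \<subseteq> mspace X - B"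
    unfolding bex_simps by blast
  have "\<epsilon> \<le> mdist X x y" if "x \<in> A" "y \<in> B" for x y
  proof (rule ccontr)
    assume "\<not> \<epsilon> \<le> mdist X x y"
    then have "y \<in> mball x \<epsilon>" using that sub by auto
    then show False using e(2) that by blast
  qed
  then show ?thesis using e(1) by blast
qed

lemma compact_similar_image:
  assumes "compactin (mtopology_of X) F" "f \<in> mspace X \<rightarrow> mspace X"
    and "\<And>x y. x \<in> mspace X \<Longrightarrow> y \<in> mspace X \<Longrightarrow> mdist X (f x) (f y) = c * mdist X x y"
  shows "compactin (mtopology_of X) (f ` F)"
proof (rule image_compactin[OF assms(1)])
  have "Lipschitz_continuous_map X X f"
    unfolding Lipschitz_continuous_map_def using assms(2,3) by (metis order_refl)
  then show "continuous_map (mtopology_of X) (mtopology_of X) f"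
    by (rule Lipschitz_continuous_imp_continuous_map)
qed

definition word_ratio :: "(nat \<Rightarrow> real) \<Rightarrow> nat list \<Rightarrow> real" where
  "word_ratio r w = prod_list (map r w)"

lemma similarity_ifsD:
  assumes "similarity_ifs X N S r" "i < N"
  shows "x \<in> mspace X \<Longrightarrow> S i x \<in> mspace X" "0 < r i" "r i < 1"
    "x \<in> mspace X \<Longrightarrow> y \<in> mspace X \<Longrightarrow> mdist X (S i x) (S i y) = r i * mdist X x y"
  using assms unfolding similarity_ifs_def by auto

lemma ifs_index_nonempty:
  assumes "similarity_ifs X N S r"
  shows "{..<N} \<noteq> {}"
proof -
  have "0 \<in> {..<N}" using assms unfolding similarity_ifs_def by simp
  then show ?thesis by blast
qed

lemma word_map_in_mspace:
  assumes "similarity_ifs X N S r" "w \<in> lists {..<N}" "x \<in> mspace X"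
  shows "foldr S w x \<in> mspace X"
  using assms(2,3) by (induction w) (auto intro: similarity_ifsD(1)[OF assms(1)])

lemma word_map_similarity:
  assumes "similarity_ifs X N S r" "w \<in> lists {..<N}" "x \<in> mspace X" "y \<in> mspace X"
  shows "mdist X (foldr S w x) (foldr S w y) = word_ratio r w * mdist X x y"
  using assms(2)
proof (induction w)
  case (Cons i w)
  then show ?case
    using similarity_ifsD(4)[OF assms(1), of i] word_map_in_mspace[OF assms(1) _ assms(3)]
      word_map_in_mspace[OF assms(1) _ assms(4)] by (auto simp: word_ratio_def)
qed (simp add: word_ratio_def)

lemma word_ratio_pos:
  assumes "similarity_ifs X N S r" "w \<in> lists {..<N}"
  shows "0 < word_ratio r w"
  using assms(2) by (induction w) (auto simp: word_ratio_def similarity_ifsD(2)[OF assms(1)])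

lemma word_ratio_le_power:
  assumes "similarity_ifs X N S r" "w \<in> lists {..<N}" "\<And>i. i < N \<Longrightarrow> r i \<le> q"
  shows "word_ratio r w \<le> q ^ length w"
  using assms(2)
proof (induction w)
  case (Cons i w)
  have "word_ratio r w \<le> q ^ length w" "i < N" "0 < word_ratio r w"
    using Cons word_ratio_pos[OF assms(1)] by auto
  moreover have "0 < r i" "r i \<le> q" using \<open>i < N\<close> assms(3) similarity_ifsD(2)[OF assms(1)] by auto
  ultimately have "r i * word_ratio r w \<le> q * q ^ length w" by (intro mult_mono) auto
  then show ?case by (simp add: word_ratio_def)
qed (simp add: word_ratio_def)

lemma uniform_ratio_bound:
  assumes "finite J" "J \<noteq> {}" "\<And>i. i \<in> J \<Longrightarrow> 0 < c i \<and> c i < (1::real)"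
  shows "\<exists>q. 0 < q \<and> q < 1 \<and> (\<forall>i\<in>J. c i \<le> q)"
proof (intro exI conjI ballI)
  have "Max (c ` J) \<in> c ` J" using assms by (intro Max_in) auto
  then show "0 < Max (c ` J)" "Max (c ` J) < 1" using assms(3) by auto
  fix i assume "i \<in> J"
  then show "c i \<le> Max (c ` J)" using assms(1) by simp
qed

lemma ifs_ratio_bound:
  assumes "similarity_ifs X N S r"
  shows "\<exists>q. 0 < q \<and> q < 1 \<and> (\<forall>i<N. r i \<le> q)"
proof -
  have "\<exists>q. 0 < q \<and> q < 1 \<and> (\<forall>i\<in>{..<N}. r i \<le> q)"
    using similarity_ifsD(2,3)[OF assms] ifs_index_nonempty[OF assms] by (intro uniform_ratio_bound) auto
  then show ?thesis by (simp add: Ball_def)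
qed

lemma word_map_image_subset:
  assumes "\<And>i. i < N \<Longrightarrow> S i ` F \<subseteq> F" "w \<in> lists {..<N}"
  shows "foldr S w ` F \<subseteq> F"
  using assms(2)
proof (induction w)
  case (Cons i w)
  then have "foldr S w ` F \<subseteq> F" "S i ` F \<subseteq> F" using assms(1) by auto
  then show ?case unfolding foldr.simps image_comp[symmetric] by blast
qed simp

text \<open>Substituting the fixed point equation into itself \<open>n\<close> times.\<close>

lemma attractor_unfold_words:
  assumes "F = (\<Union>i<N. S i ` F) \<union> C" "x \<in> F"
  shows "(\<exists>w\<in>lists {..<N}. x \<in> foldr S w ` C) \<or> (\<exists>w\<in>lists {..<N}. length w = n \<and> x \<in> foldr S w ` F)"
proof (induction n)
  case 0
  then show ?case using assms(2) by (intro disjI2 bexI[of _ "[]"]) auto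
next
  case (Suc n)
  then show ?case
  proof
    assume "\<exists>w\<in>lists {..<N}. length w = n \<and> x \<in> foldr S w ` F"
    then obtain w y where w: "w \<in> lists {..<N}" "length w = n" "y \<in> F" "x = foldr S w y" by auto
    have "y \<in> (\<Union>i<N. S i ` F) \<union> C" using w(3) assms(1) by simp
    then show ?thesis
    proof
      assume "y \<in> C"
      then show ?thesis using w by blast
    next
      assume "y \<in> (\<Union>i<N. S i ` F)"
      then obtain i z where "i < N" "z \<in> F" "y = S i z" by auto
      then show ?thesis using w by (intro disjI2 bexI[of _ "w @ [i]"]) auto
    qed
  qed simp
qed

lemma attractorD:
  assumes "is_attractor X N S C F"
  shows "F \<noteq> {}" "F \<subseteq> mspace X" "compactin (mtopology_of X) F" "F = (\<Union>i<N. S i ` F) \<union> C"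
    "C \<subseteq> F" "i < N \<Longrightarrow> S i ` F \<subseteq> F"
proof -
  show 1: "F \<noteq> {}" "compactin (mtopology_of X) F" and 2: "F = (\<Union>i<N. S i ` F) \<union> C"
    using assms unfolding is_attractor_def by simp_all
  show "F \<subseteq> mspace X" using compactin_subset_topspace[OF 1(2)] by simp
  show "C \<subseteq> F" using 2 by blast
  show "S i ` F \<subseteq> F" if "i < N" using 2 that by blast
qed

lemma attractor_word_image:
  assumes "is_attractor X N S C F" "w \<in> lists {..<N}"
  shows "foldr S w ` F \<subseteq> F"
  by (rule word_map_image_subset[OF _ assms(2)]) (rule attractorD(6)[OF assms(1)])

lemma inhomogeneous_systemD:
  assumes "inhomogeneous_system X N S r C F0 FC s"
  shows "compact_space (mtopology_of X)" "similarity_ifs X N S r" "C \<noteq> {}"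
    "is_attractor X N S {} F0" "is_attractor X N S C FC" "(\<Sum>i<N. r i powr s) = 1"
  using assms unfolding inhomogeneous_system_def is_similarity_dim_def by auto

text \<open>The ratios are uniformly below \<open>1\<close> and the space is bounded, so images under long words are small.
  The words are nonempty so that the corresponding maps contract.\<close>

lemma word_images_shrink:
  assumes "compact_space (mtopology_of X)" "similarity_ifs X N S r" "0 < \<epsilon>"
  shows "\<exists>n\<ge>1. \<forall>w\<in>lists {..<N}. length w = n \<longrightarrow>
    (\<forall>x\<in>mspace X. \<forall>y\<in>mspace X. mdist X (foldr S w x) (foldr S w y) < \<epsilon>)"
proof -
  obtain D where D: "0 < D" "\<And>x y. x \<in> mspace X \<Longrightarrow> y \<in> mspace X \<Longrightarrow> mdist X x y \<le> D"
    using compact_metric_bounded[OF assms(1)] by metis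
  obtain q where q: "0 < q" "q < 1" "\<And>i. i < N \<Longrightarrow> r i \<le> q"
    using ifs_ratio_bound[OF assms(2)] by auto
  obtain n where n: "q ^ n < \<epsilon> / D" using real_arch_pow_inv[of "\<epsilon> / D" q] q D(1) assms(3) by auto
  have "q ^ Suc n \<le> q ^ n" using q by (intro power_decreasing) auto
  then have "q ^ Suc n < \<epsilon> / D" using n by linarith
  then have n': "q ^ Suc n * D < \<epsilon>" using D(1) by (simp only: pos_less_divide_eq)
  show ?thesis
  proof (intro exI[of _ "Suc n"] conjI ballI impI)
    show "1 \<le> Suc n" by simp
    fix w x y assume w: "w \<in> lists {..<N}" "length w = Suc n" and xy: "x \<in> mspace X" "y \<in> mspace X"
    have "word_ratio r w * mdist X x y \<le> q ^ Suc n * D"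
      using word_ratio_le_power[OF assms(2) w(1) q(3)] w(2) D(2)[OF xy] q(1)
        word_ratio_pos[OF assms(2) w(1)] by (intro mult_mono) auto
    then show "mdist X (foldr S w x) (foldr S w y) < \<epsilon>"
      using n' word_map_similarity[OF assms(2) w(1) xy] by simp
  qed
qed

text \<open>A point of \<open>F0\<close> lies in arbitrarily small images \<open>S w ` F0\<close>, which are close to \<open>S w ` F \<subseteq> F\<close>.\<close>

lemma homogeneous_subset_attractor:
  assumes "compact_space (mtopology_of X)" "similarity_ifs X N S r"
    "is_attractor X N S {} F0" "is_attractor X N S C F"
  shows "F0 \<subseteq> F"
proof
  fix x assume x: "x \<in> F0"
  note F0 = attractorD[OF assms(3)] and F = attractorD[OF assms(4)]
  obtain z where z: "z \<in> F" using F(1) by blast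
  show "x \<in> F"
  proof (rule compact_limit_point[OF F(3)])
    show "x \<in> mspace X" using x F0(2) by blast
    fix \<epsilon> :: real assume "0 < \<epsilon>"
    from word_images_shrink[OF assms(1,2) this] obtain n where n0: "\<forall>w\<in>lists {..<N}. length w = n \<longrightarrow>
      (\<forall>x\<in>mspace X. \<forall>y\<in>mspace X. mdist X (foldr S w x) (foldr S w y) < \<epsilon>)" by blast
      then have n: "\<And>w x y. w \<in> lists {..<N} \<Longrightarrow> length w = n \<Longrightarrow> x \<in> mspace X \<Longrightarrow> y \<in> mspace X \<Longrightarrow>
        mdist X (foldr S w x) (foldr S w y) < \<epsilon>" by blast
    obtain w y where w: "w \<in> lists {..<N}" "length w = n" "y \<in> F0" "x = foldr S w y"
      using attractor_unfold_words[OF F0(4) x, of n] by auto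
    have "foldr S w z \<in> F" using attractor_word_image[OF assms(4) w(1)] z by blast
    moreover have "mdist X x (foldr S w z) < \<epsilon>"
      unfolding w(4) using w z F0(2) F(2) by (intro n) auto
    ultimately show "\<exists>y\<in>F. mdist X x y < \<epsilon>" by blast
  qed
qed

text \<open>A point of \<open>F\<close> that is in no image of \<open>C\<close> lies in \<open>S w ` F\<close> for words \<open>w\<close> of every length, and these
  sets come arbitrarily close to \<open>F0\<close>.\<close>

lemma attractor_eq_orbital_union:
  assumes "compact_space (mtopology_of X)" "similarity_ifs X N S r"
    "is_attractor X N S {} F0" "is_attractor X N S C F"
  shows "F = F0 \<union> (\<Union>w\<in>lists {..<N}. foldr S w ` C)"
proof (intro equalityI subsetI)
  note F0 = attractorD[OF assms(3)] and F = attractorD[OF assms(4)]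
  fix x assume x: "x \<in> F"
  obtain z where z: "z \<in> F0" using F0(1) by blast
  show "x \<in> F0 \<union> (\<Union>w\<in>lists {..<N}. foldr S w ` C)"
  proof (cases "x \<in> (\<Union>w\<in>lists {..<N}. foldr S w ` C)")
    case False
    have "x \<in> F0"
    proof (rule compact_limit_point[OF F0(3)])
      show "x \<in> mspace X" using x F(2) by blast
      fix \<epsilon> :: real assume "0 < \<epsilon>"
      from word_images_shrink[OF assms(1,2) this] obtain n where n0: "\<forall>w\<in>lists {..<N}. length w = n \<longrightarrow>
        (\<forall>x\<in>mspace X. \<forall>y\<in>mspace X. mdist X (foldr S w x) (foldr S w y) < \<epsilon>)" by blast
        then have n: "\<And>w x y. w \<in> lists {..<N} \<Longrightarrow> length w = n \<Longrightarrow> x \<in> mspace X \<Longrightarrow> y \<in> mspace X \<Longrightarrow>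
          mdist X (foldr S w x) (foldr S w y) < \<epsilon>" by blast
      obtain w y where w: "w \<in> lists {..<N}" "length w = n" "y \<in> F" "x = foldr S w y"
        using attractor_unfold_words[OF F(4) x, of n] False by auto
      have "foldr S w z \<in> F0" using attractor_word_image[OF assms(3) w(1)] z by blast
      moreover have "mdist X x (foldr S w z) < \<epsilon>"
        unfolding w(4) using w z F0(2) F(2) by (intro n) auto
      ultimately show "\<exists>y\<in>F0. mdist X x y < \<epsilon>" by blast
    qed
    then show ?thesis by simp
  qed simp
next
  note F = attractorD[OF assms(4)]
  fix x assume "x \<in> F0 \<union> (\<Union>w\<in>lists {..<N}. foldr S w ` C)"
  then show "x \<in> F"
  proof
    assume "x \<in> F0"
    then show ?thesis using homogeneous_subset_attractor[OF assms] by blast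
  next
    assume "x \<in> (\<Union>w\<in>lists {..<N}. foldr S w ` C)"
    then obtain w c where w: "w \<in> lists {..<N}" "c \<in> C" "x = foldr S w c" by blast
    then show ?thesis using attractor_word_image[OF assms(4) w(1)] F(5) by blast
  qed
qed

lemma countably_stable_dim_UN:
  assumes "countably_stable_dim X dm" "\<And>n::nat. E n \<noteq> {} \<and> E n \<subseteq> mspace X"
  shows "dm (\<Union>n. E n) = (SUP n. dm (E n))"
  by (rule assms(1)[unfolded countably_stable_dim_def, THEN conjunct1, THEN spec, THEN mp])
    (simp add: assms(2))

lemma countably_stable_dim_similar:
  assumes "countably_stable_dim X dm" "E \<noteq> {}" "E \<subseteq> mspace X" "f \<in> E \<rightarrow> mspace X" "0 < c"
    "\<And>x y. x \<in> E \<Longrightarrow> y \<in> E \<Longrightarrow> mdist X (f x) (f y) = c * mdist X x y"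
  shows "dm (f ` E) = dm E"
  by (rule assms(1)[unfolded countably_stable_dim_def, THEN conjunct2, THEN spec, THEN spec,
      THEN spec[of _ c], THEN mp]) (use assms in simp)

lemma countably_stable_dim_attractor:
  assumes "countably_stable_dim X dm" "inhomogeneous_system X N S r C F0 FC s"
  shows "dm FC = max (dm F0) (dm C)"
proof -
  note sys = inhomogeneous_systemD[OF assms(2)]
  note F0 = attractorD[OF sys(4)] and FC = attractorD[OF sys(5)]
  have C: "C \<subseteq> mspace X" using FC by blast
  let ?W = "lists {..<N}"
  have W: "?W \<noteq> {}" "countable ?W" by auto
  let ?w = "from_nat_into ?W"
  have wW: "?w n \<in> ?W" for n using from_nat_into[OF W(1)] .
  define E where "E n = (case n of 0 \<Rightarrow> F0 | Suc n \<Rightarrow> foldr S (?w n) ` C)" for n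
  have "(\<Union>n. E n) = E 0 \<union> (\<Union>n. E (Suc n))" by (subst UNIV_nat_eq) auto
  also have "\<dots> = F0 \<union> (\<Union>w\<in>range ?w. foldr S w ` C)" by (auto simp: E_def)
  also have "\<dots> = FC"
    unfolding range_from_nat_into[OF W] using attractor_eq_orbital_union[OF sys(1,2,4,5)] by simp
  finally have UE: "(\<Union>n. E n) = FC" .
  have ne: "E n \<noteq> {} \<and> E n \<subseteq> mspace X" for n
    using F0(1,2) sys(3) C word_map_in_mspace[OF sys(2) wW] by (auto simp: E_def split: nat.split)
  have sim: "dm (foldr S (?w n) ` C) = dm C" for n
  proof (rule countably_stable_dim_similar[OF assms(1) sys(3) C])
    show "foldr S (?w n) \<in> C \<rightarrow> mspace X" using C word_map_in_mspace[OF sys(2) wW] by auto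
    show "0 < word_ratio r (?w n)" by (rule word_ratio_pos[OF sys(2) wW])
    fix x y assume "x \<in> C" "y \<in> C"
    then show "mdist X (foldr S (?w n) x) (foldr S (?w n) y) = word_ratio r (?w n) * mdist X x y"
      using C by (intro word_map_similarity[OF sys(2) wW]) auto
  qed
  have "dm FC = (SUP n. dm (E n))"
    using countably_stable_dim_UN[OF assms(1), of E] ne UE by simp
  also have "\<dots> = sup (dm (E 0)) (SUP n. dm (E (Suc n)))"
    by (subst UNIV_nat_eq) (simp add: image_comp)
  also have "\<dots> = max (dm F0) (dm C)"
    using sim by (simp add: E_def sup_max)
  finally show ?thesis .
qed

section \<open>The upper box dimension of an attractor\<close>

lemma sum_powr_strict_antimono:
  assumes "similarity_ifs X N S r" "s < t"
  shows "(\<Sum>i<N. r i powr t) < (\<Sum>i<N. r i powr s)"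
proof (rule sum_strict_mono)
  show "{..<N} \<noteq> {}" by (rule ifs_index_nonempty[OF assms(1)])
  show "r i powr t < r i powr s" if "i \<in> {..<N}" for i
    using similarity_ifsD(2,3)[OF assms(1)] that assms(2) by (intro powr_less_mono') auto
qed simp

lemma similarity_dim_nonneg:
  assumes "similarity_ifs X N S r" "(\<Sum>i<N. r i powr s) = 1"
  shows "0 \<le> s"
proof (rule ccontr)
  assume "\<not> 0 \<le> s"
  then have "(\<Sum>i<N. r i powr 0) < 1" using sum_powr_strict_antimono[OF assms(1), of s 0] assms(2) by simp
  moreover have "(\<Sum>i<N. r i powr 0) = (\<Sum>i<N. 1)"
  proof (rule sum.cong)
    fix i assume "i \<in> {..<N}"
    then show "r i powr 0 = 1" using similarity_ifsD(2)[OF assms(1), of i] by simp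
  qed simp
  moreover have "1 \<le> N" using assms unfolding similarity_ifs_def by simp
  ultimately show False by simp
qed

lemma covering_number_similar_image:
  assumes "compact_space (mtopology_of X)" "F \<subseteq> mspace X" "f \<in> mspace X \<rightarrow> mspace X" "0 < c" "0 < \<delta>"
    and "\<And>x y. x \<in> mspace X \<Longrightarrow> y \<in> mspace X \<Longrightarrow> mdist X (f x) (f y) = c * mdist X x y"
  shows "covering_number X \<delta> (f ` F) = covering_number X (\<delta> / c) F"
proof (rule covering_number_similar[OF assms(1,2) _ assms(4,5)])
  show "f \<in> F \<rightarrow> mspace X" using assms(2,3) by auto
  fix x y assume "x \<in> F" "y \<in> F"
  then show "mdist X (f x) (f y) = c * mdist X x y" by (intro assms(6)) (use assms(2) in auto)
qed

lemma attractor_covering_number_le: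
  assumes "compact_space (mtopology_of X)" "similarity_ifs X N S r" "is_attractor X N S C F" "0 < \<delta>"
  shows "covering_number X \<delta> F \<le> (\<Sum>i<N. covering_number X (\<delta> / r i) F) + covering_number X \<delta> C"
proof -
  note F = attractorD[OF assms(3)] and S = similarity_ifsD[OF assms(2)]
  have SF: "S i ` F \<subseteq> mspace X" if "i < N" for i using F(2,6) that by blast
  have "covering_number X \<delta> ((\<Union>i<N. S i ` F) \<union> C)
      \<le> covering_number X \<delta> (\<Union>i<N. S i ` F) + covering_number X \<delta> C"
    using SF F(2,5) assms(1,4) by (intro covering_number_Un) auto
  also have "covering_number X \<delta> (\<Union>i<N. S i ` F) \<le> (\<Sum>i<N. covering_number X \<delta> (S i ` F))"
    using SF assms(1,4) by (intro covering_number_UN) auto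
  also have "(\<Sum>i<N. covering_number X \<delta> (S i ` F)) = (\<Sum>i<N. covering_number X (\<delta> / r i) F)"
    using assms(1,4) F(2) S by (intro sum.cong covering_number_similar_image) auto
  finally show ?thesis using F(4) by simp
qed

text \<open>The recursion for the covering numbers is solved by induction from coarse to fine scales.  The
  constant \<open>A\<close> is a solution of \<open>A * p + K \<le> A\<close> that is large enough for the scales between \<open>1\<close> and
  \<open>1 / b\<close>; one step of the recursion cannot jump over this range.\<close>

lemma upper_box_dim_attractor_le:
  assumes "compact_space (mtopology_of X)" "similarity_ifs X N S r" "is_attractor X N S C F"
    and t: "0 \<le> t" "(\<Sum>i<N. r i powr t) < 1"
    and K: "0 < K" "\<And>\<delta>. 0 < \<delta> \<Longrightarrow> \<delta> \<le> 1 \<Longrightarrow> real (covering_number X \<delta> C) \<le> K * \<delta> powr (- t)"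
  shows "upper_box_dim X F \<le> ereal t"
proof -
  note F = attractorD[OF assms(3)] and S = similarity_ifsD[OF assms(2)]
  define p where "p = (\<Sum>i<N. r i powr t)"
  obtain q where q: "0 < q" "q < 1" "\<And>i. i < N \<Longrightarrow> r i \<le> q"
    using ifs_ratio_bound[OF assms(2)] by auto
  define b where "b = Min (r ` {..<N})"
  have "r ` {..<N} \<noteq> {}" using ifs_index_nonempty[OF assms(2)] by simp
  then have "b \<in> r ` {..<N}" unfolding b_def by (intro Min_in) auto
  then have b: "0 < b" "b < 1" using S(2,3) by auto
  have br: "b \<le> r i" if "i < N" for i using that unfolding b_def by simp
  define A where "A = max (real (covering_number X 1 F) * b powr (- t)) (K / (1 - p))"
  have A0: "0 \<le> A" unfolding A_def by (simp add: le_max_iff_disj)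
  have AK: "A * p + K \<le> A"
  proof -
    have "K / (1 - p) \<le> A" unfolding A_def by simp
    then show ?thesis using t(2) by (simp add: p_def[symmetric] field_simps)
  qed
  have base: "real (covering_number X \<delta> F) \<le> A * \<delta> powr (- t)" if d: "1 \<le> \<delta>" "\<delta> \<le> 1 / b" for \<delta>
  proof -
    have "real (covering_number X \<delta> F) \<le> real (covering_number X 1 F)"
      using assms(1) F(2) d by (intro of_nat_mono covering_number_antimono) auto
    also have "\<dots> = (real (covering_number X 1 F) * b powr (- t)) * (1 / b) powr (- t)"
      using b by (simp add: powr_minus powr_divide field_simps)
    also have "\<dots> \<le> A * (1 / b) powr (- t)"
      unfolding A_def by (intro mult_right_mono) auto
    also have "\<dots> \<le> A * \<delta> powr (- t)"
      using d t(1) A0 b by (intro mult_left_mono powr_mono2') auto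
    finally show ?thesis .
  qed
  have main: "real (covering_number X \<delta> F) \<le> A * \<delta> powr (- t)" if "q ^ n \<le> \<delta>" "\<delta> \<le> 1 / b" for n \<delta>
    using that
  proof (induction n arbitrary: \<delta>)
    case 0
    then show ?case using base by simp
  next
    case (Suc n)
    have d0: "0 < \<delta>" using Suc.prems(1) q(1) by (meson less_le_trans zero_less_power)
    show ?case
    proof (cases "1 \<le> \<delta>")
      case True
      then show ?thesis using base Suc.prems by blast
    next
      case False
      have "real (covering_number X \<delta> F)
          \<le> real ((\<Sum>i<N. covering_number X (\<delta> / r i) F) + covering_number X \<delta> C)"
        by (intro of_nat_mono attractor_covering_number_le[OF assms(1,2,3) d0])
      also have "\<dots> = (\<Sum>i<N. real (covering_number X (\<delta> / r i) F)) + real (covering_number X \<delta> C)" by simp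
      also have "\<dots> \<le> (\<Sum>i<N. A * (\<delta> / r i) powr (- t)) + K * \<delta> powr (- t)"
      proof (intro add_mono sum_mono K(2) d0)
        fix i assume "i \<in> {..<N}"
        then have i: "i < N" by simp
        note ri = S(2,3)[OF i] q(3)[OF i] br[OF i]
        show "real (covering_number X (\<delta> / r i) F) \<le> A * (\<delta> / r i) powr (- t)"
        proof (rule Suc.IH)
          have "q ^ n * r i \<le> q ^ n * q" using ri q by (intro mult_left_mono) auto
          also have "\<dots> \<le> \<delta>" using Suc.prems by (simp add: mult.commute)
          finally show "q ^ n \<le> \<delta> / r i" using ri by (simp add: field_simps)
          show "\<delta> / r i \<le> 1 / b" using False ri d0 b by (intro frac_le) auto
        qed
      qed (use False in simp)
      also have "(\<Sum>i<N. A * (\<delta> / r i) powr (- t)) = A * p * \<delta> powr (- t)"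
      proof -
        have "(\<delta> / r i) powr (- t) = r i powr t * \<delta> powr (- t)" if "i < N" for i
          using S(2)[OF that] d0 by (simp add: powr_divide powr_minus field_simps)
        then have "(\<Sum>i<N. A * (\<delta> / r i) powr (- t)) = (\<Sum>i<N. A * \<delta> powr (- t) * r i powr t)"
          by (intro sum.cong) auto
        then show ?thesis by (simp add: p_def sum_distrib_left mult_ac)
      qed
      also have "A * p * \<delta> powr (- t) + K * \<delta> powr (- t) = (A * p + K) * \<delta> powr (- t)"
        by (simp add: algebra_simps)
      also have "\<dots> \<le> A * \<delta> powr (- t)" by (rule mult_right_mono[OF AK]) simp
      finally show ?thesis .
    qed
  qed
  show ?thesis
  proof (rule upper_box_dim_le[OF assms(1) F(2,1)])
    fix \<delta> :: real assume d: "0 < \<delta>" "\<delta> < 1"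
    obtain n where "q ^ n < \<delta>" using real_arch_pow_inv[OF d(1) q(2)] by blast
    moreover have "\<delta> \<le> 1 / b" using d b mult_mono[of \<delta> 1 b 1] by (simp add: field_simps)
    ultimately show "real (covering_number X \<delta> F) \<le> A * \<delta> powr (- t)" by (intro main[of n]) auto
  qed
qed

lemma upper_box_dim_attractor_le_max:
  assumes "inhomogeneous_system X N S r C F0 FC s"
  shows "upper_box_dim X FC \<le> max (ereal s) (upper_box_dim X C)"
proof (rule ccontr)
  note sys = inhomogeneous_systemD[OF assms]
  have C: "C \<subseteq> mspace X" using attractorD(2,5)[OF sys(5)] by blast
  assume "\<not> ?thesis"
  then obtain t where t: "max (ereal s) (upper_box_dim X C) < ereal t" "ereal t < upper_box_dim X FC"
    using ereal_dense2 by (meson not_le)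
  then have st: "s < t" "upper_box_dim X C < ereal t" by auto
  have t0: "0 \<le> t" using st(1) similarity_dim_nonneg[OF sys(2,6)] by simp
  obtain K where "0 < K" "\<And>\<delta>. 0 < \<delta> \<Longrightarrow> \<delta> \<le> 1 \<Longrightarrow> real (covering_number X \<delta> C) \<le> K * \<delta> powr (- t)"
    using covering_number_bound_if_upper_box_dim_less[OF sys(1) C sys(3) st(2) t0] by metis
  then have "upper_box_dim X FC \<le> ereal t"
    using sum_powr_strict_antimono[OF sys(2) st(1)] sys(6)
    by (intro upper_box_dim_attractor_le[OF sys(1,2,5) t0]) auto
  then show False using t(2) by simp
qed

lemma upper_box_dim_homogeneous_le:
  assumes "compact_space (mtopology_of X)" "similarity_ifs X N S r" "is_attractor X N S {} F0"
    "(\<Sum>i<N. r i powr s) = 1"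
  shows "upper_box_dim X F0 \<le> ereal s"
proof (rule ccontr)
  assume "\<not> ?thesis"
  then obtain t where t: "ereal s < ereal t" "ereal t < upper_box_dim X F0"
    using ereal_dense2 by (meson not_le)
  then have "0 \<le> t" "(\<Sum>i<N. r i powr t) < 1"
    using similarity_dim_nonneg[OF assms(2,4)] sum_powr_strict_antimono[OF assms(2), of s t] assms(4) by auto
  then have "upper_box_dim X F0 \<le> ereal t"
    by (intro upper_box_dim_attractor_le[OF assms(1-3), where K = 1]) (auto simp: covering_number_empty)
  then show False using t(2) by simp
qed

section \<open>The homogeneous attractor under the strong open set condition\<close>

text \<open>The superadditivity of covering numbers on separated pieces reverses the recursion: a bound
  \<open>\<eta> powr t * \<delta> powr - t\<close> holds trivially for \<open>\<delta> \<ge> \<eta>\<close> and is inherited by finer scales.\<close>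

lemma covering_number_ge_if_separated_copies:
  assumes "compact_space (mtopology_of X)" "F \<subseteq> mspace X" "F \<noteq> {}"
    and J: "finite J" "\<And>j. j \<in> J \<Longrightarrow> f j \<in> mspace X \<rightarrow> mspace X" "\<And>j. j \<in> J \<Longrightarrow> f j ` F \<subseteq> F"
      "\<And>j. j \<in> J \<Longrightarrow> 0 < c j \<and> c j < 1"
      "\<And>j x y. j \<in> J \<Longrightarrow> x \<in> mspace X \<Longrightarrow> y \<in> mspace X \<Longrightarrow> mdist X (f j x) (f j y) = c j * mdist X x y"
    and sep: "0 < \<eta>" "\<And>j k x y. j \<in> J \<Longrightarrow> k \<in> J \<Longrightarrow> j \<noteq> k \<Longrightarrow> x \<in> f j ` F \<Longrightarrow> y \<in> f k ` F \<Longrightarrow> \<eta> \<le> mdist X x y"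
    and t: "0 \<le> t" "1 \<le> (\<Sum>j\<in>J. c j powr t)"
    and d: "0 < \<delta>"
  shows "\<eta> powr t * \<delta> powr (- t) \<le> real (covering_number X \<delta> F)"
proof -
  have "J \<noteq> {}" using t(2) by auto
  then have "\<exists>q. 0 < q \<and> q < 1 \<and> (\<forall>j\<in>J. c j \<le> q)" by (intro uniform_ratio_bound J(1,4))
  then obtain q where q: "0 < q" "q < 1" "\<And>j. j \<in> J \<Longrightarrow> c j \<le> q" by blast
  have main: "\<eta> powr t * \<delta> powr (- t) \<le> real (covering_number X \<delta> F)" if "\<eta> * q ^ n \<le> \<delta>" "0 < \<delta>" for n \<delta>
    using that
  proof (induction n arbitrary: \<delta>)
    case 0
    have "\<eta> powr t * \<delta> powr (- t) \<le> \<delta> powr t * \<delta> powr (- t)"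
      using 0 sep(1) t(1) by (intro mult_right_mono powr_mono2) auto
    also have "\<dots> = 1" using 0 by (simp flip: powr_add)
    also have "\<dots> \<le> real (covering_number X \<delta> F)"
      using covering_number_pos[OF assms(1,2) 0(2) assms(3)] by simp
    finally show ?case .
  next
    case (Suc n)
    show ?case
    proof (cases "\<eta> \<le> \<delta>")
      case True
      have "\<eta> powr t * \<delta> powr (- t) \<le> \<delta> powr t * \<delta> powr (- t)"
        using True sep(1) t(1) by (intro mult_right_mono powr_mono2) auto
      also have "\<dots> = 1" using Suc by (simp flip: powr_add)
      also have "\<dots> \<le> real (covering_number X \<delta> F)"
        using covering_number_pos[OF assms(1,2) Suc.prems(2) assms(3)] by simp
      finally show ?thesis .
    next
      case False
      have "\<eta> powr t * \<delta> powr (- t) \<le> \<eta> powr t * \<delta> powr (- t) * (\<Sum>j\<in>J. c j powr t)"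
        using mult_left_mono[OF t(2), of "\<eta> powr t * \<delta> powr (- t)"] by simp
      also have "\<dots> = (\<Sum>j\<in>J. \<eta> powr t * (\<delta> / c j) powr (- t))"
        unfolding sum_distrib_left
      proof (rule sum.cong)
        fix j assume "j \<in> J"
        then show "\<eta> powr t * \<delta> powr (- t) * c j powr t = \<eta> powr t * (\<delta> / c j) powr (- t)"
          using J(4) Suc.prems(2) by (simp add: powr_divide powr_minus field_simps)
      qed simp
      also have "\<dots> \<le> (\<Sum>j\<in>J. real (covering_number X (\<delta> / c j) F))"
      proof (rule sum_mono)
        fix j assume j: "j \<in> J"
        show "\<eta> powr t * (\<delta> / c j) powr (- t) \<le> real (covering_number X (\<delta> / c j) F)"
        proof (rule Suc.IH)
          have "\<eta> * q ^ n * c j \<le> \<eta> * q ^ n * q" using q j sep(1) by (intro mult_left_mono) auto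
          also have "\<dots> \<le> \<delta>" using Suc.prems by (simp add: mult_ac)
          finally show "\<eta> * q ^ n \<le> \<delta> / c j" using J(4)[OF j] by (simp add: field_simps)
          show "0 < \<delta> / c j" using J(4)[OF j] Suc.prems by simp
        qed
      qed
      also have "\<dots> = (\<Sum>j\<in>J. real (covering_number X \<delta> (f j ` F)))"
      proof (rule sum.cong[OF refl])
        fix j assume j: "j \<in> J"
        have "covering_number X \<delta> (f j ` F) = covering_number X (\<delta> / c j) F"
          by (rule covering_number_similar_image[OF assms(1,2) J(2)[OF j] _ Suc.prems(2) J(5)[OF j]])
            (use J(4)[OF j] in simp)
        then show "real (covering_number X (\<delta> / c j) F) = real (covering_number X \<delta> (f j ` F))" by simp
      qed
      also have "\<dots> = real (\<Sum>j\<in>J. covering_number X \<delta> (f j ` F))" by simp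
      also have "\<dots> \<le> real (covering_number X \<delta> F)"
      proof (intro of_nat_mono covering_number_separated)
        fix j k x y assume "j \<in> J" "k \<in> J" "j \<noteq> k" "x \<in> f j ` F" "y \<in> f k ` F"
        then show "\<delta> < mdist X x y" using sep(2)[of j k x y] False by simp
      qed (use assms(1,2) J Suc.prems in auto)
      finally show ?thesis .
    qed
  qed
  obtain n where "q ^ n < \<delta> / \<eta>" using real_arch_pow_inv[of "\<delta> / \<eta>" q] q d sep(1) by auto
  then show ?thesis using d sep(1) by (intro main[of n]) (auto simp: field_simps)
qed

lemma sum_words_ratio:
  assumes "similarity_ifs X N S r"
  shows "(\<Sum>w | w \<in> lists {..<N} \<and> length w = k. word_ratio r w powr t) = (\<Sum>i<N. r i powr t) ^ k"
proof (induction k)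
  case 0
  have "{w. w \<in> lists {..<N} \<and> length w = 0} = {[]}" by auto
  then show ?case by (simp add: word_ratio_def)
next
  case (Suc k)
  let ?L = "\<lambda>k. {w. w \<in> lists {..<N} \<and> length w = k}"
  have im: "?L (Suc k) = (\<lambda>(i, w). i # w) ` ({..<N} \<times> ?L k)"
    by (auto simp: length_Suc_conv image_iff)
  have inj: "inj_on (\<lambda>(i, w). i # w) ({..<N} \<times> ?L k)" by (auto simp: inj_on_def)
  have "(\<Sum>w\<in>?L (Suc k). word_ratio r w powr t)
      = (\<Sum>(i, w)\<in>{..<N} \<times> ?L k. word_ratio r (i # w) powr t)"
    unfolding im sum.reindex[OF inj] by (simp add: case_prod_unfold)
  also have "\<dots> = (\<Sum>(i, w)\<in>{..<N} \<times> ?L k. r i powr t * word_ratio r w powr t)"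
    using word_ratio_pos[OF assms] similarity_ifsD(2)[OF assms]
    by (intro sum.cong) (auto simp: word_ratio_def powr_mult less_imp_le)
  also have "\<dots> = (\<Sum>i<N. r i powr t) * (\<Sum>w\<in>?L k. word_ratio r w powr t)"
    by (simp add: sum_product sum.cartesian_product)
  finally show ?case using Suc.IH by simp
qed

lemma word_images_disjoint:
  assumes "similarity_ifs X N S r" "U \<subseteq> mspace X" "\<And>i. i < N \<Longrightarrow> S i ` U \<subseteq> U"
    "disjoint_family_on (\<lambda>i. S i ` U) {..<N}"
    "v \<in> lists {..<N}" "w \<in> lists {..<N}" "length v = length w" "v \<noteq> w"
  shows "foldr S v ` U \<inter> foldr S w ` U = {}"
  using assms(5-8)
proof (induction v arbitrary: w)
  case (Cons i v)
  then obtain j w' where w: "w = j # w'" by (cases w) auto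
  have ij: "i < N" "j < N" and vw: "v \<in> lists {..<N}" "w' \<in> lists {..<N}" "length v = length w'"
    using Cons.hyps Cons.prems(1,2)[unfolded w] by simp_all
  have sub: "foldr S v ` U \<subseteq> U" "foldr S w' ` U \<subseteq> U"
    by (rule word_map_image_subset, rule assms(3), assumption, rule vw)+
  show ?case
  proof (rule equals0I)
    fix x assume "x \<in> foldr S (i # v) ` U \<inter> foldr S w ` U"
    then have "x \<in> S i ` foldr S v ` U" "x \<in> S j ` foldr S w' ` U" by (auto simp: w image_comp)
    then obtain a b where ab: "a \<in> foldr S v ` U" "b \<in> foldr S w' ` U" "x = S i a" "x = S j b" by blast
    have "a \<in> U" "b \<in> U" using ab(1,2) sub by blast+
    then have "x \<in> S i ` U" "x \<in> S j ` U" using ab(3,4) by blast+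
    then have eq: "i = j" using assms(4) ij unfolding disjoint_family_on_def by blast
    have m: "a \<in> mspace X" "b \<in> mspace X" using ab sub assms(2) by auto
    have "r i * mdist X a b = mdist X x x"
      using similarity_ifsD(4)[OF assms(1) ij(1) m] ab eq by simp
    moreover have "x \<in> mspace X" using \<open>x \<in> S i ` U\<close> assms(2,3) ij by blast
    ultimately have "a = b" using m similarity_ifsD(2)[OF assms(1) ij(1)] by (simp add: mdist_self)
    moreover have "v \<noteq> w'" using Cons.prems(3) eq w by simp
    ultimately show False using Cons.IH[OF vw(2,3)] ab by blast
  qed
qed simp

text \<open>For \<open>t < s\<close> the sum \<open>p\<close> of the \<open>r i powr t\<close> exceeds \<open>1\<close>.  Composing all words \<open>w\<close> of length \<open>k\<close> with a fixed
  word \<open>u\<close> whose image of \<open>F0\<close> lies in \<open>U\<close> gives separated copies of \<open>F0\<close>, with sum \<open>p ^ k\<close> times a constant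
  depending on \<open>u\<close>.  For large \<open>k\<close> this is at least \<open>1\<close>.\<close>

lemma lower_box_dim_ge_similarity_dim:
  assumes "compact_space (mtopology_of X)" "similarity_ifs X N S r" "is_attractor X N S {} F0"
    "(\<Sum>i<N. r i powr s) = 1" "strong_open_set_condition X N S C F0 FC"
  shows "ereal s \<le> lower_box_dim X F0"
proof (rule ccontr)
  note F0 = attractorD[OF assms(3)]
  assume "\<not> ?thesis"
  then obtain t where t: "lower_box_dim X F0 < ereal t" "ereal t < ereal s"
    using ereal_dense2 by (meson not_le)
  have "ereal 0 \<le> lower_box_dim X F0"
  proof (rule lower_box_dim_ge[of 1])
    fix \<delta> :: real assume d: "0 < \<delta>"
    then show "1 * \<delta> powr (- 0) \<le> real (covering_number X \<delta> F0)"
      using covering_number_pos[OF assms(1) F0(2) d F0(1)] by simp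
  qed simp
  then have t0: "0 \<le> t" using t(1) by (metis ereal_less_eq(3) less_imp_le order_trans)
  define p where "p = (\<Sum>i<N. r i powr t)"
  have p1: "1 < p" unfolding p_def using sum_powr_strict_antimono[OF assms(2), of t s] t(2) assms(4) by simp
  obtain U x where U: "openin (mtopology_of X) U" "x \<in> F0" "x \<in> U" "\<And>i. i < N \<Longrightarrow> S i ` U \<subseteq> U"
      "disjoint_family_on (\<lambda>i. S i ` U) {..<N}"
    using assms(5) unfolding strong_open_set_condition_def by fast
  have UX: "U \<subseteq> mspace X" using openin_subset[OF U(1)] by simp
  obtain \<epsilon> where e: "0 < \<epsilon>" "mball_of X x \<epsilon> \<subseteq> U"
  proof -
    interpret Metric_space "mspace X" "mdist X" by blast
    show ?thesis using that U(1,3) unfolding mtopology_of_def mball_of_def openin_mtopology by blast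
  qed
  from word_images_shrink[OF assms(1,2) e(1)] obtain n where n1: "1 \<le> n"
    and n0: "\<forall>w\<in>lists {..<N}. length w = n \<longrightarrow>
      (\<forall>x\<in>mspace X. \<forall>y\<in>mspace X. mdist X (foldr S w x) (foldr S w y) < \<epsilon>)" by blast
  have n2: "mdist X (foldr S w x) (foldr S w y) < \<epsilon>"
    if "w \<in> lists {..<N}" "length w = n" "x \<in> mspace X" "y \<in> mspace X" for w x y using n0 that by blast
  note n = n1 n2
  obtain u a where u: "u \<in> lists {..<N}" "length u = n" "a \<in> F0" "x = foldr S u a"
    using attractor_unfold_words[OF F0(4) U(2), of n] by auto
  have uU: "foldr S u ` F0 \<subseteq> U"
  proof
    fix y assume "y \<in> foldr S u ` F0"
    then obtain b where b: "b \<in> F0" "y = foldr S u b" by auto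
    then have "y \<in> mball_of X x \<epsilon>"
      using n(2)[OF u(1,2)] u(3,4) F0(2) word_map_in_mspace[OF assms(2) u(1)] by auto
    then show "y \<in> U" using e(2) by blast
  qed
  have u0: "0 < word_ratio r u powr t" using word_ratio_pos[OF assms(2) u(1)] by simp
  obtain k where k: "1 / word_ratio r u powr t < p ^ k" using real_arch_pow[OF p1] by blast
  define J where "J = {w. w \<in> lists {..<N} \<and> length w = k}"
  have J: "finite J" "\<And>w. w \<in> J \<Longrightarrow> w \<in> lists {..<N}" "\<And>w. w \<in> J \<Longrightarrow> w @ u \<in> lists {..<N}"
    using u(1) finite_lists_length_eq[of "{..<N}" k] unfolding J_def lists_eq_set by auto
  have cpt: "compactin (mtopology_of X) (foldr S (w @ u) ` F0)" if "w \<in> J" for w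
    using word_map_in_mspace[OF assms(2) J(3)[OF that]] word_map_similarity[OF assms(2) J(3)[OF that]]
    by (intro compact_similar_image[OF F0(3)]) auto
  have disj: "foldr S (v @ u) ` F0 \<inter> foldr S (w @ u) ` F0 = {}" if vw: "v \<in> J" "w \<in> J" "v \<noteq> w" for v w
  proof -
    have "foldr S v ` U \<inter> foldr S w ` U = {}"
      using vw by (intro word_images_disjoint[OF assms(2) UX U(4,5)]) (auto simp: J_def)
    moreover have "foldr S (v @ u) ` F0 \<subseteq> foldr S v ` U" "foldr S (w @ u) ` F0 \<subseteq> foldr S w ` U"
      using uU by auto
    ultimately show ?thesis by blast
  qed
  have "\<exists>\<eta>>0. \<forall>x\<in>foldr S (v @ u) ` F0. \<forall>y\<in>foldr S (w @ u) ` F0. v \<noteq> w \<longrightarrow> \<eta> \<le> mdist X x y"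
    if vw: "v \<in> J" "w \<in> J" for v w
  proof (cases "v = w")
    case True
    then show ?thesis by (intro exI[of _ 1]) auto
  next
    case False
    then show ?thesis using disjoint_compact_gap[OF cpt[OF vw(1)] cpt[OF vw(2)] disj[OF vw]] by blast
  qed
  then obtain gap where gap: "\<And>v w. v \<in> J \<Longrightarrow> w \<in> J \<Longrightarrow> 0 < gap v w"
    "\<And>v w x y. v \<in> J \<Longrightarrow> w \<in> J \<Longrightarrow> v \<noteq> w \<Longrightarrow> x \<in> foldr S (v @ u) ` F0 \<Longrightarrow> y \<in> foldr S (w @ u) ` F0 \<Longrightarrow>
      gap v w \<le> mdist X x y" by metis
  \<comment> \<open>Gaps are positive also for equal words, where they carry no information.\<close>
  define \<eta> where "\<eta> = Min (insert 1 ((\<lambda>(v, w). gap v w) ` (J \<times> J)))"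
  have fin: "finite (insert 1 ((\<lambda>(v, w). gap v w) ` (J \<times> J)))" using J(1) by simp
  have eta0: "0 < \<eta>" unfolding \<eta>_def using fin gap(1) by (subst Min_gr_iff) auto
  have eta: "\<eta> \<le> gap v w" if "v \<in> J" "w \<in> J" for v w
    unfolding \<eta>_def using fin that by (intro Min_le) auto
  obtain q where q: "0 < q" "q < 1" "\<And>i. i < N \<Longrightarrow> r i \<le> q"
    using ifs_ratio_bound[OF assms(2)] by auto
  have "ereal t \<le> lower_box_dim X F0"
  proof (rule lower_box_dim_ge)
    show "0 < \<eta> powr t" using eta0 by simp
    fix \<delta> :: real assume d: "0 < \<delta>"
    show "\<eta> powr t * \<delta> powr (- t) \<le> real (covering_number X \<delta> F0)"
    proof (rule covering_number_ge_if_separated_copies[OF assms(1) F0(2,1) J(1),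
          where f = "\<lambda>w. foldr S (w @ u)" and c = "\<lambda>w. word_ratio r (w @ u)"])
      fix w assume w: "w \<in> J"
      note wu = J(3)[OF w]
      show "foldr S (w @ u) \<in> mspace X \<rightarrow> mspace X" using word_map_in_mspace[OF assms(2) wu] by blast
      show "foldr S (w @ u) ` F0 \<subseteq> F0" using attractor_word_image[OF assms(3) wu] .
      have "word_ratio r (w @ u) \<le> q ^ length (w @ u)"
        using word_ratio_le_power[OF assms(2) wu q(3)] .
      also have "\<dots> < 1" using power_strict_decreasing[of 0 "length (w @ u)" q] q n(1) u(2) by simp
      finally show "0 < word_ratio r (w @ u) \<and> word_ratio r (w @ u) < 1"
        using word_ratio_pos[OF assms(2) wu] by simp
      show "mdist X (foldr S (w @ u) x) (foldr S (w @ u) y) = word_ratio r (w @ u) * mdist X x y"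
        if "x \<in> mspace X" "y \<in> mspace X" for x y using word_map_similarity[OF assms(2) wu that] .
    next
      fix v w x y assume vw: "v \<in> J" "w \<in> J" "v \<noteq> w"
        and xy: "x \<in> foldr S (v @ u) ` F0" "y \<in> foldr S (w @ u) ` F0"
      show "\<eta> \<le> mdist X x y" by (rule order_trans[OF eta[OF vw(1,2)] gap(2)[OF vw xy]])
    next
      have "(\<Sum>w\<in>J. word_ratio r (w @ u) powr t) = (\<Sum>w\<in>J. word_ratio r w powr t * word_ratio r u powr t)"
        using word_ratio_pos[OF assms(2) u(1)] word_ratio_pos[OF assms(2) J(2)]
        by (intro sum.cong) (auto simp: word_ratio_def powr_mult less_imp_le)
      also have "\<dots> = p ^ k * word_ratio r u powr t"
        using sum_words_ratio[OF assms(2), where k = k and t = t] by (simp add: J_def p_def flip: sum_distrib_right)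
      finally show "1 \<le> (\<Sum>w\<in>J. word_ratio r (w @ u) powr t)" using k u0 by (simp add: field_simps)
    qed (use eta0 t0 d in auto)
  qed
  then show False using t(1) by simp
qed

lemma has_box_dim_homogeneous:
  assumes "compact_space (mtopology_of X)" "similarity_ifs X N S r" "is_attractor X N S {} F0"
    "(\<Sum>i<N. r i powr s) = 1" "strong_open_set_condition X N S C F0 FC"
  shows "has_box_dim X F0 (ereal s)"
  using lower_box_dim_ge_similarity_dim[OF assms] upper_box_dim_homogeneous_le[OF assms(1-4)]
    lower_le_upper_box_dim[of X F0] unfolding has_box_dim_def by (meson order_antisym order_trans)

section \<open>Sequences with the first-difference metric\<close>

definition seq_dist :: "(nat \<Rightarrow> nat) \<Rightarrow> (nat \<Rightarrow> nat) \<Rightarrow> real" where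
  "seq_dist x y = (if x = y then 0 else (1/2) ^ (LEAST i. x i \<noteq> y i))"

lemma seq_dist_first_difference:
  assumes "x \<noteq> y"
  shows "\<exists>m. seq_dist x y = (1/2) ^ m \<and> x m \<noteq> y m \<and> (\<forall>i<m. x i = y i)"
proof -
  have ex: "\<exists>i. x i \<noteq> y i" using assms by auto
  show ?thesis
  proof (intro exI conjI allI impI)
    show "seq_dist x y = (1/2) ^ (LEAST i. x i \<noteq> y i)" using assms by (simp add: seq_dist_def)
    show "x (LEAST i. x i \<noteq> y i) \<noteq> y (LEAST i. x i \<noteq> y i)" using ex by (rule LeastI_ex)
    fix i assume "i < (LEAST i. x i \<noteq> y i)"
    then show "x i = y i" using not_less_Least by blast
  qed
qed

text \<open>Only distances \<open>0\<close> and \<open>(1/2) ^ m\<close> occur, so comparisons with powers of \<open>1/2\<close> determine the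
  metric, and the strict comparison sees one more entry than the weak one.\<close>

lemma seq_dist_le_iff: "seq_dist x y \<le> (1/2) ^ n \<longleftrightarrow> (\<forall>i<n. x i = y i)"
proof (cases "x = y")
  case False
  from seq_dist_first_difference[OF this] obtain m
    where m: "seq_dist x y = (1/2) ^ m" "x m \<noteq> y m" "\<And>i. i < m \<Longrightarrow> x i = y i" by blast
  have "(1/2 :: real) ^ m \<le> (1/2) ^ n \<longleftrightarrow> n \<le> m" by (rule power_decreasing_iff) auto
  then show ?thesis using m by (metis not_le order_less_le_trans)
qed (simp add: seq_dist_def)

lemma seq_dist_less_iff: "seq_dist x y < (1/2) ^ n \<longleftrightarrow> (\<forall>i\<le>n. x i = y i)"
proof (cases "x = y")
  case False
  from seq_dist_first_difference[OF this] obtain m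
    where m: "seq_dist x y = (1/2) ^ m" "x m \<noteq> y m" "\<And>i. i < m \<Longrightarrow> x i = y i" by blast
  have "(1/2 :: real) ^ m < (1/2) ^ n \<longleftrightarrow> n < m" by (rule power_strict_decreasing_iff) auto
  then show ?thesis using m by (metis not_le order_le_less_trans)
qed (simp add: seq_dist_def)

lemma Metric_space_seq_dist: "Metric_space UNIV seq_dist"
proof
  show "0 \<le> seq_dist x y" for x y by (simp add: seq_dist_def)
  show "seq_dist x y = seq_dist y x" for x y by (simp add: seq_dist_def eq_commute)
  show "seq_dist x y = 0 \<longleftrightarrow> x = y" for x y by (simp add: seq_dist_def)
  show "seq_dist x z \<le> seq_dist x y + seq_dist y z" for x y z
  proof (cases "x = z")
    case True
    then show ?thesis by (simp add: seq_dist_def)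
  next
    case False
    from seq_dist_first_difference[OF this] obtain m
      where m: "seq_dist x z = (1/2) ^ m" "x m \<noteq> z m" by blast
    have "\<not> (seq_dist x y < (1/2) ^ m \<and> seq_dist y z < (1/2) ^ m)"
      using m(2) unfolding seq_dist_less_iff by (metis order_refl)
    moreover have "0 \<le> seq_dist x y" "0 \<le> seq_dist y z" by (simp_all add: seq_dist_def)
    ultimately show ?thesis using m(1) by linarith
  qed
qed

abbreviation seq_cons :: "nat \<Rightarrow> (nat \<Rightarrow> nat) \<Rightarrow> nat \<Rightarrow> nat" where
  "seq_cons i x \<equiv> case_nat i x"

lemma seq_cons_eq_iff: "seq_cons i x = seq_cons j y \<longleftrightarrow> i = j \<and> x = y"
proof
  assume eq: "seq_cons i x = seq_cons j y"
  have "i = j" using fun_cong[OF eq, of 0] by simp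
  moreover have "x n = y n" for n using fun_cong[OF eq, of "Suc n"] by simp
  ultimately show "i = j \<and> x = y" by auto
qed simp

lemma seq_dist_cons: "seq_dist (seq_cons i x) (seq_cons i y) = 1/2 * seq_dist x y"
proof (cases "x = y")
  case False
  then obtain n where "x n \<noteq> y n" by auto
  then have "(LEAST n. seq_cons i x n \<noteq> seq_cons i y n) = Suc (LEAST n. x n \<noteq> y n)"
    by (subst Least_Suc[of _ "Suc n"]) auto
  moreover have "seq_cons i x \<noteq> seq_cons i y" using False by (simp add: seq_cons_eq_iff)
  ultimately show ?thesis using False by (simp add: seq_dist_def)
qed (simp add: seq_dist_def)

lemma seq_dist_le_1: "seq_dist x y \<le> 1"
  using seq_dist_le_iff[of x y 0] by simp

lemma seq_dist_eq_1: "x 0 \<noteq> y 0 \<Longrightarrow> seq_dist x y = 1"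
  using seq_dist_less_iff[of x y 0] seq_dist_le_1[of x y] by auto

lemma ex_inj_seq_real: "\<exists>e :: (nat \<Rightarrow> nat) \<Rightarrow> real. inj e"
proof -
  obtain g :: "nat set \<Rightarrow> real" where g: "bij g"
    using nat_sets_eqpoll_reals unfolding eqpoll_def by blast
  let ?G = "\<lambda>x :: nat \<Rightarrow> nat. (\<lambda>i. prod_encode (i, x i)) ` UNIV"
  have "inj ?G"
  proof (rule injI, rule ext)
    fix x y :: "nat \<Rightarrow> nat" and i assume "?G x = ?G y"
    then have "prod_encode (i, x i) \<in> ?G y" by blast
    then show "x i = y i" by (auto simp: prod_encode_eq)
  qed
  then have "inj (g \<circ> ?G)" using bij_is_inj[OF g] by (intro inj_compose)
  then show ?thesis by blast
qed

text \<open>An arbitrary injection, by which real numbers serve as names of sequences.\<close>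

definition seq_code :: "(nat \<Rightarrow> nat) \<Rightarrow> real" where
  "seq_code = (SOME e. inj e)"

definition seq_decode :: "real \<Rightarrow> nat \<Rightarrow> nat" where
  "seq_decode = inv seq_code"

lemma inj_seq_code: "inj seq_code"
  unfolding seq_code_def using ex_inj_seq_real by (rule someI_ex)

lemma seq_decode_code [simp]: "seq_decode (seq_code x) = x"
  by (simp add: seq_decode_def inj_seq_code)

lemma seq_code_eq_iff [simp]: "seq_code x = seq_code y \<longleftrightarrow> x = y"
  using inj_seq_code by (simp add: inj_eq)

definition bounded_seqs :: "(nat \<Rightarrow> nat) \<Rightarrow> (nat \<Rightarrow> nat) set" where
  "bounded_seqs B = {x. \<forall>i. x i \<le> B i}"

definition seq_space :: "(nat \<Rightarrow> nat) \<Rightarrow> real metric" where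
  "seq_space B = metric (seq_code ` bounded_seqs B, \<lambda>u v. seq_dist (seq_decode u) (seq_decode v))"

lemma Metric_space_seq_code:
  "Metric_space (seq_code ` bounded_seqs B) (\<lambda>u v. seq_dist (seq_decode u) (seq_decode v))"
proof -
  interpret Metric_space UNIV seq_dist by (rule Metric_space_seq_dist)
  show ?thesis
    by unfold_locales (auto simp: commute triangle)
qed

lemma mspace_seq_space [simp]: "mspace (seq_space B) = seq_code ` bounded_seqs B"
  unfolding seq_space_def by (rule Metric_space.mspace_metric[OF Metric_space_seq_code])

lemma mdist_seq_space [simp]: "mdist (seq_space B) (seq_code x) (seq_code y) = seq_dist x y"
  unfolding seq_space_def by (simp add: Metric_space.mdist_metric[OF Metric_space_seq_code])

text \<open>A product of finite discrete spaces is compact, and the coding is continuous because a cylinder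
  fixing the first \<open>n\<close> entries is open in the product topology.\<close>

lemma compact_seq_space: "compact_space (mtopology_of (seq_space B))"
proof -
  interpret Metric_space "mspace (seq_space B)" "mdist (seq_space B)" by blast
  let ?T = "product_topology (\<lambda>i. discrete_topology {..B i}) UNIV"
  have top: "topspace ?T = bounded_seqs B"
    by (auto simp: bounded_seqs_def PiE_UNIV_domain)
  have "compact_space ?T"
    unfolding compact_space_product_topology by (simp add: compact_space_discrete_topology)
  then have cpt: "compactin ?T (bounded_seqs B)" unfolding compact_space_def top .
  have "continuous_map ?T mtopology seq_code"
    unfolding continuous_map_to_metric
  proof (intro ballI allI impI)
    fix x and \<epsilon> :: real assume "x \<in> topspace ?T" and e: "0 < \<epsilon>"
    then have x: "x \<in> bounded_seqs B" using top by simp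
    obtain n where n: "(1/2 :: real) ^ n < \<epsilon>" using real_arch_pow_inv[OF e, of "1/2"] by auto
    let ?V = "\<lambda>i. if i < n then {x i} else {..B i}"
    have "openin ?T (PiE UNIV ?V)"
    proof (rule product_topology_basis)
      show "openin (discrete_topology {..B i}) (?V i)" for i
        using x by (auto simp: bounded_seqs_def)
      have "{i. ?V i \<noteq> topspace (discrete_topology {..B i})} \<subseteq> {..<n}" by auto
      then show "finite {i. ?V i \<noteq> topspace (discrete_topology {..B i})}"
        using finite_subset by blast
    qed
    moreover have "x \<in> PiE UNIV ?V" using x by (auto simp: bounded_seqs_def)
    moreover have "seq_code y \<in> mball (seq_code x) \<epsilon>" if "y \<in> PiE UNIV ?V" for y
    proof -
      have yV: "y i \<in> ?V i" for i using that by (auto simp: PiE_iff)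
      have "y \<in> bounded_seqs B" unfolding bounded_seqs_def
      proof (intro CollectI allI)
        show "y i \<le> B i" for i using yV[of i] x by (auto simp: bounded_seqs_def split: if_splits)
      qed
      moreover have "seq_dist x y \<le> (1/2) ^ n" unfolding seq_dist_le_iff
      proof (intro allI impI)
        show "x i = y i" if "i < n" for i using yV[of i] that by simp
      qed
      ultimately show ?thesis unfolding in_mball using x n by simp
    qed
    ultimately show "\<exists>U. openin ?T U \<and> x \<in> U \<and> (\<forall>y\<in>U. seq_code y \<in> mball (seq_code x) \<epsilon>)"
      by blast
  qed
  then have "compactin mtopology (seq_code ` bounded_seqs B)" using cpt by (rule image_compactin[rotated])
  moreover have "topspace mtopology = seq_code ` bounded_seqs B"
    using topspace_mtopology unfolding mspace_seq_space .
  ultimately show ?thesis unfolding compact_space_def mtopology_of_def by (simp only:)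
qed

text \<open>Closedness in the product topology, as a condition on sequences.\<close>

definition prefix_closed :: "(nat \<Rightarrow> nat) set \<Rightarrow> bool" where
  "prefix_closed E \<longleftrightarrow> (\<forall>x. (\<forall>n. \<exists>y\<in>E. \<forall>i<n. x i = y i) \<longrightarrow> x \<in> E)"

lemma compactin_seq_space:
  assumes "E \<subseteq> bounded_seqs B" "prefix_closed E"
  shows "compactin (mtopology_of (seq_space B)) (seq_code ` E)"
proof -
  interpret Metric_space "mspace (seq_space B)" "mdist (seq_space B)" by blast
  have "mtopology closure_of (seq_code ` E) \<subseteq> seq_code ` E"
  proof
    fix u assume u: "u \<in> mtopology closure_of (seq_code ` E)"
    then have "u \<in> mspace (seq_space B)" unfolding metric_closure_of by simp
    then obtain x where x: "x \<in> bounded_seqs B" "u = seq_code x" by auto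
    have "\<exists>y\<in>E. \<forall>i<n. x i = y i" for n
    proof -
      have "\<exists>v\<in>seq_code ` E. v \<in> mball u ((1/2) ^ n)" using u unfolding metric_closure_of by simp
      then obtain y where "y \<in> E" "seq_code y \<in> mball u ((1/2) ^ n)" by blast
      then have "y \<in> E" "seq_dist x y < (1/2) ^ n" unfolding in_mball x(2) by simp_all
      then show ?thesis unfolding seq_dist_less_iff by (meson less_imp_le)
    qed
    then have "x \<in> E" using assms(2) unfolding prefix_closed_def by blast
    then show "u \<in> seq_code ` E" using x(2) by simp
  qed
  moreover have "seq_code ` E \<subseteq> topspace mtopology"
    unfolding topspace_mtopology using assms(1) by auto
  ultimately have "closedin mtopology (seq_code ` E)" unfolding closure_of_subset_eq[symmetric] by blast
  then show ?thesis
    using compact_seq_space[of B] closedin_compact_space unfolding mtopology_of_def by blast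
qed

section \<open>Inhomogeneous systems on sequences\<close>

definition cons_map :: "nat \<Rightarrow> real \<Rightarrow> real" where
  "cons_map i u = seq_code (seq_cons i (seq_decode u))"

text \<open>The attractor with condensation set \<open>E\<close> for the two maps that prepend \<open>0\<close> and \<open>1\<close>; for \<open>E = {}\<close> it is the
  set of binary sequences.\<close>

definition binary_tail_seqs :: "(nat \<Rightarrow> nat) set \<Rightarrow> (nat \<Rightarrow> nat) set" where
  "binary_tail_seqs E = {x. (\<forall>i. x i < 2) \<or> (\<exists>k. (\<forall>i<k. x i < 2) \<and> (\<lambda>i. x (i + k)) \<in> E)}"

lemma cons_map_image: "cons_map i ` seq_code ` E = seq_code ` seq_cons i ` E"
  by (simp add: image_image cons_map_def)

lemma seq_cons_bounded:
  assumes "mono B" "2 \<le> B 0" "i < 2" "x \<in> bounded_seqs B"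
  shows "seq_cons i x \<in> bounded_seqs B"
  unfolding bounded_seqs_def
proof (intro CollectI allI)
  fix n
  show "seq_cons i x n \<le> B n"
  proof (cases n)
    case (Suc m)
    have "x m \<le> B m" using assms(4) by (simp add: bounded_seqs_def)
    also have "\<dots> \<le> B (Suc m)" using assms(1) by (simp add: mono_def)
    finally show ?thesis using Suc by simp
  qed (use assms in simp)
qed

lemma similarity_ifs_cons_map:
  assumes "mono B" "2 \<le> B 0"
  shows "similarity_ifs (seq_space B) 2 cons_map (\<lambda>_. 1/2)"
  unfolding similarity_ifs_def
proof (intro conjI allI impI ballI)
  fix i :: nat assume i: "i < 2"
  show "cons_map i \<in> mspace (seq_space B) \<rightarrow> mspace (seq_space B)"
    using seq_cons_bounded[OF assms i] by (auto simp: cons_map_def)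
  fix u v assume "u \<in> mspace (seq_space B)" "v \<in> mspace (seq_space B)"
  then show "mdist (seq_space B) (cons_map i u) (cons_map i v) = 1/2 * mdist (seq_space B) u v"
    by (auto simp: cons_map_def seq_dist_cons)
qed auto

lemma binary_tail_seqs_bounded:
  assumes "mono B" "2 \<le> B 0" "E \<subseteq> bounded_seqs B"
  shows "binary_tail_seqs E \<subseteq> bounded_seqs B"
proof
  fix x assume "x \<in> binary_tail_seqs E"
  have B2: "2 \<le> B i" for i using assms(1,2) by (meson le0 monoD order_trans)
  have "x i \<le> B i" for i
  proof (cases "x i < 2")
    case True
    then show ?thesis using B2[of i] by linarith
  next
    case False
    then obtain k where k: "\<forall>i<k. x i < 2" "(\<lambda>i. x (i + k)) \<in> E"
      using \<open>x \<in> binary_tail_seqs E\<close> unfolding binary_tail_seqs_def by auto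
    then have ki: "k \<le> i" using False by (meson not_le)
    have "x (i - k + k) \<le> B (i - k)" using k(2) assms(3) unfolding bounded_seqs_def by blast
    also have "\<dots> \<le> B i" using assms(1) by (simp add: mono_def)
    finally show ?thesis using ki by simp
  qed
  then show "x \<in> bounded_seqs B" by (simp add: bounded_seqs_def)
qed

lemma binary_tail_seqs_unfold:
  assumes "\<And>x. x \<in> E \<Longrightarrow> 2 \<le> x 0"
  shows "binary_tail_seqs E = (\<Union>i<2. seq_cons i ` binary_tail_seqs E) \<union> E"
proof (intro equalityI subsetI)
  fix x assume x: "x \<in> binary_tail_seqs E"
  show "x \<in> (\<Union>i<2. seq_cons i ` binary_tail_seqs E) \<union> E"
  proof (cases "x 0 < 2")
    case True
    let ?y = "\<lambda>i. x (Suc i)"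
    have eq: "x = seq_cons (x 0) ?y" by (rule ext) (simp split: nat.split)
    have "?y \<in> binary_tail_seqs E"
    proof (cases "\<forall>i. x i < 2")
      case False
      then obtain k where k: "\<forall>i<k. x i < 2" "(\<lambda>i. x (i + k)) \<in> E"
        using x unfolding binary_tail_seqs_def by auto
      have "k \<noteq> 0" using assms[OF k(2)] True by (intro notI) simp
      then obtain l where l: "k = Suc l" by (cases k) auto
      then have "(\<forall>i<l. ?y i < 2) \<and> (\<lambda>i. ?y (i + l)) \<in> E" using k by auto
      then show ?thesis unfolding binary_tail_seqs_def by blast
    qed (simp add: binary_tail_seqs_def)
    then show ?thesis using eq True by blast
  next
    case False
    then obtain k where k: "\<forall>i<k. x i < 2" "(\<lambda>i. x (i + k)) \<in> E"
      using x unfolding binary_tail_seqs_def by auto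
    have "k = 0" using k(1) False by (cases k) auto
    then show ?thesis using k(2) by simp
  qed
next
  fix x assume "x \<in> (\<Union>i<2. seq_cons i ` binary_tail_seqs E) \<union> E"
  then show "x \<in> binary_tail_seqs E"
  proof
    assume "x \<in> E"
    then have "(\<forall>i<0. x i < 2) \<and> (\<lambda>i. x (i + 0)) \<in> E" by simp
    then show ?thesis unfolding binary_tail_seqs_def by blast
  next
    assume "x \<in> (\<Union>i<2. seq_cons i ` binary_tail_seqs E)"
    then obtain i y where i: "i < 2" "y \<in> binary_tail_seqs E" "x = seq_cons i y" by auto
    show ?thesis
    proof (cases "\<forall>i. y i < 2")
      case True
      then have "\<forall>j. x j < 2" using i by (auto split: nat.split)
      then show ?thesis by (simp add: binary_tail_seqs_def)
    next
      case False
      then obtain k where k: "\<forall>i<k. y i < 2" "(\<lambda>i. y (i + k)) \<in> E"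
        using i unfolding binary_tail_seqs_def by auto
      have "x j < 2" if "j < Suc k" for j using that i k(1) by (cases j) auto
      moreover have "(\<lambda>j. x (j + Suc k)) \<in> E" using k(2) i(3) by simp
      ultimately show ?thesis unfolding binary_tail_seqs_def by blast
    qed
  qed
qed

text \<open>The first entry that is at least \<open>2\<close> marks where the tail in \<open>E\<close> begins, and long prefixes determine it.\<close>

lemma binary_tail_seqs_closed:
  assumes "prefix_closed E" "\<And>x. x \<in> E \<Longrightarrow> 2 \<le> x 0"
  shows "prefix_closed (binary_tail_seqs E)"
  unfolding prefix_closed_def
proof (intro allI impI)
  fix x assume ap: "\<forall>n. \<exists>y\<in>binary_tail_seqs E. \<forall>i<n. x i = y i"
  show "x \<in> binary_tail_seqs E"
  proof (cases "\<forall>i. x i < 2")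
    case False
    define k where "k = (LEAST i. \<not> x i < 2)"
    have k: "\<not> x k < 2" "\<And>i. i < k \<Longrightarrow> x i < 2"
      unfolding k_def using False LeastI_ex[of "\<lambda>i. \<not> x i < 2"] not_less_Least by blast+
    have near: "\<forall>n. \<exists>y\<in>E. \<forall>i<n. x (i + k) = y i"
    proof
      fix n
      obtain y where y: "y \<in> binary_tail_seqs E" "\<And>i. i < n + Suc k \<Longrightarrow> x i = y i" using ap by meson
      have yk: "\<not> y k < 2" using y(2)[of k] k(1) by simp
      then obtain l where l: "\<forall>i<l. y i < 2" "(\<lambda>i. y (i + l)) \<in> E"
        using y(1) unfolding binary_tail_seqs_def by auto
      have "l \<le> k" using l(1) yk by (meson not_le)
      moreover have "\<not> l < k"
      proof
        assume "l < k"
        then have "y l < 2" using y(2)[of l] k(2)[of l] by simp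
        then show False using assms(2)[OF l(2)] by simp
      qed
      ultimately have "l = k" by simp
      then have "(\<lambda>i. y (i + k)) \<in> E" using l(2) by simp
      moreover have "\<forall>i<n. x (i + k) = y (i + k)" using y(2) by simp
      ultimately show "\<exists>y\<in>E. \<forall>i<n. x (i + k) = y i" by (intro bexI[of _ "\<lambda>i. y (i + k)"]) auto
    qed
    then have "(\<lambda>i. x (i + k)) \<in> E"
      using assms(1) unfolding prefix_closed_def by (elim allE[of _ "\<lambda>i. x (i + k)"]) simp
    then show ?thesis using k(2) unfolding binary_tail_seqs_def by blast
  qed (simp add: binary_tail_seqs_def)
qed

section \<open>A countable condensation set with prescribed covering numbers\<close>

text \<open>For nondecreasing \<open>q\<close> the sequence with index \<open>v\<close> starts with entries \<open>2\<close> and takes the value \<open>2 + v\<close>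
  from the first place \<open>i\<close> with \<open>v < q (Suc i)\<close> on.  Hence the first \<open>n\<close> entries tell the sequences with index
  below \<open>q n\<close> apart and agree with those of the sequence with index \<open>0\<close> for all other indices.\<close>

definition branch_seq :: "(nat \<Rightarrow> nat) \<Rightarrow> nat \<Rightarrow> nat \<Rightarrow> nat" where
  "branch_seq q v i = 2 + (if v < q (Suc i) then v else 0)"

lemma branch_seq_prefix_closed: "prefix_closed (range (branch_seq q))"
  unfolding prefix_closed_def
proof (intro allI impI)
  fix x assume ap: "\<forall>n. \<exists>y\<in>range (branch_seq q). \<forall>i<n. x i = y i"
  have ap': "\<exists>v. \<forall>i<n. x i = branch_seq q v i" for n using ap by auto
  show "x \<in> range (branch_seq q)"
  proof (cases "\<forall>i. x i = 2")
    case True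
    then have "x = branch_seq q 0" by (auto simp: branch_seq_def)
    then show ?thesis by blast
  next
    case False
    then obtain i where i: "x i \<noteq> 2" by blast
    obtain v where v: "\<forall>j<Suc i. x j = branch_seq q v j" using ap' by blast
    then have xi: "x i = branch_seq q v i" by simp
    have "x j = branch_seq q v j" for j
    proof -
      obtain w where w: "\<forall>l<Suc (max i j). x l = branch_seq q w l" using ap' by blast
      then have "x i = branch_seq q w i" "x j = branch_seq q w j" by auto
      moreover from this have "w = v" using xi i by (auto simp: branch_seq_def split: if_splits)
      ultimately show ?thesis by simp
    qed
    then have "x = branch_seq q v" by auto
    then show ?thesis by blast
  qed
qed

abbreviation example_space :: "(nat \<Rightarrow> nat) \<Rightarrow> real metric" where
  "example_space q \<equiv> seq_space (\<lambda>i. 2 + q (Suc i))"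

abbreviation branch_set :: "(nat \<Rightarrow> nat) \<Rightarrow> real set" where
  "branch_set q \<equiv> seq_code ` range (branch_seq q)"

abbreviation tail_set :: "(nat \<Rightarrow> nat) set \<Rightarrow> real set" where
  "tail_set E \<equiv> seq_code ` binary_tail_seqs E"

lemma attractor_tail_set:
  assumes "mono B" "2 \<le> B 0" "E \<subseteq> bounded_seqs B" "prefix_closed E" "\<And>x. x \<in> E \<Longrightarrow> 2 \<le> x 0"
  shows "is_attractor (seq_space B) 2 cons_map (seq_code ` E) (tail_set E)"
  unfolding is_attractor_def
proof (intro conjI)
  have "(\<lambda>_. 0) \<in> binary_tail_seqs E" by (simp add: binary_tail_seqs_def)
  then show "tail_set E \<noteq> {}" by blast
  show "compactin (mtopology_of (seq_space B)) (tail_set E)"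
    by (intro compactin_seq_space binary_tail_seqs_bounded binary_tail_seqs_closed assms)
  have "tail_set E = seq_code ` ((\<Union>i<2. seq_cons i ` binary_tail_seqs E) \<union> E)"
    by (subst binary_tail_seqs_unfold) (auto dest: assms(5))
  also have "\<dots> = (\<Union>i<2. cons_map i ` tail_set E) \<union> seq_code ` E"
    by (simp only: image_Un image_UN cons_map_image)
  finally show "tail_set E = (\<Union>i<2. cons_map i ` tail_set E) \<union> seq_code ` E" .
qed

lemma example_system:
  assumes "mono q"
  shows "inhomogeneous_system (example_space q) 2 cons_map (\<lambda>_. 1/2) (branch_set q)
           (tail_set {}) (tail_set (range (branch_seq q))) 1"
    "strong_open_set_condition (example_space q) 2 cons_map (branch_set q)
           (tail_set {}) (tail_set (range (branch_seq q)))"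
    "strong_separation_condition (example_space q) 2 cons_map (branch_set q)
           (tail_set {}) (tail_set (range (branch_seq q)))"
proof -
  let ?B = "\<lambda>i. 2 + q (Suc i)" and ?E = "range (branch_seq q)"
  have B: "mono ?B" "2 \<le> ?B 0" using assms by (auto simp: mono_def)
  have E: "?E \<subseteq> bounded_seqs ?B" by (auto simp: bounded_seqs_def branch_seq_def)
  have E0: "2 \<le> x 0" if "x \<in> ?E" for x using that by (auto simp: branch_seq_def)
  have ifs: "similarity_ifs (example_space q) 2 cons_map (\<lambda>_. 1/2)" by (rule similarity_ifs_cons_map[OF B])
  have F0: "is_attractor (example_space q) 2 cons_map {} (tail_set {})"
    using attractor_tail_set[OF B, of "{}"] by (simp add: prefix_closed_def)
  have FC: "is_attractor (example_space q) 2 cons_map (branch_set q) (tail_set ?E)"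
    by (intro attractor_tail_set B E branch_seq_prefix_closed) (rule E0)
  have C: "compactin (mtopology_of (example_space q)) (branch_set q)"
    by (rule compactin_seq_space[OF E branch_seq_prefix_closed])
  show "inhomogeneous_system (example_space q) 2 cons_map (\<lambda>_. 1/2) (branch_set q)
           (tail_set {}) (tail_set ?E) 1"
    unfolding inhomogeneous_system_def
    using compact_seq_space ifs F0 FC C by (simp add: is_similarity_dim_def)
  have disj: "disjoint_family_on (\<lambda>i. cons_map i ` U) {..<2}" for U
    unfolding disjoint_family_on_def by (auto simp: cons_map_def seq_cons_eq_iff)
  show "strong_open_set_condition (example_space q) 2 cons_map (branch_set q) (tail_set {}) (tail_set ?E)"
    unfolding strong_open_set_condition_def
  proof (intro exI conjI)
    show "openin (mtopology_of (example_space q)) (mspace (example_space q))"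
      by (metis openin_topspace topspace_mtopology_of)
    show "tail_set {} \<inter> mspace (example_space q) \<noteq> {}" using attractorD(1,2)[OF F0] by blast
    show "(\<Union>i<2. cons_map i ` mspace (example_space q)) \<subseteq> mspace (example_space q)"
      using similarity_ifsD(1)[OF ifs] by blast
  qed (rule disj)
  show "strong_separation_condition (example_space q) 2 cons_map (branch_set q) (tail_set {}) (tail_set ?E)"
    unfolding strong_separation_condition_def
  proof (intro conjI disj allI impI)
    fix i :: nat assume i: "i < 2"
    have "seq_cons i x \<noteq> branch_seq q v" for x v
      using i by (auto simp: branch_seq_def fun_eq_iff intro!: exI[of _ 0])
    then show "cons_map i ` tail_set ?E \<inter> branch_set q = {}" by (auto simp: cons_map_def)
  qed
qed

lemma branch_set_covering_number_le:
  assumes "1 \<le> q n" "mono q"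
  shows "covering_number (example_space q) ((1/2) ^ n) (branch_set q) \<le> q n"
proof -
  let ?f = "\<lambda>u i. if i < n then seq_decode u i else 0"
  have sub: "branch_set q \<subseteq> mspace (example_space q)" by (auto simp: bounded_seqs_def branch_seq_def)
  have im: "?f ` branch_set q \<subseteq> (\<lambda>v. ?f (seq_code (branch_seq q v))) ` {..<q n}"
  proof
    fix g assume "g \<in> ?f ` branch_set q"
    then obtain v where v: "g = ?f (seq_code (branch_seq q v))" by auto
    show "g \<in> (\<lambda>v. ?f (seq_code (branch_seq q v))) ` {..<q n}"
    proof (cases "v < q n")
      case False
      have "\<not> v < q (Suc i)" if "i < n" for i
        using False that monoD[OF assms(2), of "Suc i" n] by simp
      then have "g = ?f (seq_code (branch_seq q 0))" unfolding v by (auto simp: branch_seq_def)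
      moreover have "0 \<in> {..<q n}" using assms(1) by simp
      ultimately show ?thesis by blast
    qed (use v in blast)
  qed
  then have fin: "finite (?f ` branch_set q)" using finite_subset by blast
  have "colouring (example_space q) ((1/2) ^ n) (branch_set q) ?f"
    unfolding colouring_def
  proof (intro ballI impI)
    fix u u' assume "u \<in> branch_set q" "u' \<in> branch_set q" and eq: "?f u = ?f u'"
    then obtain x y where xy: "u = seq_code x" "u' = seq_code y" by blast
    have "x i = y i" if "i < n" for i using fun_cong[OF eq, of i] that xy by simp
    then show "mdist (example_space q) u u' \<le> (1/2) ^ n" using xy by (simp only: mdist_seq_space seq_dist_le_iff) simp
  qed
  then have "covering_number (example_space q) ((1/2) ^ n) (branch_set q) \<le> card (?f ` branch_set q)"
    using sub fin by (intro covering_number_le_colouring) auto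
  also have "\<dots> \<le> card ((\<lambda>v. ?f (seq_code (branch_seq q v))) ` {..<q n})" using im by (intro card_mono) auto
  also have "\<dots> \<le> q n" using card_image_le[of "{..<q n}"] by simp
  finally show ?thesis .
qed

lemma branch_set_covering_number_ge:
  assumes "0 < \<delta>" "\<delta> < (1/2) ^ m"
  shows "q (Suc m) \<le> covering_number (example_space q) \<delta> (branch_set q)"
proof -
  let ?X = "example_space q" and ?p = "\<lambda>v. seq_code (branch_seq q v)"
  have sub: "branch_set q \<subseteq> mspace ?X" by (auto simp: bounded_seqs_def branch_seq_def)
  have "q (Suc m) = (\<Sum>v<q (Suc m). 1)" by simp
  also have "\<dots> \<le> (\<Sum>v<q (Suc m). covering_number ?X \<delta> {?p v})"
    using sub by (intro sum_mono covering_number_pos compact_seq_space assms(1)) auto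
  also have "\<dots> \<le> covering_number ?X \<delta> (branch_set q)"
  proof (rule covering_number_separated[OF compact_seq_space _ _ sub assms(1)])
    fix u v x y assume uv: "u \<in> {..<q (Suc m)}" "v \<in> {..<q (Suc m)}" "u \<noteq> v" "x \<in> {?p u}" "y \<in> {?p v}"
    then have "branch_seq q u m \<noteq> branch_seq q v m" by (simp add: branch_seq_def)
    then have "\<not> seq_dist (branch_seq q u) (branch_seq q v) < (1/2) ^ m"
      unfolding seq_dist_less_iff by blast
    then show "\<delta> < mdist ?X x y" using uv assms(2) by simp
  qed auto
  finally show ?thesis .
qed

lemma tail_set_covering_number_ge:
  assumes "mono q" "0 < \<delta>" "\<delta> < 1"
  shows "2 * covering_number (example_space q) (2 * \<delta>) (tail_set (range (branch_seq q)))
    \<le> covering_number (example_space q) \<delta> (tail_set (range (branch_seq q)))"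
proof -
  let ?X = "example_space q" and ?F = "tail_set (range (branch_seq q))"
  note sys = inhomogeneous_systemD[OF example_system(1)[OF assms(1)]]
  note F = attractorD[OF sys(5)] and S = similarity_ifsD[OF sys(2)]
  have "2 * covering_number ?X (2 * \<delta>) ?F = (\<Sum>i<2::nat. covering_number ?X (\<delta> / (1/2)) ?F)"
    by (simp add: mult.commute)
  also have "\<dots> = (\<Sum>i<2. covering_number ?X \<delta> (cons_map i ` ?F))"
  proof (rule sum.cong[OF refl])
    fix i :: nat assume "i \<in> {..<2}"
    then have i: "i < 2" by simp
    show "covering_number ?X (\<delta> / (1/2)) ?F = covering_number ?X \<delta> (cons_map i ` ?F)"
      by (rule covering_number_similar_image[OF sys(1) F(2) _ _ assms(2), symmetric])
        (use S[OF i] in auto)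
  qed
  also have "\<dots> \<le> covering_number ?X \<delta> ?F"
  proof (rule covering_number_separated[OF sys(1) _ _ F(2) assms(2)])
    show "cons_map i ` ?F \<subseteq> ?F" if "i \<in> {..<2}" for i using F(6) that by blast
    fix i j x y assume ij: "i \<in> {..<2::nat}" "j \<in> {..<2}" "i \<noteq> j" "x \<in> cons_map i ` ?F" "y \<in> cons_map j ` ?F"
    then obtain a b where "x = seq_code (seq_cons i a)" "y = seq_code (seq_cons j b)"
      by (auto simp: cons_map_def)
    then show "\<delta> < mdist ?X x y" using seq_dist_eq_1[of "seq_cons i a" "seq_cons j b"] ij(3) assms(3) by simp
  qed simp
  finally show ?thesis .
qed

lemma tail_set_covering_number_le:
  assumes "mono q" "0 < \<delta>"
  shows "covering_number (example_space q) \<delta> (tail_set (range (branch_seq q)))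
    \<le> 2 * covering_number (example_space q) (2 * \<delta>) (tail_set (range (branch_seq q)))
      + covering_number (example_space q) \<delta> (branch_set q)"
proof -
  note sys = inhomogeneous_systemD[OF example_system(1)[OF assms(1)]]
  show ?thesis using attractor_covering_number_le[OF sys(1,2,5) assms(2)] by (simp add: mult.commute)
qed

section \<open>Two growth functions\<close>

text \<open>For the heights \<open>b\<close> considered below, at the places \<open>2 ^ (j^2)\<close> the height jumps to \<open>b j\<close>, stays there as long as \<open>n \<le> b j\<close> and then follows the
  diagonal until the next jump.  The bound \<open>j \<le> n\<close> keeps the maximum over a finite set.\<close>

definition jump_height :: "(nat \<Rightarrow> nat) \<Rightarrow> nat \<Rightarrow> nat" where
  "jump_height b n = Max (insert n (b ` {j. j \<le> n \<and> 2 ^ (j^2) \<le> n}))"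

definition jump_growth :: "(nat \<Rightarrow> nat) \<Rightarrow> nat \<Rightarrow> nat" where
  "jump_growth b n = 2 ^ jump_height b n"

lemma jump_height_ge: "n \<le> jump_height b n"
  unfolding jump_height_def by (intro Max_ge) auto

lemma le_two_power_square: "j \<le> 2 ^ (j^2)" for j :: nat
proof -
  have "j \<le> j^2" by (simp add: power2_eq_square)
  also have "\<dots> \<le> 2 ^ (j^2)" by (simp add: less_imp_le)
  finally show ?thesis .
qed

lemma jump_height_ge_jump: "2 ^ (j^2) \<le> n \<Longrightarrow> b j \<le> jump_height b n"
  unfolding jump_height_def using le_two_power_square[of j] by (intro Max_ge) auto

lemma jump_height_le:
  assumes "mono b" "n < 2 ^ ((Suc j)^2)"
  shows "jump_height b n \<le> max n (b j)"
  unfolding jump_height_def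
proof (rule Max.boundedI)
  fix h assume "h \<in> insert n (b ` {j. j \<le> n \<and> 2 ^ (j^2) \<le> n})"
  then show "h \<le> max n (b j)"
  proof
    assume "h \<in> b ` {j. j \<le> n \<and> 2 ^ (j^2) \<le> n}"
    then obtain i where i: "h = b i" "2 ^ (i^2) \<le> n" by auto
    have "(2::nat) ^ (i^2) < 2 ^ ((Suc j)^2)" using i(2) assms(2) by (rule le_less_trans)
    then have "i^2 < (Suc j)^2" by (rule power_less_imp_less_exp[rotated]) simp
    then have "i < Suc j" by (rule power2_less_imp_less) simp
    then have "i \<le> j" by simp
    then show ?thesis using monoD[OF assms(1)] i(1) by (simp add: le_max_iff_disj)
  qed simp
qed auto

lemma mono_jump_growth: "mono (jump_growth b)"
proof (rule monoI)
  fix m n :: nat assume mn: "m \<le> n"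
  have "jump_height b m \<le> jump_height b n"
    unfolding jump_height_def[of b m]
  proof (rule Max.boundedI)
    fix h assume "h \<in> insert m (b ` {j. j \<le> m \<and> 2 ^ (j^2) \<le> m})"
    then show "h \<le> jump_height b n"
      using mn jump_height_ge[of n b] jump_height_ge_jump[of _ n b] by auto
  qed auto
  then show "jump_growth b m \<le> jump_growth b n" by (simp add: jump_growth_def)
qed

lemma dyadic_scale:
  assumes "0 < \<delta>" "\<delta> < (1::real)"
  shows "\<exists>m. (1/2) ^ Suc m \<le> \<delta> \<and> \<delta> < (1/2) ^ m"
proof -
  let ?P = "\<lambda>n. (1/2) ^ n \<le> \<delta>"
  obtain n0 where "(1/2) ^ n0 < \<delta>" using real_arch_pow_inv[OF assms(1), of "1/2"] by auto
  then have ex: "?P n0" by simp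
  have "?P (LEAST n. ?P n)" using ex by (rule LeastI)
  moreover have "(LEAST n. ?P n) \<noteq> 0"
  proof
    assume "(LEAST n. ?P n) = 0"
    then have "?P 0" using \<open>?P (LEAST n. ?P n)\<close> by simp
    then show False using assms(2) by simp
  qed
  then obtain m where m: "(LEAST n. ?P n) = Suc m" by (cases "LEAST n. ?P n") auto
  moreover have "\<not> ?P m" using not_less_Least[of m ?P] m by simp
  ultimately show ?thesis by (intro exI[of _ m]) auto
qed

text \<open>Heights that are large compared with the place \<open>2 ^ (j^2)\<close> of the jump but do not exceed the place
  of the next one.\<close>

locale jumps =
  fixes b :: "nat \<Rightarrow> nat"
  assumes mono_b: "mono b"
    and jump_large: "2 ^ j * 2 ^ (j^2) \<le> b j"
    and jump_small: "b j \<le> 2 ^ ((Suc j)^2)"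
begin

abbreviation "X \<equiv> example_space (jump_growth b)"
abbreviation "C \<equiv> branch_set (jump_growth b)"
abbreviation "FC \<equiv> tail_set (range (branch_seq (jump_growth b)))"

lemma C_covering_number_le: "covering_number X ((1/2) ^ n) C \<le> 2 ^ jump_height b n"
  using branch_set_covering_number_le[OF _ mono_jump_growth, of b n] by (simp add: jump_growth_def)

lemma C_covering_number_ge:
  assumes "0 < \<delta>" "\<delta> < (1/2) ^ m"
  shows "2 ^ jump_height b (Suc m) \<le> covering_number X \<delta> C"
  using branch_set_covering_number_ge[OF assms, of "jump_growth b"] by (simp add: jump_growth_def)

lemma compact_X: "compact_space (mtopology_of X)"
  and C_subset: "C \<subseteq> mspace X"
  and C_nonempty: "C \<noteq> {}"
proof -
  note sys = inhomogeneous_systemD[OF example_system(1)[OF mono_jump_growth[of b]]]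
  show "compact_space (mtopology_of X)" "C \<noteq> {}" by (rule sys(1), rule sys(3))
  show "C \<subseteq> mspace X" using attractorD(2,5)[OF sys(5)] by (rule order_trans[rotated])
qed

text \<open>At the last place \<open>n\<close> before a jump the height is at most \<open>n + 1\<close>.\<close>

lemma lower_box_dim_C: "lower_box_dim X C = 1"
proof (rule antisym)
  show "1 \<le> lower_box_dim X C" unfolding one_ereal_def
  proof (rule lower_box_dim_ge[of 1])
    fix \<delta> :: real assume d: "0 < \<delta>" "\<delta> < 1"
    obtain m where m: "(1/2) ^ Suc m \<le> \<delta>" "\<delta> < (1/2) ^ m" using dyadic_scale[OF d] by blast
    have "1 * \<delta> powr (- 1) = 1 / \<delta>" using d by (simp add: powr_minus_divide)
    also have "\<dots> \<le> 1 / (1/2) ^ Suc m" using m d by (intro divide_left_mono) auto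
    also have "\<dots> = 2 ^ Suc m" by (simp add: power_divide)
    also have "\<dots> \<le> 2 ^ jump_height b (Suc m)" by (intro power_increasing jump_height_ge) auto
    also have "\<dots> \<le> real (covering_number X \<delta> C)"
      using of_nat_mono[OF C_covering_number_ge[OF d(1) m(2)], where 'a = real] by simp
    finally show "1 * \<delta> powr (- 1) \<le> real (covering_number X \<delta> C)" .
  qed simp
  have le: "lower_box_dim X C \<le> ereal t" if t: "1 < t" for t
  proof (rule lower_box_dim_le_dyadic)
    fix m
    obtain k :: nat where k: "1 / (t - 1) \<le> real k" using real_arch_simple by blast
    \<comment> \<open>Then \<open>n\<close> is the last place before a jump, and \<open>n + 1 \<le> t * n\<close> because of \<open>n \<ge> k\<close>.\<close>
    define j where "j = max (max m k) 1"
    define n :: nat where "n = 2 ^ ((Suc j)^2) - 1"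
    have "2 ^ j \<le> (2::nat) ^ ((Suc j)^2) - 1"
    proof -
      have "(2::nat) ^ Suc j \<le> 2 ^ ((Suc j)^2)" by (intro power_increasing) (auto simp: power2_eq_square)
      moreover have "(1::nat) \<le> 2 ^ j" by simp
      ultimately show ?thesis by simp
    qed
    then have jn: "j \<le> n" unfolding n_def using less_exp[of j] by linarith
    then have n: "m \<le> n" "k \<le> n" "1 \<le> n" by (auto simp: j_def)
    have lt: "n < 2 ^ ((Suc j)^2)" "Suc n = 2 ^ ((Suc j)^2)" by (simp_all add: n_def)
    have "jump_height b n \<le> Suc n" using jump_height_le[OF mono_b lt(1)] jump_small[of j] lt(2) by simp
    then have "covering_number X ((1/2) ^ n) C \<le> 2 ^ Suc n"
      using C_covering_number_le[of n] power_increasing[of "jump_height b n" "Suc n" "2::nat"] by simp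
    then have "real (covering_number X ((1/2) ^ n) C) \<le> 2 ^ Suc n"
      using of_nat_mono[where 'a = real] by fastforce
    moreover have "0 < real (covering_number X ((1/2) ^ n) C)"
      using covering_number_pos[OF compact_X C_subset _ C_nonempty, of "(1/2) ^ n"] by simp
    ultimately have "log 2 (real (covering_number X ((1/2) ^ n) C)) \<le> log 2 (2 ^ Suc n)"
      by (subst log_le_cancel_iff) auto
    also have "\<dots> = real n + 1" by (subst log_nat_power) auto
    also have "\<dots> \<le> t * real n"
    proof -
      have "1 / (t - 1) \<le> real n" using k n by linarith
      then show ?thesis using t by (simp add: field_simps)
    qed
    finally show "\<exists>n\<ge>m. 1 \<le> n \<and> log 2 (real (covering_number X ((1/2) ^ n) C)) \<le> t * real n"
      using n by blast
  qed
  show "lower_box_dim X C \<le> 1"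
  proof (rule ccontr)
    assume "\<not> ?thesis"
    then obtain t where "ereal 1 < ereal t" "ereal t < lower_box_dim X C"
      using ereal_dense2[of "ereal 1" "lower_box_dim X C"] unfolding one_ereal_def not_le by blast
    then show False using le[of t] by simp
  qed
qed

lemma upper_box_dim_C: "upper_box_dim X C = \<infinity>"
proof -
  have "ereal (real K) \<le> upper_box_dim X C" for K :: nat
  proof (rule upper_box_dim_ge_dyadic)
    fix m
    define j where "j = max m K"
    define n :: nat where "n = 2 ^ (j^2)"
    have n: "m \<le> n" "1 \<le> n" using le_two_power_square[of j] by (auto simp: n_def j_def)
    then obtain n' where n': "n = Suc n'" by (cases n) auto
    have "K \<le> 2 ^ j" using less_exp[of j] unfolding j_def by linarith
    then have "K * n \<le> 2 ^ j * 2 ^ (j^2)" by (simp add: n_def)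
    also have "\<dots> \<le> jump_height b n" using jump_large[of j] jump_height_ge_jump[of j n b] by (simp add: n_def)
    finally have Kn: "K * n \<le> jump_height b n" .
    have "(1/2 :: real) ^ n < (1/2) ^ n'" unfolding n' by (rule power_strict_decreasing) auto
    then have "2 ^ jump_height b n \<le> covering_number X ((1/2) ^ n) C"
      unfolding n' by (intro C_covering_number_ge) auto
    moreover have "(2::nat) ^ (K * n) \<le> 2 ^ jump_height b n" using Kn by (intro power_increasing) auto
    ultimately have "(2::nat) ^ (K * n) \<le> covering_number X ((1/2) ^ n) C" by (rule order_trans[rotated])
    then have "2 ^ (K * n) \<le> real (covering_number X ((1/2) ^ n) C)"
      using of_nat_mono[where 'a = real] by fastforce
    then have "log 2 (2 ^ (K * n)) \<le> log 2 (real (covering_number X ((1/2) ^ n) C))"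
      by (subst log_le_cancel_iff) (auto intro: less_le_trans[rotated])
    then have "real K * real n \<le> log 2 (real (covering_number X ((1/2) ^ n) C))"
      by (simp add: log_nat_power)
    then show "\<exists>n\<ge>m. 1 \<le> n \<and> real K * real n \<le> log 2 (real (covering_number X ((1/2) ^ n) C))"
      using n by blast
  qed
  then show ?thesis by (intro ereal_top) (metis ereal_less_eq(3) order_trans real_arch_simple)
qed

lemma countably_stable_dims_C: "hausdorff_dim X C = 0" "packing_dim X C = 0"
proof -
  have "countable C" by simp
  note C = this C_nonempty C_subset
  show "hausdorff_dim X C = 0"
    by (rule countably_stable_dim_countable_set[OF countably_stable_hausdorff_dim C])
      (rule compact_X, rule hausdorff_dim_singleton[OF compact_X])
  show "packing_dim X C = 0"
    by (rule countably_stable_dim_countable_set[OF countably_stable_packing_dim C])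
      (rule packing_dim_singleton)
qed

lemma lower_box_dim_FC_if_given_by:
  assumes "Q \<in> {no_separation, strong_open_set_condition, strong_separation_condition}"
    and "lower_box_dim_given_by Q \<phi>"
  shows "lower_box_dim X FC = \<phi> 1 \<infinity> 0 0 1 1"
proof -
  note ex = example_system[OF mono_jump_growth[of b]]
  note sys = inhomogeneous_systemD[OF ex(1)]
  have "Q X 2 cons_map C (tail_set {}) FC"
    using assms(1) ex(2,3) by (auto simp: no_separation_def)
  moreover have "has_box_dim X (tail_set {}) (ereal 1)"
    by (rule has_box_dim_homogeneous[OF sys(1,2,4,6) ex(2)])
  ultimately have "lower_box_dim X FC =
      \<phi> (lower_box_dim X C) (upper_box_dim X C) (hausdorff_dim X C) (packing_dim X C) (ereal 1) 1"
    using assms(2) ex(1) unfolding lower_box_dim_given_by_def by blast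
  then show ?thesis
    by (simp only: lower_box_dim_C upper_box_dim_C countably_stable_dims_C one_ereal_def)
qed

lemma FC_covering_number_ge_iterate:
  assumes "0 < \<delta>" "2 ^ k * \<delta> < 2"
  shows "2 ^ k * covering_number X (2 ^ k * \<delta>) FC \<le> covering_number X \<delta> FC"
  using assms
proof (induction k arbitrary: \<delta>)
  case (Suc k)
  have "1 * \<delta> \<le> 2 ^ k * \<delta>" using Suc.prems(1) by (intro mult_right_mono) auto
  moreover have "2 ^ k * \<delta> < 1" using Suc.prems(2) by simp
  ultimately have d1: "\<delta> < 1" by linarith
  have "2 ^ k * covering_number X (2 ^ k * (2 * \<delta>)) FC \<le> covering_number X (2 * \<delta>) FC"
    using Suc.prems by (intro Suc.IH) (auto simp: mult_ac)
  then show ?case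
    using tail_set_covering_number_ge[OF mono_jump_growth Suc.prems(1) d1, of b]
    by (simp add: mult_ac)
qed simp

end

lemma jumps_adjacent: "jumps (\<lambda>j. 2 ^ ((Suc j)^2))"
proof
  show "mono (\<lambda>j. 2 ^ ((Suc j)^2) :: nat)" by (intro monoI power_increasing power_mono) auto
  show "2 ^ j * 2 ^ (j^2) \<le> (2 ^ ((Suc j)^2) :: nat)" for j
    unfolding power_add[symmetric] by (intro power_increasing) (auto simp: power2_eq_square)
qed simp

lemma jumps_sparse: "jumps (\<lambda>j. 2 ^ j * 2 ^ (j^2))"
proof
  show "mono (\<lambda>j. 2 ^ j * 2 ^ (j^2) :: nat)" by (intro monoI mult_mono power_increasing power_mono) auto
  show "2 ^ j * 2 ^ (j^2) \<le> (2 ^ ((Suc j)^2) :: nat)" for j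
    unfolding power_add[symmetric] by (intro power_increasing) (auto simp: power2_eq_square)
qed simp

text \<open>Let \<open>a\<close> be the place of the last jump at or before \<open>n\<close>, and \<open>h > n\<close> its height.  The copies of \<open>C\<close> under
  words of length \<open>n - a\<close> contribute \<open>2 ^ (n - a + h)\<close> to the covering number at scale \<open>(1/2) ^ n\<close>, and
  \<open>a \<le> h / 2\<close> makes the exponent at least \<open>3/2 * n\<close>.\<close>

lemma lower_box_dim_FC_ge_adjacent_jumps:
  "ereal (3/2) \<le> lower_box_dim (example_space (jump_growth (\<lambda>j. 2 ^ ((Suc j)^2))))
     (tail_set (range (branch_seq (jump_growth (\<lambda>j. 2 ^ ((Suc j)^2))))))"
proof -
  let ?b = "\<lambda>j. 2 ^ ((Suc j)^2) :: nat"
  interpret jumps ?b by (rule jumps_adjacent)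
  note F = attractorD[OF inhomogeneous_systemD(5)[OF example_system(1)[OF mono_jump_growth[of ?b]]]]
  show ?thesis
  proof (rule lower_box_dim_ge[of 1])
    fix \<delta> :: real assume d: "0 < \<delta>" "\<delta> < 1"
    obtain m where m: "(1/2) ^ Suc m \<le> \<delta>" "\<delta> < (1/2) ^ m" using dyadic_scale[OF d] by blast
    define n where "n = Suc m"
    have "\<exists>j. 2 ^ (j^2) \<le> n \<and> n < 2 ^ ((Suc j)^2)"
    proof -
      let ?P = "\<lambda>j. n < 2 ^ (j^2)"
      have "n \<le> n^2" by (simp add: power2_eq_square)
      then have "?P n" using less_exp[of "n^2"] by linarith
      then have "?P (LEAST j. ?P j)" by (rule LeastI)
      moreover have "\<not> ?P 0" by (simp add: n_def)
      ultimately obtain j where j: "(LEAST j. ?P j) = Suc j" by (cases "LEAST j. ?P j") auto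
      then have "\<not> ?P j" using not_less_Least[of j ?P] by simp
      then show ?thesis using \<open>?P (LEAST j. ?P j)\<close> j by (intro exI[of _ j]) simp
    qed
    then obtain j where j: "2 ^ (j^2) \<le> n" "n < 2 ^ ((Suc j)^2)" by blast
    define a :: nat where "a = 2 ^ (j^2)"
    have a1: "1 \<le> a" by (simp add: a_def)
    then obtain a' where a': "a = Suc a'" by (cases a) auto
    \<comment> \<open>After \<open>k\<close> doublings the scale has moved from about \<open>(1/2) ^ n\<close> to about \<open>(1/2) ^ a\<close>, where \<open>C\<close> is large.\<close>
    define k where "k = n - a"
    have k: "n = k + a" using j(1) by (simp add: k_def a_def)
    have mk: "m = k + a'" using k a' by (simp add: n_def)
    have small: "2 ^ k * \<delta> < (1/2) ^ a'"
    proof -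
      have "2 ^ k * \<delta> < 2 ^ k * (1/2) ^ m" using m(2) by simp
      also have "\<dots> = (1/2) ^ a'" by (simp add: mk power_add power_divide)
      finally show ?thesis .
    qed
    have le2: "2 ^ k * \<delta> < 2"
    proof -
      have "(1/2 :: real) ^ a' \<le> 1" by (rule power_le_one) auto
      then show ?thesis using small by linarith
    qed
    have "2 ^ ?b j \<le> (2::nat) ^ jump_height ?b a"
      by (intro power_increasing jump_height_ge_jump) (auto simp: a_def)
    also have "\<dots> \<le> covering_number X (2 ^ k * \<delta>) C"
      unfolding a' using d small by (intro C_covering_number_ge) auto
    also have "\<dots> \<le> covering_number X (2 ^ k * \<delta>) FC"
      using d F(2,5) by (intro covering_number_antimono compact_X) auto
    finally have "2 ^ k * 2 ^ ?b j \<le> 2 ^ k * covering_number X (2 ^ k * \<delta>) FC" by simp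
    also have "\<dots> \<le> covering_number X \<delta> FC" by (rule FC_covering_number_ge_iterate[OF d(1) le2])
    finally have big: "2 ^ (k + ?b j) \<le> covering_number X \<delta> FC" by (simp add: power_add)
    have "2 * a \<le> ?b j"
    proof -
      have "2 * a = 2 ^ Suc (j^2)" by (simp add: a_def)
      also have "\<dots> \<le> 2 ^ ((Suc j)^2)" by (intro power_increasing) (auto simp: power2_eq_square)
      finally show ?thesis .
    qed
    moreover have "3 * n \<le> 2 * (k + h)" if "2 * a \<le> h" "n < h" for h :: nat
      using that k by simp
    ultimately have "3 * n \<le> 2 * (k + ?b j)" using j(2) by blast
    moreover have "3/2 * real n \<le> real h" if "3 * n \<le> 2 * h" for h
      using of_nat_mono[OF that, where 'a = real] by simp
    ultimately have exp: "3/2 * real n \<le> real (k + ?b j)" by blast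
    have "1 * \<delta> powr (- (3/2)) \<le> ((1/2) ^ n) powr (- (3/2))"
      using m(1) d unfolding n_def by (simp only: mult_1) (intro powr_mono2', auto)
    also have "\<dots> = 2 powr (3/2 * real n)"
    proof -
      have "(1/2 :: real) ^ n = inverse (2 ^ n)" by (simp only: power_one_over inverse_eq_divide)
      also have "\<dots> = 2 powr (- real n)" unfolding powr_minus by (subst powr_realpow) auto
      finally have "(1/2 :: real) ^ n = 2 powr (- real n)" .
      then show ?thesis by (simp add: powr_powr mult.commute)
    qed
    also have "\<dots> \<le> 2 powr real (k + ?b j)" using exp by (intro powr_mono) auto
    also have "\<dots> = real (2 ^ (k + ?b j))" by (subst powr_realpow) auto
    also have "\<dots> \<le> real (covering_number X \<delta> FC)" using big by (rule of_nat_mono)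
    finally show "1 * \<delta> powr (- (3/2)) \<le> real (covering_number X \<delta> FC)" .
  qed simp
qed

text \<open>Up to the next jump the covering number at scale \<open>(1/2) ^ n\<close> is at most \<open>(n + 1) * 2 ^ (n + b j)\<close>.  At the end
  of this range \<open>b j\<close> is at most \<open>(n + 1) / 32\<close> if \<open>j \<ge> 4\<close>, and the logarithm to base \<open>2\<close> is at most \<open>5/4 * n\<close>.\<close>

lemma lower_box_dim_FC_le_sparse_jumps:
  "lower_box_dim (example_space (jump_growth (\<lambda>j. 2 ^ j * 2 ^ (j^2))))
     (tail_set (range (branch_seq (jump_growth (\<lambda>j. 2 ^ j * 2 ^ (j^2)))))) \<le> ereal (5/4)"
proof -
  let ?b = "\<lambda>j. 2 ^ j * 2 ^ (j^2) :: nat"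
  interpret jumps ?b by (rule jumps_sparse)
  note F = attractorD[OF inhomogeneous_systemD(5)[OF example_system(1)[OF mono_jump_growth[of ?b]]]]
  show ?thesis
  proof (rule lower_box_dim_le_dyadic)
    fix m :: nat
    \<comment> \<open>The \<open>4\<close> makes the quotient \<open>2 ^ (j + 1)\<close> of \<open>n + 1\<close> and the last jump height at least \<open>32\<close>.\<close>
    define j where "j = max m 4"
    define n :: nat where "n = 2 ^ ((Suc j)^2) - 1"
    have Sn: "Suc n = 2 ^ ((Suc j)^2)" by (simp add: n_def)
    have bound: "covering_number X ((1/2) ^ i) FC \<le> Suc i * 2 ^ (i + ?b j)" if "i \<le> n" for i
      using that
    proof (induction i)
      case 0
      have "covering_number X 1 FC \<le> 1"
      proof (rule covering_number_small_set[OF F(2)])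
        fix x y assume "x \<in> FC" "y \<in> FC"
        then show "mdist X x y \<le> 1" using seq_dist_le_1 by auto
      qed simp
      then show ?case by (simp add: order_trans)
    next
      case (Suc i)
      have "jump_height ?b (Suc i) \<le> max (Suc i) (?b j)"
        using Suc.prems Sn by (intro jump_height_le mono_b) simp
      also have "\<dots> \<le> Suc i + ?b j" by simp
      finally have "(2::nat) ^ jump_height ?b (Suc i) \<le> 2 ^ (Suc i + ?b j)" by (intro power_increasing) auto
      then have c: "covering_number X ((1/2) ^ Suc i) C \<le> 2 ^ (Suc i + ?b j)"
        using C_covering_number_le[of "Suc i"] by (rule order_trans[rotated])
      have "covering_number X ((1/2) ^ Suc i) FC \<le> 2 * covering_number X (2 * (1/2) ^ Suc i) FC
          + covering_number X ((1/2) ^ Suc i) C"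
        by (rule tail_set_covering_number_le[OF mono_jump_growth]) simp
      also have "2 * (1/2 :: real) ^ Suc i = (1/2) ^ i" by simp
      also have "2 * covering_number X ((1/2) ^ i) FC + covering_number X ((1/2) ^ Suc i) C
          \<le> 2 * (Suc i * 2 ^ (i + ?b j)) + 2 ^ (Suc i + ?b j)"
        using Suc.IH Suc.prems c by (intro add_mono mult_left_mono) auto
      also have "\<dots> = Suc (Suc i) * 2 ^ (Suc i + ?b j)" by simp
      finally show ?case .
    qed
    have j4: "4 \<le> j" "m \<le> j" by (auto simp: j_def)
    have bn: "32 * ?b j \<le> Suc n"
    proof -
      have "32 * ?b j = 2 ^ (5 + j + j^2)" by (simp add: power_add)
      also have "\<dots> \<le> 2 ^ ((Suc j)^2)" using j4 by (intro power_increasing) (auto simp: power2_eq_square)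
      finally show ?thesis using Sn by simp
    qed
    have sq: "(Suc j)^2 \<le> 2 * ?b j"
    proof -
      have "(Suc j)^2 \<le> 2 * (j + j^2)" using j4 by (simp add: power2_eq_square)
      also have "j + j^2 \<le> 2 ^ (j + j^2)" by (simp add: less_imp_le)
      finally show ?thesis by (simp add: power_add)
    qed
    have "j < 2 ^ j" by (rule less_exp)
    also have "(2::nat) ^ j \<le> ?b j" by simp
    finally have jn: "j \<le> n" using bn by linarith
    have n1: "1 \<le> n" "m \<le> n" using jn j4 by auto
    let ?N = "covering_number X ((1/2) ^ n) FC"
    have "0 < real ?N" using covering_number_pos[OF compact_X F(2) _ F(1), of "(1/2) ^ n"] by simp
    moreover have "?N \<le> 2 ^ ((Suc j)^2 + (n + ?b j))"
      using bound[of n] Sn by (simp add: power_add)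
    then have "real ?N \<le> 2 ^ ((Suc j)^2 + (n + ?b j))"
      using of_nat_mono[where 'a = real] by fastforce
    ultimately have "log 2 (real ?N) \<le> log 2 (2 ^ ((Suc j)^2 + (n + ?b j)))"
      by (subst log_le_cancel_iff) auto
    also have "\<dots> = real ((Suc j)^2 + (n + ?b j))" by (subst log_nat_power) auto
    also have "\<dots> \<le> 5/4 * real n"
    proof -
      have "4 * (p + (n + h)) \<le> 5 * n" if "p \<le> 2 * h" "32 * h \<le> Suc n" for p h :: nat
        using that n1(1) by simp
      from this[OF sq bn] have "real (4 * ((Suc j)^2 + (n + ?b j))) \<le> real (5 * n)" by (rule of_nat_mono)
      moreover have "real q \<le> 5/4 * real n" if "real (4 * q) \<le> real (5 * n)" for q
        using that by simp
      ultimately show ?thesis by blast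
    qed
    finally show "\<exists>n\<ge>m. 1 \<le> n \<and> log 2 (real (covering_number X ((1/2) ^ n) FC)) \<le> 5/4 * real n"
      using n1 by blast
  qed
qed

section \<open>Dependence of the dimensions of an inhomogeneous attractor\<close>

theorem corollary2p12:
  shows
    \<comment> \<open>whatever separation is imposed, the lower box dimension is not a function of the numbers\<close>
    "(\<forall>Q \<in> {no_separation, strong_open_set_condition, strong_separation_condition}.
        \<not> (\<exists>\<phi>. lower_box_dim_given_by Q \<phi>)) \<and>
     \<comment> \<open>in contrast to countably stable dimensions and the upper box dimension\<close>
     (\<forall>(X :: 'a metric) N S r C F0 FC s.
        inhomogeneous_system X N S r C F0 FC s \<longrightarrow>
          countably_stable_dim X (hausdorff_dim X) \<and>
          countably_stable_dim X (packing_dim X) \<and>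
          (\<forall>dm. countably_stable_dim X dm \<longrightarrow> dm FC = max (dm F0) (dm C)) \<and>
          max (upper_box_dim X F0) (upper_box_dim X C) \<le> upper_box_dim X FC \<and>
          upper_box_dim X FC \<le> max (ereal s) (upper_box_dim X C) \<and>
          (strong_open_set_condition X N S C F0 FC \<longrightarrow>
             upper_box_dim X FC = max (upper_box_dim X F0) (upper_box_dim X C)))"
proof (intro conjI ballI allI impI)
  fix Q :: "real separation_condition"
  assume Q: "Q \<in> {no_separation, strong_open_set_condition, strong_separation_condition}"
  show "\<not> (\<exists>\<phi>. lower_box_dim_given_by Q \<phi>)"
  proof
    assume "\<exists>\<phi>. lower_box_dim_given_by Q \<phi>"
    then obtain \<phi> where "lower_box_dim_given_by Q \<phi>" ..
    note eq = jumps.lower_box_dim_FC_if_given_by[OF _ Q this]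
    have "ereal (3/2) \<le> \<phi> 1 \<infinity> 0 0 1 1"
      using lower_box_dim_FC_ge_adjacent_jumps unfolding eq[OF jumps_adjacent] .
    also have "\<dots> \<le> ereal (5/4)"
      using lower_box_dim_FC_le_sparse_jumps unfolding eq[OF jumps_sparse] .
    finally show False by simp
  qed
next
  fix X :: "'a metric" and N S r C F0 FC s
  assume sys: "inhomogeneous_system X N S r C F0 FC s"
  note sysD = inhomogeneous_systemD[OF sys]
  note F0 = attractorD[OF sysD(4)] and FC = attractorD[OF sysD(5)]
  show "countably_stable_dim X (hausdorff_dim X)" by (rule countably_stable_hausdorff_dim[OF sysD(1)])
  show "countably_stable_dim X (packing_dim X)" by (rule countably_stable_packing_dim)
  show "dm FC = max (dm F0) (dm C)" if "countably_stable_dim X dm" for dm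
    using that sys by (rule countably_stable_dim_attractor)
  show lower: "max (upper_box_dim X F0) (upper_box_dim X C) \<le> upper_box_dim X FC"
    using homogeneous_subset_attractor[OF sysD(1,2,4,5)] FC(2,5)
    by (intro max.boundedI upper_box_dim_mono[OF sysD(1)] F0(1) sysD(3))
  show upper: "upper_box_dim X FC \<le> max (ereal s) (upper_box_dim X C)"
    by (rule upper_box_dim_attractor_le_max[OF sys])
  assume "strong_open_set_condition X N S C F0 FC"
  then have eq: "upper_box_dim X F0 = ereal s"
    using has_box_dim_homogeneous[OF sysD(1,2,4,6)] unfolding has_box_dim_def by blast
  show "upper_box_dim X FC = max (upper_box_dim X F0) (upper_box_dim X C)"
    using upper lower unfolding eq by (rule antisym)
qed

end
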